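(* Let $\delta>0$ be sufficiently small, let $N^{1/2+\delta}\le Q\le N$, and let $u:=(\log N)/(\log y)$. There exists a large constant $C>0$ such that the following holds. If $$1+\frac{\log C}{\log N}\le u\le 2$$ and $N$ is large enough in terms of $\delta$, then $$V(N,Q;\mathbf{1}_{y\text{-smooth}})\gg_\delta QN\log u+Q^2 .$$
   Context: For an arithmetic function $f:\mathbb{N}\to\mathbb{C}$, a positive integer $N$ and a real number $1<Q\le N$, $$V(N,Q;f):=\sum_{q\le Q}\ \sum_{h\mid q}\ \sum_{\substack{a \bmod q\\ (a,q)=h}}\Bigg|\sum_{\substack{n\le N\\ n\equiv a \bmod q}}f(n)-\frac{1}{\varphi(q/h)}\sum_{\substack{n\le N\\ (n,q)=h}}f(n)\Bigg|^2,$$ where $\varphi$ is Euler's totient function and $(\cdot,\cdot)$ is the greatest common divisor. $\mathbf{1}_{y\text{-smooth}}$ is the indicator function of the $y$-smooth numbers, i.e. the positive integers all of whose prime factors $p$ satisfy $p\le y$. $A\gg_\delta B$ means $A\ge \kappa B$ for some constant $\kappa=\kappa(\delta)>0$. *)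

theory Defs
  imports Complex_Main "HOL-Library.Indicator_Function" "HOL-Number_Theory.Number_Theory"
begin

text \<open>
  The residue classes modulo \<open>q\<close> are represented by \<open>{..<q}\<close>; the class of \<open>0\<close> belongs to
  \<open>h = q\<close>, since \<open>gcd 0 q = q\<close>.
\<close>

definition ap_variance :: "nat \<Rightarrow> real \<Rightarrow> (nat \<Rightarrow> complex) \<Rightarrow> real" where
  "ap_variance N Q f =
    (\<Sum>q | 1 \<le> q \<and> real q \<le> Q. \<Sum>h | h dvd q. \<Sum>a | a < q \<and> gcd a q = h.
      (cmod ((\<Sum>n | 1 \<le> n \<and> n \<le> N \<and> [n = a] (mod q). f n)
        - 1 / of_nat (totient (q div h)) * (\<Sum>n | 1 \<le> n \<and> n \<le> N \<and> gcd n q = h. f n)))\<^sup>2)"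

definition smooth_numbers :: "real \<Rightarrow> nat set" where
  "smooth_numbers y = {n. n > 0 \<and> (\<forall>p. prime p \<and> p dvd n \<longrightarrow> real p \<le> y)}"

end

theory Submission
  imports Defs "HOL-Analysis.Analysis" "HOL-Computational_Algebra.Squarefree" "HOL-Real_Asymp.Real_Asymp"
begin

text \<open>
  By Cauchy--Schwarz, every family \<open>w q\<close> of functions on the residues modulo \<open>q\<close> that is orthogonal to
  the functions of \<open>gcd a q\<close> bounds the variance from below by
  \<open>(\<Sum>q. \<Sum>n\<le>N. f n * w q n)\<^sup>2 / \<parallel>w\<parallel>\<^sup>2\<close>. Odd functions are orthogonal to functions of \<open>gcd a q\<close>, so no mean
  values have to be estimated. Write \<open>f = 1 - g\<close>, where \<open>g\<close> is supported on the \<open>n = p * m\<close> with a prime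
  \<open>p > y\<close>, and \<open>t = ln (N / y) / ln N\<close>, which has the order of \<open>ln u\<close>.

  If \<open>Q\<close> is large compared with \<open>N * t\<close>, then \<open>g\<close> is negligible and a square wave detects the fractional
  parts of \<open>N / q\<close>; this gives \<open>Q\<^sup>2\<close>. If \<open>Q\<close> is small compared with \<open>N * t\<close>, then \<open>w q\<close> is a combination of
  sines with frequencies \<open>b / q\<close> lying just to the right of fractions \<open>a / r\<close>, where \<open>r\<close> is a little
  smaller than \<open>sqrt N\<close>, has one large prime factor, and has no other prime factor up to \<open>N / y\<close>. Since
  \<open>Q \<ge> N powr (1 / 2 + \<delta>)\<close>, these frequencies are equidistributed near each \<open>a / r\<close>, up to an error
  controlled by the dual large sieve, so \<open>w\<close> correlates with \<open>g\<close> like a weighted sum of the Ramanujan sums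
  of \<open>n\<close> modulo \<open>r\<close>, which have constant sign on almost all of the support of \<open>g\<close>; this gives
  \<open>Q * N * t\<close>. The intermediate range follows because the variance is increasing in \<open>Q\<close>.
\<close>

section \<open>Duality for the variance\<close>

text \<open>At an exact fraction \<open>a / r\<close> sines are useless, since they cancel over the
  totatives of \<open>r\<close>. Shifted by \<open>\<beta> > 0\<close> they add up to the Ramanujan
  sum times \<open>sin (2 * pi * n * \<beta>)\<close>, and that sine is nonnegative for all
  \<open>n \<le> N\<close> if \<open>\<beta> \<le> 1 / (4 * N)\<close>. Frequencies being multiples
  of \<open>1 / q\<close>, such shifts require \<open>r * q \<ge> 4 * N\<close>, while the large
  sieve wants fractions spaced by \<open>1 / N\<close>, hence \<open>r \<le> sqrt N\<close>; both
  fit because \<open>Q\<close> exceeds \<open>sqrt N\<close> by a power of \<open>N\<close>. Up to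
  constants the method yields \<open>H * t\<close> times \<open>Q * N * t\<close>, where
  \<open>H\<close> is the sum of \<open>1 / totient r\<close> over the \<open>r\<close> used, so
  \<open>H\<close> has to reach \<open>1 / t\<close>. A harmonic sum up to a power of
  \<open>N\<close>, sifted by the primes up to \<open>M = N / y\<close>, has order
  \<open>ln N / ln M = 1 / t\<close>; one additional prime \<open>p\<close> moves \<open>r\<close>
  close to \<open>sqrt N\<close> at the cost of a constant. Multiples of \<open>p\<close> have the
  wrong sign with weight \<open>p - 1\<close>. The support of \<open>g\<close> contains none of them
  if \<open>p > M\<close>; otherwise \<open>t \<ge> 1 / 4\<close> and
  \<open>M / p \<le> N powr (\<delta> / 2)\<close>, which makes their share small only for small
  \<open>\<delta>\<close>.\<close>

lemma ap_variance_eq_sum_classes: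
  "ap_variance N Q f = (\<Sum>q | 1 \<le> q \<and> real q \<le> Q. \<Sum>a<q.
      (cmod ((\<Sum>n | 1 \<le> n \<and> n \<le> N \<and> [n = a] (mod q). f n)
        - 1 / of_nat (totient (q div gcd a q)) * (\<Sum>n | 1 \<le> n \<and> n \<le> N \<and> gcd n q = gcd a q. f n)))\<^sup>2)"
  unfolding ap_variance_def
proof (rule sum.cong[OF refl])
  fix q assume "q \<in> {q. 1 \<le> q \<and> real q \<le> Q}"
  then have q: "q > 0" by auto
  let ?F = "\<lambda>a h. (cmod ((\<Sum>n | 1 \<le> n \<and> n \<le> N \<and> [n = a] (mod q). f n)
        - 1 / of_nat (totient (q div h)) * (\<Sum>n | 1 \<le> n \<and> n \<le> N \<and> gcd n q = h. f n)))\<^sup>2"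
  have "(\<Sum>h | h dvd q. \<Sum>a | a < q \<and> gcd a q = h. ?F a h)
      = (\<Sum>h | h dvd q. \<Sum>a | a \<in> {..<q} \<and> gcd a q = h. ?F a (gcd a q))"
    by (intro sum.cong) auto
  also have "\<dots> = (\<Sum>a<q. ?F a (gcd a q))"
    using q by (intro sum.group) auto
  finally show "(\<Sum>h | h dvd q. \<Sum>a | a < q \<and> gcd a q = h. ?F a h) = (\<Sum>a<q. ?F a (gcd a q))" .
qed

lemma ap_variance_nonneg: "ap_variance N Q f \<ge> 0"
  unfolding ap_variance_def by (intro sum_nonneg) auto

lemma finite_moduli: "finite {q::nat. 1 \<le> q \<and> real q \<le> Q}"
  by (rule finite_subset[of _ "{..nat \<lfloor>Q\<rfloor>}"]) (auto simp: le_nat_iff le_floor_iff)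

lemma ap_variance_mono:
  assumes "Q \<le> Q'"
  shows "ap_variance N Q f \<le> ap_variance N Q' f"
  unfolding ap_variance_eq_sum_classes using assms
  by (intro sum_mono2 finite_moduli) (auto intro!: sum_nonneg)

text \<open>The involution \<open>a \<mapsto> - a\<close> modulo \<open>q\<close> preserves
  \<open>gcd a q\<close> and changes the sign of \<open>w\<close>. The residue \<open>0\<close> is a
  fixed point, hence \<open>(q - a) mod q\<close> instead of \<open>q - a\<close>.\<close>

lemma sum_odd_mult_gcd_eq_0:
  fixes w \<phi> :: "nat \<Rightarrow> real"
  assumes q: "q > 0" and odd: "\<And>a. a < q \<Longrightarrow> w ((q - a) mod q) = - w a"
  shows "(\<Sum>a<q. w a * \<phi> (gcd a q)) = 0"
proof -
  have inv: "(q - (q - a) mod q) mod q = a" if "a < q" for a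
    using that by (cases "a = 0") auto
  have "(\<Sum>a<q. w a * \<phi> (gcd a q)) = (\<Sum>a<q. w ((q - a) mod q) * \<phi> (gcd ((q - a) mod q) q))"
    using q inv by (intro sum.reindex_bij_witness[of _ "\<lambda>a. (q - a) mod q" "\<lambda>a. (q - a) mod q"]) auto
  also have "\<dots> = (\<Sum>a<q. - (w a * \<phi> (gcd a q)))"
  proof (rule sum.cong[OF refl])
    fix a assume "a \<in> {..<q}"
    then have a: "a < q" by simp
    have "gcd ((q - a) mod q) q = gcd a q"
      using a by (metis gcd.commute gcd_diff1_nat gcd_red_nat less_imp_le_nat gcd_diff2_nat)
    then show "w ((q - a) mod q) * \<phi> (gcd ((q - a) mod q) q) = - (w a * \<phi> (gcd a q))"
      using odd[OF a] by simp
  qed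
  finally show ?thesis by (simp add: sum_negf)
qed

lemma Cauchy_Schwarz_residues:
  fixes d w :: "nat \<Rightarrow> nat \<Rightarrow> real"
  assumes "finite D"
  shows "(\<Sum>q\<in>D. \<Sum>a<q. d q a * w q a)\<^sup>2 \<le> (\<Sum>q\<in>D. \<Sum>a<q. (d q a)\<^sup>2) * (\<Sum>q\<in>D. \<Sum>a<q. (w q a)\<^sup>2)"
  using Cauchy_Schwarz_ineq_sum[of "\<lambda>z. d (fst z) (snd z)" "\<lambda>z. w (fst z) (snd z)" "Sigma D (\<lambda>q. {..<q})"] assms
  by (simp add: sum.Sigma case_prod_beta)

text \<open>Odd test functions are orthogonal to every function of \<open>gcd a q\<close>, so the mean values
  subtracted in the variance drop out of the scalar product.\<close>

lemma sum_odd_test_function: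
  fixes f w \<phi> :: "nat \<Rightarrow> real"
  assumes q: "q > 0" and odd: "\<And>a. a < q \<Longrightarrow> w ((q - a) mod q) = - w a"
  shows "(\<Sum>n=1..N. f n * w (n mod q))
    = (\<Sum>a<q. ((\<Sum>n | 1 \<le> n \<and> n \<le> N \<and> [n = a] (mod q). f n) - \<phi> (gcd a q)) * w a)"
proof -
  have "(\<Sum>n=1..N. f n * w (n mod q)) = (\<Sum>a<q. \<Sum>n | n \<in> {1..N} \<and> n mod q = a. f n * w (n mod q))"
    using q by (intro sum.group[symmetric]) auto
  also have "\<dots> = (\<Sum>a<q. (\<Sum>n | 1 \<le> n \<and> n \<le> N \<and> [n = a] (mod q). f n) * w a)"
    unfolding sum_distrib_right by (intro sum.cong refl) (auto simp: Cong.cong_def)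
  finally show ?thesis
    using sum_odd_mult_gcd_eq_0[of q w \<phi>, OF q odd]
    by (simp add: left_diff_distrib right_diff_distrib sum_subtractf mult.commute)
qed

text \<open>The deviations \<open>d\<close> have the same scalar product with an odd
  \<open>w\<close> as \<open>f\<close> itself, so Cauchy-Schwarz bounds the correlation of
  \<open>f\<close> with \<open>w\<close>. Moduli outside \<open>D\<close> only add squares to the
  variance.\<close>

lemma variance_duality:
  fixes f :: "nat \<Rightarrow> real" and w :: "nat \<Rightarrow> nat \<Rightarrow> real"
  assumes D: "\<And>q. q \<in> D \<Longrightarrow> 1 \<le> q \<and> real q \<le> Q"
    and odd: "\<And>q a. q \<in> D \<Longrightarrow> a < q \<Longrightarrow> w q ((q - a) mod q) = - w q a"
  shows "(\<Sum>q\<in>D. \<Sum>n=1..N. f n * w q (n mod q))\<^sup>2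
    \<le> ap_variance N Q (\<lambda>n. of_real (f n)) * (\<Sum>q\<in>D. \<Sum>a<q. (w q a)\<^sup>2)"
proof -
  have sub: "D \<subseteq> {q. 1 \<le> q \<and> real q \<le> Q}" using D by auto
  then have fin: "finite D" using finite_moduli finite_subset by blast
  define S where "S q a = (\<Sum>n | 1 \<le> n \<and> n \<le> N \<and> [n = a] (mod q). f n)" for q a
  define m where "m q h = 1 / real (totient (q div h)) * (\<Sum>n | 1 \<le> n \<and> n \<le> N \<and> gcd n q = h. f n)" for q h
  define d where "d q a = S q a - m q (gcd a q)" for q a
  have cm: "(cmod ((\<Sum>n | 1 \<le> n \<and> n \<le> N \<and> [n = a] (mod q). of_real (f n))
        - 1 / of_nat (totient (q div gcd a q)) * (\<Sum>n | 1 \<le> n \<and> n \<le> N \<and> gcd n q = gcd a q. of_real (f n))))\<^sup>2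
      = (d q a)\<^sup>2" for q a
  proof -
    have "(\<Sum>n | 1 \<le> n \<and> n \<le> N \<and> [n = a] (mod q). of_real (f n))
        - 1 / of_nat (totient (q div gcd a q)) * (\<Sum>n | 1 \<le> n \<and> n \<le> N \<and> gcd n q = gcd a q. of_real (f n))
        = (of_real (d q a) :: complex)"
      by (simp add: d_def S_def m_def)
    then show ?thesis by (simp only: norm_of_real power2_abs)
  qed
  have "ap_variance N Q (\<lambda>n. of_real (f n)) = (\<Sum>q | 1 \<le> q \<and> real q \<le> Q. \<Sum>a<q. (d q a)\<^sup>2)"
    unfolding ap_variance_eq_sum_classes cm ..
  also have "\<dots> \<ge> (\<Sum>q\<in>D. \<Sum>a<q. (d q a)\<^sup>2)"
    by (intro sum_mono2 finite_moduli sub) (auto intro!: sum_nonneg)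
  finally have V: "(\<Sum>q\<in>D. \<Sum>a<q. (d q a)\<^sup>2) \<le> ap_variance N Q (\<lambda>n. of_real (f n))" .
  have "(\<Sum>n=1..N. f n * w q (n mod q)) = (\<Sum>a<q. d q a * w q a)" if q: "q \<in> D" for q
    unfolding d_def S_def using D[OF q] odd[OF q] by (intro sum_odd_test_function) auto
  then have "(\<Sum>q\<in>D. \<Sum>n=1..N. f n * w q (n mod q)) = (\<Sum>q\<in>D. \<Sum>a<q. d q a * w q a)"
    by simp
  also have "\<dots>\<^sup>2 \<le> (\<Sum>q\<in>D. \<Sum>a<q. (d q a)\<^sup>2) * (\<Sum>q\<in>D. \<Sum>a<q. (w q a)\<^sup>2)"
    by (rule Cauchy_Schwarz_residues[OF fin])
  also have "\<dots> \<le> ap_variance N Q (\<lambda>n. of_real (f n)) * (\<Sum>q\<in>D. \<Sum>a<q. (w q a)\<^sup>2)"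
    by (intro mult_right_mono V sum_nonneg) auto
  finally show ?thesis .
qed

section \<open>The dual large sieve\<close>

lemma cis_2pi_int: "cis (2 * pi * of_int k) = 1"
  using cis_multiple_2pi[of "of_int k"] by simp

lemma norm_cis_minus_1: "cmod (cis (2 * x) - 1) = 2 * \<bar>sin x\<bar>"
proof -
  have "(cmod (cis (2 * x) - 1))\<^sup>2 = (cos (2 * x) - 1)\<^sup>2 + (sin (2 * x))\<^sup>2"
    by (simp add: cmod_power2)
  also have "\<dots> = (sin (2 * x))\<^sup>2 + (cos (2 * x))\<^sup>2 + 1 - 2 * cos (2 * x)"
    by (simp add: power2_eq_square algebra_simps)
  also have "\<dots> = 2 - 2 * cos (2 * x)"
    by simp
  also have "\<dots> = (2 * \<bar>sin x\<bar>)\<^sup>2"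
    by (simp add: cos_double_sin power_mult_distrib)
  finally show ?thesis
    by (rule power2_eq_imp_eq) auto
qed

text \<open>Jordan's inequality: the concave sine lies above its chord on
  \<open>{0..pi/2}\<close>.\<close>

lemma sin_pi_ge:
  assumes "0 \<le> x" "x \<le> 1 / 2"
  shows "sin (pi * x) \<ge> 2 * x"
proof -
  have "concave_on {0..pi/2} sin"
  proof (rule f''_le0_imp_concave[where f' = cos and f'' = "\<lambda>x. - sin x"])
    fix x :: real assume "x \<in> {0..pi/2}"
    then show "- sin x \<le> 0" using sin_ge_zero[of x] by auto
  qed (auto intro!: derivative_eq_intros)
  then have "sin ((1 - 2 * x) * 0 + (2 * x) * (pi / 2)) \<ge> (1 - 2 * x) * sin 0 + (2 * x) * sin (pi / 2)"
    using assms concave_onD[of "{0..pi/2}" sin "2*x" 0 "pi/2"] by (simp add: algebra_simps)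
  then show ?thesis by (simp add: algebra_simps)
qed

text \<open>The left half follows from Jordan's inequality, the right half by
  \<open>x \<mapsto> 1 - x\<close>. A sum instead of the larger term lets the distances to
  \<open>0\<close> and to \<open>1\<close> be summed separately.\<close>

lemma inverse_sin_pi_squared_le:
  assumes "0 < x" "x < 1"
  shows "1 / (sin (pi * x))\<^sup>2 \<le> 1 / (4 * x\<^sup>2) + 1 / (4 * (1 - x)\<^sup>2)"
proof -
  have *: "1 / (sin (pi * z))\<^sup>2 \<le> 1 / (4 * z\<^sup>2)" if z: "0 < z" "z \<le> 1/2" for z :: real
  proof -
    have "(2 * z)\<^sup>2 \<le> (sin (pi * z))\<^sup>2" using sin_pi_ge[of z] z by (intro power_mono) auto
    moreover have "0 < (2 * z)\<^sup>2" using z by simp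
    ultimately have "1 / (sin (pi * z))\<^sup>2 \<le> 1 / (2 * z)\<^sup>2" by (intro frac_le) auto
    then show ?thesis by (simp add: power_mult_distrib)
  qed
  show ?thesis
  proof (cases "x \<le> 1/2")
    case True
    moreover have "0 \<le> 1 / (4 * (1 - x)\<^sup>2)" by simp
    ultimately show ?thesis using *[of x] assms by linarith
  next
    case False
    have "sin (pi * (1 - x)) = sin (pi * x)"
      by (simp add: algebra_simps sin_diff)
    then have "1 / (sin (pi * x))\<^sup>2 \<le> 1 / (4 * (1 - x)\<^sup>2)"
      using *[of "1 - x"] False assms by simp
    moreover have "0 \<le> 1 / (4 * x\<^sup>2)" by simp
    ultimately show ?thesis by linarith
  qed
qed

lemma sum_inverse_squares_le: "(\<Sum>k=1..K. 1 / (real k)\<^sup>2) \<le> 2"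
proof -
  \<comment> \<open>Subtracting \<open>1 / Suc K\<close> strengthens the claim so that the induction
    telescopes.\<close>
  have "(\<Sum>k=1..Suc K. 1 / (real k)\<^sup>2) \<le> 2 - 1 / real (Suc K)" for K
  proof (induction K)
    case (Suc K)
    have "1 / (real (Suc (Suc K)))\<^sup>2 \<le> 1 / (real (Suc K) * real (Suc (Suc K)))"
      unfolding power2_eq_square by (intro divide_left_mono mult_right_mono) auto
    also have "\<dots> = 1 / real (Suc K) - 1 / real (Suc (Suc K))"
      by (simp add: field_simps)
    finally show ?case using Suc by simp
  qed simp
  from this[of K] have "(\<Sum>k=1..Suc K. 1 / (real k)\<^sup>2) \<le> 2"
    by (rule order_trans) simp
  moreover have "(\<Sum>k=1..K. 1 / (real k)\<^sup>2) \<le> (\<Sum>k=1..Suc K. 1 / (real k)\<^sup>2)"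
    by (intro sum_mono2) auto
  ultimately show ?thesis by (rule order_trans[rotated])
qed

text \<open>The integer parts of \<open>N * x i\<close> are positive and distinct, so the sum is
  dominated by the sum of \<open>N^2 / k^2\<close>.\<close>

lemma sum_inverse_squares_separated_le:
  fixes x :: "'i \<Rightarrow> real"
  assumes fin: "finite I" and N: "N > 0"
    and ge: "\<And>i. i \<in> I \<Longrightarrow> x i \<ge> 1 / N"
    and sep: "\<And>i j. i \<in> I \<Longrightarrow> j \<in> I \<Longrightarrow> i \<noteq> j \<Longrightarrow> \<bar>x i - x j\<bar> \<ge> 1 / N"
  shows "(\<Sum>i\<in>I. 1 / (x i)\<^sup>2) \<le> 2 * N\<^sup>2"
proof -
  define k where "k i = nat \<lfloor>N * x i\<rfloor>" for i
  have N1: "N * x i \<ge> 1" if "i \<in> I" for i using ge[OF that] N by (simp add: field_simps)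
  have k1: "k i \<ge> 1" if "i \<in> I" for i using N1[OF that] by (simp add: k_def le_nat_iff le_floor_iff)
  have kle: "real (k i) \<le> N * x i" if "i \<in> I" for i using N1[OF that] by (simp add: k_def)
  have klt: "N * x i < real (k i) + 1" if "i \<in> I" for i using N1[OF that] unfolding k_def by linarith
  have inj: "inj_on k I"
  proof (rule inj_onI, rule ccontr)
    fix i j assume ij: "i \<in> I" "j \<in> I" "k i = k j" "i \<noteq> j"
    have "\<bar>N * x i - N * x j\<bar> < 1"
      using kle[OF ij(1)] kle[OF ij(2)] klt[OF ij(1)] klt[OF ij(2)] ij(3) by linarith
    moreover have "\<bar>N * x i - N * x j\<bar> = N * \<bar>x i - x j\<bar>"
      using N by (simp add: abs_mult flip: right_diff_distrib)
    ultimately show False using sep[OF ij(1,2,4)] N by (simp add: field_simps)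
  qed
  obtain K where K: "\<And>i. i \<in> I \<Longrightarrow> k i \<le> K"
    using finite_nat_set_iff_bounded_le[of "k ` I"] fin by auto
  have "(\<Sum>i\<in>I. 1 / (x i)\<^sup>2) \<le> (\<Sum>i\<in>I. N\<^sup>2 * (1 / (real (k i))\<^sup>2))"
  proof (rule sum_mono)
    fix i assume i: "i \<in> I"
    have "(real (k i))\<^sup>2 \<le> (N * x i)\<^sup>2" using kle[OF i] by (intro power_mono) auto
    moreover have "(real (k i))\<^sup>2 > 0" using k1[OF i] by auto
    moreover have "x i > 0" using ge[OF i] N by (smt (verit) divide_pos_pos)
    ultimately show "1 / (x i)\<^sup>2 \<le> N\<^sup>2 * (1 / (real (k i))\<^sup>2)"
      using N by (simp add: field_simps power_mult_distrib)
  qed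
  also have "\<dots> = N\<^sup>2 * (\<Sum>k\<in>k ` I. 1 / (real k)\<^sup>2)"
    using inj by (simp add: sum.reindex sum_distrib_left)
  also have "\<dots> \<le> N\<^sup>2 * (\<Sum>k=1..K. 1 / (real k)\<^sup>2)"
    using k1 K by (intro mult_left_mono sum_mono2) auto
  also have "\<dots> \<le> N\<^sup>2 * 2"
    by (intro mult_left_mono sum_inverse_squares_le) auto
  finally show ?thesis by simp
qed

lemma norm_geometric_cis_squared_le:
  assumes "sin (pi * \<theta>) \<noteq> 0"
  shows "(cmod (\<Sum>l<L. cis (2 * pi * real l * \<theta>)))\<^sup>2 \<le> 1 / (sin (pi * \<theta>))\<^sup>2"
proof -
  let ?z = "cis (2 * (pi * \<theta>))"
  have n: "cmod (?z - 1) = 2 * \<bar>sin (pi * \<theta>)\<bar>" by (rule norm_cis_minus_1)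
  then have "?z \<noteq> 1" using assms by (metis norm_eq_zero right_minus_eq mult_eq_0_iff abs_eq_0 zero_neq_numeral)
  have "(\<Sum>l<L. cis (2 * pi * real l * \<theta>)) = (\<Sum>l<L. ?z ^ l)"
    by (intro sum.cong refl) (simp add: Complex.DeMoivre mult_ac)
  also have "\<dots> = (?z ^ L - 1) / (?z - 1)"
    using \<open>?z \<noteq> 1\<close> by (simp add: geometric_sum)
  also have "cmod \<dots> \<le> 2 / cmod (?z - 1)"
    unfolding norm_divide using norm_triangle_ineq4[of "?z ^ L" 1]
    by (intro divide_right_mono) (auto simp: norm_power)
  also have "\<dots> = 1 / \<bar>sin (pi * \<theta>)\<bar>" using n by simp
  finally have "(cmod (\<Sum>l<L. cis (2 * pi * real l * \<theta>)))\<^sup>2 \<le> (1 / \<bar>sin (pi * \<theta>)\<bar>)\<^sup>2"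
    by (intro power_mono) auto
  then show ?thesis by (simp add: power_divide)
qed

text \<open>The row sum for Schur's test. The diagonal contributes \<open>4 * N^2\<close>; the other
  differences, reduced to the unit interval by \<open>frac\<close>, keep distance
  \<open>1 / N\<close> from both ends and from one another, and contribute at most
  \<open>N^2\<close> in total.\<close>

lemma large_sieve_kernel_row:
  fixes \<alpha> :: "'i \<Rightarrow> real" and N :: nat
  assumes fin: "finite I" and N: "N > 0" and i: "i \<in> I"
    and sep: "\<And>i j k. i \<in> I \<Longrightarrow> j \<in> I \<Longrightarrow> i \<noteq> j \<Longrightarrow> \<bar>\<alpha> i - \<alpha> j - of_int k\<bar> \<ge> 1 / real N"
  shows "(\<Sum>j\<in>I. (cmod (\<Sum>l<2*N. cis (2 * pi * real l * (\<alpha> i - \<alpha> j))))\<^sup>2) \<le> 5 * (real N)\<^sup>2"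
proof -
  let ?K = "\<lambda>j. (cmod (\<Sum>l<2*N. cis (2 * pi * real l * (\<alpha> i - \<alpha> j))))\<^sup>2"
  define x where "x j = frac (\<alpha> i - \<alpha> j)" for j
  have x_eq: "x j = \<alpha> i - \<alpha> j - of_int \<lfloor>\<alpha> i - \<alpha> j\<rfloor>" for j by (simp add: x_def frac_def)
  have x01: "x j \<ge> 0" "x j < 1" for j by (simp_all add: x_def frac_lt_1)
  let ?I = "I - {i}"
  have x1: "x j \<ge> 1 / real N" if "j \<in> ?I" for j
    using sep[of i j "\<lfloor>\<alpha> i - \<alpha> j\<rfloor>"] that i x01(1)[of j] by (auto simp: x_eq)
  have x2: "1 - x j \<ge> 1 / real N" if "j \<in> ?I" for j
    using sep[of i j "\<lfloor>\<alpha> i - \<alpha> j\<rfloor> + 1"] that i x01(2)[of j] by (auto simp: x_eq)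
  have x3: "\<bar>x j - x k\<bar> \<ge> 1 / real N" if "j \<in> ?I" "k \<in> ?I" "j \<noteq> k" for j k
    using sep[of k j "\<lfloor>\<alpha> i - \<alpha> j\<rfloor> - \<lfloor>\<alpha> i - \<alpha> k\<rfloor>"] that by (auto simp: x_eq algebra_simps)
  have s1: "(\<Sum>j\<in>?I. 1 / (x j)\<^sup>2) \<le> 2 * (real N)\<^sup>2"
    using fin N x1 x3 by (intro sum_inverse_squares_separated_le) auto
  have s2: "(\<Sum>j\<in>?I. 1 / (1 - x j)\<^sup>2) \<le> 2 * (real N)\<^sup>2"
    using fin N x2 x3 by (intro sum_inverse_squares_separated_le) (auto simp: abs_minus_commute)
  have "?K j \<le> 1 / 4 * (1 / (x j)\<^sup>2) + 1 / 4 * (1 / (1 - x j)\<^sup>2)" if j: "j \<in> ?I" for j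
  proof -
    have pos: "0 < x j" "x j < 1" using x1[OF j] x2[OF j] N order.strict_trans2[of 0 "1 / real N"] by (simp_all, smt (verit))
    have "pi * x j < pi * 1" using pos by (intro mult_strict_left_mono) auto
    then have s0: "sin (pi * x j) > 0" using pos by (intro sin_gt_zero) auto
    have "cis (2 * pi * real l * (\<alpha> i - \<alpha> j)) = cis (2 * pi * real l * x j)" for l
    proof -
      have "2 * pi * real l * (\<alpha> i - \<alpha> j) = 2 * pi * real l * x j + 2 * pi * of_int (int l * \<lfloor>\<alpha> i - \<alpha> j\<rfloor>)"
        by (simp add: x_eq algebra_simps)
      then show ?thesis by (simp add: cis_mult[symmetric] cis_2pi_int del: of_int_mult)
    qed
    then have "?K j = (cmod (\<Sum>l<2*N. cis (2 * pi * real l * x j)))\<^sup>2" by simp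
    also have "\<dots> \<le> 1 / (sin (pi * x j))\<^sup>2"
      using s0 by (intro norm_geometric_cis_squared_le) auto
    also have "\<dots> \<le> 1 / (4 * (x j)\<^sup>2) + 1 / (4 * (1 - x j)\<^sup>2)"
      by (rule inverse_sin_pi_squared_le) fact+
    finally show ?thesis by simp
  qed
  then have "(\<Sum>j\<in>?I. ?K j) \<le> (\<Sum>j\<in>?I. 1 / 4 * (1 / (x j)\<^sup>2) + 1 / 4 * (1 / (1 - x j)\<^sup>2))"
    by (rule sum_mono)
  also have "\<dots> = 1 / 4 * (\<Sum>j\<in>?I. 1 / (x j)\<^sup>2) + 1 / 4 * (\<Sum>j\<in>?I. 1 / (1 - x j)\<^sup>2)"
    by (simp add: sum.distrib sum_distrib_left)
  also have "\<dots> \<le> (real N)\<^sup>2" using s1 s2 by simp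
  finally have "(\<Sum>j\<in>?I. ?K j) \<le> (real N)\<^sup>2" .
  moreover have "(\<Sum>j\<in>I. ?K j) = ?K i + (\<Sum>j\<in>?I. ?K j)"
    using fin i by (intro sum.remove) auto
  moreover have "?K i = 4 * (real N)\<^sup>2" by (simp add: power_mult_distrib)
  ultimately show ?thesis by simp
qed

text \<open>Schur's test: the product of two moduli is at most half the sum of their squares, and
  the two halves agree by symmetry.\<close>

lemma hermitian_form_le:
  fixes c :: "'i \<Rightarrow> complex" and K :: "'i \<Rightarrow> 'i \<Rightarrow> real"
  assumes sym: "\<And>i j. K i j = K j i" and nn: "\<And>i j. K i j \<ge> 0"
    and row: "\<And>i. i \<in> I \<Longrightarrow> (\<Sum>j\<in>I. K i j) \<le> B"
  shows "(\<Sum>i\<in>I. \<Sum>j\<in>I. cmod (c i) * cmod (c j) * K i j) \<le> B * (\<Sum>i\<in>I. (cmod (c i))\<^sup>2)"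
proof -
  have "(\<Sum>i\<in>I. \<Sum>j\<in>I. cmod (c i) * cmod (c j) * K i j)
      \<le> (\<Sum>i\<in>I. \<Sum>j\<in>I. (cmod (c i))\<^sup>2 / 2 * K i j + (cmod (c j))\<^sup>2 / 2 * K i j)"
  proof (intro sum_mono)
    fix i j
    have "2 * (cmod (c i) * cmod (c j)) \<le> (cmod (c i))\<^sup>2 + (cmod (c j))\<^sup>2"
      using sum_squares_bound[of "cmod (c i)" "cmod (c j)"] by simp
    then have "(cmod (c i) * cmod (c j)) * K i j \<le> ((cmod (c i))\<^sup>2 / 2 + (cmod (c j))\<^sup>2 / 2) * K i j"
      by (intro mult_right_mono nn) simp
    then show "cmod (c i) * cmod (c j) * K i j \<le> (cmod (c i))\<^sup>2 / 2 * K i j + (cmod (c j))\<^sup>2 / 2 * K i j"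
      by (simp add: distrib_right)
  qed
  also have "\<dots> = (\<Sum>i\<in>I. \<Sum>j\<in>I. (cmod (c i))\<^sup>2 / 2 * K i j) + (\<Sum>i\<in>I. \<Sum>j\<in>I. (cmod (c j))\<^sup>2 / 2 * K i j)"
    by (simp add: sum.distrib)
  also have "(\<Sum>i\<in>I. \<Sum>j\<in>I. (cmod (c j))\<^sup>2 / 2 * K i j) = (\<Sum>i\<in>I. \<Sum>j\<in>I. (cmod (c i))\<^sup>2 / 2 * K i j)"
    by (subst sum.swap) (simp add: sym)
  also have "(\<Sum>i\<in>I. \<Sum>j\<in>I. (cmod (c i))\<^sup>2 / 2 * K i j) + (\<Sum>i\<in>I. \<Sum>j\<in>I. (cmod (c i))\<^sup>2 / 2 * K i j)
      = (\<Sum>i\<in>I. (cmod (c i))\<^sup>2 * (\<Sum>j\<in>I. K i j))"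
    unfolding sum_distrib_left[symmetric] sum.distrib[symmetric]
    by (intro sum.cong refl) (simp add: field_simps)
  also have "\<dots> \<le> (\<Sum>i\<in>I. (cmod (c i))\<^sup>2 * B)"
    by (intro sum_mono mult_left_mono row) auto
  finally show ?thesis by (simp add: sum_distrib_left mult.commute)
qed

text \<open>Every \<open>n \<in> {1..N}\<close> is \<open>l - m\<close> for at least
  \<open>N\<close> pairs \<open>l, m < 2 * N\<close>. Summing over these pairs turns the kernel into
  the squared modulus of a geometric sum, a Fejer kernel, which decays fast enough for Schur's test
  to work without a logarithm.\<close>

lemma large_sieve_dual:
  fixes \<alpha> :: "'i \<Rightarrow> real" and c :: "'i \<Rightarrow> complex" and N :: nat
  assumes fin: "finite I" and N: "N > 0"
    and sep: "\<And>i j k. i \<in> I \<Longrightarrow> j \<in> I \<Longrightarrow> i \<noteq> j \<Longrightarrow> \<bar>\<alpha> i - \<alpha> j - of_int k\<bar> \<ge> 1 / real N"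
  shows "(\<Sum>n=1..N. (cmod (\<Sum>i\<in>I. c i * cis (2 * pi * real n * \<alpha> i)))\<^sup>2)
    \<le> 5 * real N * (\<Sum>i\<in>I. (cmod (c i))\<^sup>2)"
proof -
  define T where "T x = (\<Sum>i\<in>I. c i * cis (2 * pi * x * \<alpha> i))" for x :: real
  define G where "G l m = (cmod (T (real l - real m)))\<^sup>2" for l m :: nat
  let ?P = "\<lambda>l m i j. cis (2 * pi * real l * (\<alpha> i - \<alpha> j)) * cnj (cis (2 * pi * real m * (\<alpha> i - \<alpha> j)))"
  let ?D = "\<lambda>i j. \<Sum>l<2*N. cis (2 * pi * real l * (\<alpha> i - \<alpha> j))"
  have "real N * (\<Sum>n=1..N. (cmod (T (real n)))\<^sup>2) = (\<Sum>m<N. \<Sum>n=1..N. (cmod (T (real n)))\<^sup>2)"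
    by simp
  also have "\<dots> = (\<Sum>m<N. \<Sum>l\<in>{1+m..N+m}. G l m)"
  proof (rule sum.cong[OF refl])
    fix m
    show "(\<Sum>n=1..N. (cmod (T (real n)))\<^sup>2) = (\<Sum>l\<in>{1+m..N+m}. G l m)"
      by (rule sum.reindex_bij_witness[of _ "\<lambda>l. l - m" "\<lambda>n. n + m"]) (auto simp: G_def)
  qed
  also have "\<dots> \<le> (\<Sum>m<N. \<Sum>l<2*N. G l m)"
    by (intro sum_mono sum_mono2) (auto simp: G_def)
  also have "\<dots> \<le> (\<Sum>m<2*N. \<Sum>l<2*N. G l m)"
    by (intro sum_mono2) (auto simp: G_def intro!: sum_nonneg)
  finally have 1: "real N * (\<Sum>n=1..N. (cmod (T (real n)))\<^sup>2) \<le> (\<Sum>m<2*N. \<Sum>l<2*N. G l m)" .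
  have G: "complex_of_real (G l m) = (\<Sum>i\<in>I. \<Sum>j\<in>I. c i * cnj (c j) * ?P l m i j)" for l m
  proof -
    have "complex_of_real (G l m) = T (real l - real m) * cnj (T (real l - real m))"
      unfolding G_def by (simp only: complex_norm_square)
    also have "\<dots> = (\<Sum>i\<in>I. \<Sum>j\<in>I. c i * cis (2 * pi * (real l - real m) * \<alpha> i)
        * (cnj (c j) * cnj (cis (2 * pi * (real l - real m) * \<alpha> j))))"
      unfolding T_def by (simp add: sum_product)
    also have "\<dots> = (\<Sum>i\<in>I. \<Sum>j\<in>I. c i * cnj (c j) * ?P l m i j)"
      by (intro sum.cong refl) (simp add: cis_cnj cis_mult algebra_simps)
    finally show ?thesis .
  qed
  have S: "(\<Sum>m<2*N. \<Sum>l<2*N. c i * cnj (c j) * ?P l m i j)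
    = c i * cnj (c j) * (?D i j * cnj (?D i j))" for i j
  proof -
    have "(\<Sum>m<2*N. \<Sum>l<2*N. a * (b l * cnj (b m))) = a * ((\<Sum>l<2*N. b l) * cnj (\<Sum>m<2*N. b m))"
      for a :: complex and b
      unfolding cnj_sum sum_product unfolding sum_distrib_left by (rule sum.swap)
    then show ?thesis .
  qed
  have "complex_of_real (\<Sum>m<2*N. \<Sum>l<2*N. G l m) = (\<Sum>m<2*N. \<Sum>l<2*N. \<Sum>i\<in>I. \<Sum>j\<in>I. c i * cnj (c j) * ?P l m i j)"
    by (simp add: G)
  also have "\<dots> = (\<Sum>i\<in>I. \<Sum>j\<in>I. \<Sum>m<2*N. \<Sum>l<2*N. c i * cnj (c j) * ?P l m i j)"
    by (simp only: sum.swap[where A = "{..<2*N}" and B = I])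
  also have "\<dots> = (\<Sum>i\<in>I. \<Sum>j\<in>I. c i * cnj (c j) * (?D i j * cnj (?D i j)))"
    unfolding S ..
  also have "\<dots> = (\<Sum>i\<in>I. \<Sum>j\<in>I. c i * cnj (c j) * of_real ((cmod (?D i j))\<^sup>2))"
    by (simp only: complex_norm_square)
  finally have 2: "complex_of_real (\<Sum>m<2*N. \<Sum>l<2*N. G l m)
      = (\<Sum>i\<in>I. \<Sum>j\<in>I. c i * cnj (c j) * of_real ((cmod (?D i j))\<^sup>2))" .
  have "(\<Sum>m<2*N. \<Sum>l<2*N. G l m) \<le> cmod (complex_of_real (\<Sum>m<2*N. \<Sum>l<2*N. G l m))"
    by (simp only: norm_of_real abs_ge_self)
  also have "\<dots> \<le> (\<Sum>i\<in>I. \<Sum>j\<in>I. cmod (c i) * cmod (c j) * (cmod (?D i j))\<^sup>2)"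
    unfolding 2 by (intro sum_norm_le) (simp add: norm_mult norm_power)
  also have "\<dots> \<le> 5 * (real N)\<^sup>2 * (\<Sum>i\<in>I. (cmod (c i))\<^sup>2)"
  proof (rule hermitian_form_le)
    fix i j
    have "?D i j = cnj (?D j i)" by (simp add: cis_cnj algebra_simps)
    then show "(cmod (?D i j))\<^sup>2 = (cmod (?D j i))\<^sup>2" by (simp only: complex_mod_cnj)
  next
    fix i assume "i \<in> I"
    then show "(\<Sum>j\<in>I. (cmod (?D i j))\<^sup>2) \<le> 5 * (real N)\<^sup>2"
      by (rule large_sieve_kernel_row[OF fin N _ sep])
  qed simp
  finally have "real N * (\<Sum>n=1..N. (cmod (T (real n)))\<^sup>2) \<le> 5 * (real N)\<^sup>2 * (\<Sum>i\<in>I. (cmod (c i))\<^sup>2)"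
    using 1 by simp
  also have "\<dots> = real N * (5 * real N * (\<Sum>i\<in>I. (cmod (c i))\<^sup>2))"
    by (simp add: power2_eq_square)
  finally show ?thesis using N by (simp add: T_def)
qed

lemma sum_cis_residues:
  fixes k :: int
  assumes q: "q > 0"
  shows "(\<Sum>x<q. cis (2 * pi * (of_int k * real x / real q))) = (if int q dvd k then of_nat q else 0)"
proof -
  let ?z = "cis (2 * pi * of_int k / real q)"
  have z: "cis (2 * pi * (of_int k * real x / real q)) = ?z ^ x" for x
    by (simp add: Complex.DeMoivre mult_ac)
  have "?z = 1 \<longleftrightarrow> int q dvd k"
  proof
    assume "?z = 1"
    then have "cos (2 * pi * of_int k / real q) = 1" by (simp add: complex_eq_iff)
    then obtain l :: int where "2 * pi * of_int k / real q = of_int l * 2 * pi"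
      using cos_one_2pi_int by blast
    then have "2 * pi * of_int k = 2 * pi * (of_int l * real q)" using q by (simp add: field_simps)
    then have "real_of_int k = real_of_int (l * int q)" by simp
    then have "k = l * int q" by (simp only: of_int_eq_iff)
    then show "int q dvd k" by simp
  next
    assume "int q dvd k"
    then obtain l where "k = int q * l" by (auto elim: dvdE)
    then have "2 * pi * of_int k / real q = 2 * pi * of_int l" using q by simp
    then show "?z = 1" by (simp only: cis_2pi_int)
  qed
  moreover have "?z ^ q = cis (2 * pi * of_int k)" using q by (simp add: Complex.DeMoivre)
  then have "?z ^ q = 1" by (simp only: cis_2pi_int)
  ultimately show ?thesis unfolding z by (cases "?z = 1") (simp_all add: geometric_sum)
qed

lemma parseval_residues:
  fixes c :: "nat \<Rightarrow> complex"
  assumes q: "q > 0" and B: "B \<subseteq> {..<q}"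
  shows "(\<Sum>x<q. (cmod (\<Sum>b\<in>B. c b * cis (2 * pi * real b * real x / real q)))\<^sup>2)
    = real q * (\<Sum>b\<in>B. (cmod (c b))\<^sup>2)"
proof -
  have fin: "finite B" using B finite_subset by blast
  let ?e = "\<lambda>b x. cis (2 * pi * real b * real x / real q)"
  have orth: "(\<Sum>x<q. ?e b x * cnj (?e b' x)) = (if b = b' then of_nat q else 0)" if "b \<in> B" "b' \<in> B" for b b'
  proof -
    have "?e b x * cnj (?e b' x) = cis (2 * pi * (of_int (int b - int b') * real x / real q))" for x
    proof -
      have "2 * pi * real b * real x / real q - 2 * pi * real b' * real x / real q
          = 2 * pi * (of_int (int b - int b') * real x / real q)"
        by (simp add: diff_divide_distrib left_diff_distrib right_diff_distrib mult_ac)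
      then show ?thesis by (simp only: cis_cnj cis_mult add_uminus_conv_diff)
    qed
    moreover have "int q dvd int b - int b' \<longleftrightarrow> int b mod int q = int b' mod int q"
      by (simp only: mod_eq_dvd_iff)
    then have "int q dvd int b - int b' \<longleftrightarrow> b = b'"
      using that B by (auto simp: subset_iff simp flip: of_nat_mod)
    ultimately show ?thesis using sum_cis_residues[OF q, of "int b - int b'"] by simp
  qed
  have "complex_of_real (\<Sum>x<q. (cmod (\<Sum>b\<in>B. c b * ?e b x))\<^sup>2)
      = (\<Sum>x<q. \<Sum>b\<in>B. \<Sum>b'\<in>B. c b * cnj (c b') * (?e b x * cnj (?e b' x)))"
    by (simp add: complex_norm_square sum_product mult_ac del: of_real_power)
  also have "\<dots> = (\<Sum>b\<in>B. \<Sum>b'\<in>B. \<Sum>x<q. c b * cnj (c b') * (?e b x * cnj (?e b' x)))"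
    by (simp only: sum.swap[where A = "{..<q}" and B = B])
  also have "\<dots> = (\<Sum>b\<in>B. \<Sum>b'\<in>B. c b * cnj (c b') * (if b = b' then of_nat q else 0))"
    by (simp only: sum_distrib_left[symmetric] orth cong: sum.cong)
  also have "\<dots> = (\<Sum>b\<in>B. of_nat q * (c b * cnj (c b)))"
    using fin by (simp add: if_distrib sum.delta mult_ac cong: if_cong)
  also have "\<dots> = complex_of_real (real q * (\<Sum>b\<in>B. (cmod (c b))\<^sup>2))"
    by (simp add: sum_distrib_left complex_norm_square del: of_real_power)
  finally show ?thesis by (simp only: of_real_eq_iff)
qed

section \<open>Sums over primes\<close>

lemma of_nat_div_le: "real (n div d) \<le> real n / real d"
  using floor_divide_of_nat_eq[of n d, where 'a = real] by linarith

lemma card_multiples: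
  assumes "d > 0"
  shows "card {m \<in> {1..n}. d dvd m} = n div d"
proof -
  have "{m \<in> {1..n}. d dvd m} = (\<lambda>k. d * k) ` {1..n div d}"
    using assms by (auto simp: dvd_def less_eq_div_iff_mult_less_eq mult.commute image_iff)
  then show ?thesis using assms by (simp add: card_image inj_on_def)
qed

text \<open>Chebyshev's identity: expand \<open>ln m\<close> as the sum of \<open>mangoldt\<close>
  over the divisors of \<open>m\<close> and interchange the sums.\<close>

lemma ln_fact_eq_sum_mangoldt:
  "ln (fact n) = (\<Sum>d=1..n. mangoldt d * real (n div d))"
proof -
  have "ln (fact n :: real) = (\<Sum>m=1..n. ln (real m))"
    by (induction n) (simp_all add: ln_mult)
  also have "\<dots> = (\<Sum>m=1..n. \<Sum>d | d \<in> {1..n} \<and> d dvd m. mangoldt d)"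
  proof (rule sum.cong[OF refl])
    fix m assume "m \<in> {1..n}"
    then have "{d. d \<in> {1..n} \<and> d dvd m} = {d. d dvd m}"
      by (auto dest: dvd_imp_le intro: Nat.gr0I)
    then show "ln (real m) = (\<Sum>d | d \<in> {1..n} \<and> d dvd m. mangoldt d)"
      using mangoldt_sum[of m, where 'a = real] \<open>m \<in> {1..n}\<close> by simp
  qed
  also have "\<dots> = (\<Sum>d=1..n. \<Sum>m | m \<in> {1..n} \<and> d dvd m. mangoldt d)"
    by (rule sum.swap_restrict) auto
  also have "\<dots> = (\<Sum>d=1..n. mangoldt d * real (n div d))"
  proof (rule sum.cong[OF refl])
    fix d assume "d \<in> {1..n}"
    then show "(\<Sum>m | m \<in> {1..n} \<and> d dvd m. mangoldt d) = mangoldt d * real (n div d)"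
      using card_multiples[of d n] by simp
  qed
  finally show ?thesis .
qed

text \<open>The logarithm of the central binomial coefficient is at most
  \<open>2 * m * ln 2\<close>. In it \<open>mangoldt d\<close> has the coefficient
  \<open>(2*m) div d - 2 * (m div d)\<close>, which is never negative and at least \<open>1\<close>
  for \<open>m < d \<le> 2 * m\<close>.\<close>

lemma sum_mangoldt_double:
  "(\<Sum>d=1..2*m. mangoldt d) \<le> (\<Sum>d=1..m. mangoldt d) + 2 * real m * ln (2::real)"
proof -
  have "ln (fact (2*m)) - 2 * ln (fact m :: real) = ln (real ((2*m) choose m))"
    by (simp add: binomial_fact ln_div ln_mult)
  also have "\<dots> \<le> ln (2 ^ (2*m))"
  proof -
    have "real ((2*m) choose m) \<le> real (2 ^ (2*m))"
      by (intro of_nat_mono binomial_le_pow2)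
    then show ?thesis by (simp add: zero_less_binomial)
  qed
  also have "\<dots> = 2 * real m * ln 2" by (simp add: ln_realpow)
  finally have 1: "ln (fact (2*m)) - 2 * ln (fact m :: real) \<le> 2 * real m * ln 2" .
  have "ln (fact m :: real) = (\<Sum>d=1..2*m. mangoldt d * real (m div d))"
    unfolding ln_fact_eq_sum_mangoldt by (intro sum.mono_neutral_left) auto
  then have "ln (fact (2*m)) - 2 * ln (fact m :: real)
      = (\<Sum>d=1..2*m. mangoldt d * real ((2*m) div d)) - 2 * (\<Sum>d=1..2*m. mangoldt d * real (m div d))"
    by (simp only: ln_fact_eq_sum_mangoldt[of "2*m"])
  also have "\<dots> = (\<Sum>d=1..2*m. mangoldt d * (real ((2*m) div d) - 2 * real (m div d)))"
    by (simp add: sum_subtractf sum_distrib_left right_diff_distrib mult_ac)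
  also have "\<dots> \<ge> (\<Sum>d=1..2*m. mangoldt d * (if d \<in> {m<..2*m} then 1 else 0))"
  proof (intro sum_mono mult_left_mono mangoldt_nonneg)
    fix d assume d: "d \<in> {1..2*m}"
    have "2 * (m div d) \<le> (2*m) div d"
      using d by (simp add: less_eq_div_iff_mult_less_eq)
    then have "real (2 * (m div d)) \<le> real ((2*m) div d)" by (intro of_nat_mono)
    moreover have "(2*m) div d \<ge> 1" using d by (simp add: less_eq_div_iff_mult_less_eq)
    then have "real ((2*m) div d) \<ge> 1" by linarith
    moreover have "m < d \<Longrightarrow> m div d = 0" by simp
    ultimately show "(if d \<in> {m<..2*m} then 1 else 0) \<le> real ((2*m) div d) - 2 * real (m div d)"
      by (simp only: of_nat_mult of_nat_numeral greaterThanAtMost_iff split: if_split) auto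
  qed
  also have "(\<Sum>d=1..2*m. mangoldt d * (if d \<in> {m<..2*m} then 1 else 0)) = (\<Sum>d\<in>{m<..2*m}. mangoldt d :: real)"
    by (intro sum.mono_neutral_cong_right) auto
  finally have "(\<Sum>d\<in>{m<..2*m}. mangoldt d) \<le> 2 * real m * ln (2::real)" using 1 by linarith
  moreover have "(\<Sum>d=1..2*m. mangoldt d :: real) = (\<Sum>d=1..m. mangoldt d) + (\<Sum>d\<in>{m<..2*m}. mangoldt d)"
    by (subst sum.union_disjoint[symmetric]) (auto intro!: sum.cong)
  ultimately show ?thesis by linarith
qed

lemma sum_mangoldt_le: "(\<Sum>d=1..n. mangoldt d) \<le> 4 * real n"
proof (induction n rule: less_induct)
  case (less n)
  define m where "m = n div 2"
  show ?case
  proof (cases "n = 0")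
    case False
    then have "m < n" by (simp add: m_def)
    have "2 * real m * ln 2 \<le> 2 * real m * 1" using ln2_le_25_over_36 by (intro mult_left_mono) auto
    then have even: "(\<Sum>d=1..2*m. mangoldt d) \<le> 6 * real m"
      using sum_mangoldt_double[of m] less[OF \<open>m < n\<close>] by linarith
    show ?thesis
    proof (cases "even n")
      case True
      then have "n = 2 * m" by (simp add: m_def)
      then show ?thesis using even by simp
    next
      case False
      then have n: "n = Suc (2 * m)" by (simp add: m_def)
      \<comment> \<open>The even part uses only \<open>6 * m\<close> of the allowed
        \<open>8 * m + 4\<close>, which leaves room for the last term, at most
        \<open>n - 1 = 2 * m\<close>.\<close>
      have "mangoldt n \<le> ln (real n)" using n by (intro mangoldt_le) auto
      also have "\<dots> \<le> real n - 1" using n by (intro ln_le_minus_one) auto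
      finally show ?thesis using even n by simp
    qed
  qed simp
qed

lemma ln_fact_le: "ln (fact n) \<le> real n * ln (real n)"
proof (cases "n = 0")
  case False
  have "fact n \<le> real n ^ n" by (metis fact_le_power order.refl of_nat_power)
  then have "ln (fact n) \<le> ln (real n ^ n)" using False by simp
  then show ?thesis using False by (simp add: ln_realpow)
qed simp

text \<open>\<open>n ^ n / fact n\<close> is a single term of the series of
  \<open>exp n\<close>.\<close>

lemma ln_fact_ge:
  assumes "n > 0"
  shows "ln (fact n) \<ge> real n * ln (real n) - real n"
proof -
  have "(real n ^ n) /\<^sub>R fact n \<le> exp (real n)"
  proof -
    have "(\<Sum>k\<in>{n}. (real n ^ k) /\<^sub>R fact k) \<le> (\<Sum>k. (real n ^ k) /\<^sub>R fact k)"
      by (intro sum_le_suminf summable_exp_generic) auto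
    then show ?thesis by (simp add: exp_def)
  qed
  then have "real n ^ n \<le> exp (real n) * fact n" by (simp add: field_simps)
  then have "ln (real n ^ n) \<le> ln (exp (real n) * fact n)" using assms by simp
  then show ?thesis using assms by (simp add: ln_realpow ln_mult)
qed

text \<open>Mertens' first theorem from above: replacing \<open>n div d\<close> by
  \<open>n / d\<close> costs at most \<open>mangoldt d\<close> per term, altogether
  \<open>4 * n\<close> by Chebyshev's bound.\<close>

lemma sum_mangoldt_over_le:
  assumes "n > 0"
  shows "(\<Sum>d=1..n. mangoldt d / real d) \<le> ln (real n) + 4"
proof -
  have "real n * (\<Sum>d=1..n. mangoldt d / real d) = (\<Sum>d=1..n. mangoldt d * (real n / real d))"
    by (simp add: sum_distrib_left mult_ac)
  also have "\<dots> \<le> (\<Sum>d=1..n. mangoldt d * (real (n div d) + 1))"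
  proof (intro sum_mono mult_left_mono mangoldt_nonneg)
    fix d assume "d \<in> {1..n}"
    show "real n / real d \<le> real (n div d) + 1"
      using floor_divide_of_nat_eq[of n d, where 'a = real] by linarith
  qed
  also have "\<dots> = ln (fact n) + (\<Sum>d=1..n. mangoldt d)"
    by (simp add: ln_fact_eq_sum_mangoldt distrib_left sum.distrib)
  also have "\<dots> \<le> real n * (ln (real n) + 4)"
    using ln_fact_le[of n] sum_mangoldt_le[of n] by (simp add: distrib_left)
  finally show ?thesis using assms by simp
qed

lemma sum_mangoldt_over_ge:
  assumes "n > 0"
  shows "(\<Sum>d=1..n. mangoldt d / real d) \<ge> ln (real n) - 1"
proof -
  have "real n * (ln (real n) - 1) \<le> ln (fact n)"
    using ln_fact_ge[OF assms] by (simp add: right_diff_distrib)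
  also have "\<dots> \<le> (\<Sum>d=1..n. mangoldt d * (real n / real d))"
    unfolding ln_fact_eq_sum_mangoldt by (intro sum_mono mult_left_mono mangoldt_nonneg of_nat_div_le)
  also have "\<dots> = real n * (\<Sum>d=1..n. mangoldt d / real d)"
    by (simp add: sum_distrib_left mult_ac)
  finally show ?thesis using assms by simp
qed

lemma sum_ln_prime_over_le:
  assumes "n > 0"
  shows "(\<Sum>p | prime p \<and> p \<le> n. ln (real p) / real p) \<le> ln (real n) + 4"
proof -
  have "(\<Sum>p | prime p \<and> p \<le> n. ln (real p) / real p) = (\<Sum>p | prime p \<and> p \<le> n. mangoldt p / real p)"
    by (intro sum.cong) auto
  also have "\<dots> \<le> (\<Sum>d=1..n. mangoldt d / real d)"
    by (intro sum_mono2) (auto simp: mangoldt_nonneg dest: prime_ge_1_nat)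
  finally show ?thesis using sum_mangoldt_over_le[OF assms] by simp
qed

section \<open>From prime powers to primes\<close>

lemma sum_inverse_powers_le:
  assumes "m \<ge> (2::nat)"
  shows "(\<Sum>k=2..n. 1 / real m ^ k) \<le> 2 / real m ^ 2"
proof -
  have m: "1 / real m \<le> 1 / 2" using assms by (intro divide_left_mono) auto
  have "(\<Sum>k=2..n. 1 / real m ^ k) \<le> (\<Sum>k=2..Suc n. (1 / real m) ^ k)"
    by (auto simp: power_one_over)
  also have "\<dots> = (\<Sum>k<n. (1 / real m) ^ (k + 2))"
    by (induction n) auto
  also have "\<dots> \<le> (\<Sum>k<n. (1 / real m)\<^sup>2 * (1 / 2) ^ k)"
    unfolding power_add by (subst mult.commute, intro sum_mono mult_left_mono power_mono m) auto
  also have "\<dots> = (1 / real m)\<^sup>2 * (\<Sum>k<n. (1 / 2) ^ k)"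
    by (simp add: sum_distrib_left)
  also have "\<dots> \<le> (1 / real m)\<^sup>2 * 2"
    by (intro mult_left_mono) (auto simp: geometric_sum)
  finally show ?thesis by (simp add: power_one_over)
qed

text \<open>Proper prime powers are enlarged to all \<open>m ^ k\<close> with
  \<open>m, k \<ge> 2\<close>; summed over \<open>k\<close> their terms are dominated by
  \<open>4 * m powr (- 3 / 2)\<close>.\<close>

lemma sum_mangoldt_nonprime_bounded:
  obtains c :: real where "c \<ge> 0"
    "\<And>n. (\<Sum>d | d \<in> {1..n} \<and> \<not> prime d. mangoldt d / real d) \<le> c"
proof
  define f where "f = (\<lambda>m::nat. 4 * real m powr (- 3 / 2))"
  have sf: "summable f" unfolding f_def by (intro summable_mult) (simp add: summable_real_powr_iff)
  show "suminf f \<ge> 0" by (intro suminf_nonneg sf) (simp add: f_def)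
  fix n :: nat
  let ?A = "{d. d \<in> {1..n} \<and> \<not> prime d \<and> primepow d}"
  let ?g = "\<lambda>(m, k). ln (real m) / real m ^ k"
  have "(\<Sum>d | d \<in> {1..n} \<and> \<not> prime d. mangoldt d / real d) = (\<Sum>d\<in>?A. mangoldt d / real d)"
    by (intro sum.mono_neutral_right) (auto simp: mangoldt_def)
  also have "\<dots> \<le> (\<Sum>z\<in>{2..n} \<times> {2..n}. ?g z)"
  proof (rule sum_le_included[where i = "\<lambda>(m, k). m ^ k"])
    show "\<forall>z\<in>{2..n} \<times> {2..n}. 0 \<le> ?g z" by auto
    show "\<forall>d\<in>?A. \<exists>z\<in>{2..n} \<times> {2..n}. (\<lambda>(m, k). m ^ k) z = d \<and> mangoldt d / real d \<le> ?g z"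
    proof
      fix d assume "d \<in> ?A"
      then have d: "1 \<le> d" "d \<le> n" "\<not> prime d" "primepow d" by auto
      from d(4) obtain p k where pk: "prime p" "k > 0" "d = p ^ k" by (auto simp: primepow_def)
      have k2: "k \<ge> 2" using pk d(3) by (cases "k = 1") auto
      have p2: "p \<ge> 2" using pk(1) prime_ge_2_nat by blast
      have "p ^ 1 \<le> p ^ k" using p2 k2 by (intro power_increasing) auto
      moreover have "k < p ^ k" using p2 by (intro less_exp[THEN order.strict_trans2]) (auto intro: power_mono)
      ultimately have "(p, k) \<in> {2..n} \<times> {2..n}" using k2 p2 d pk by auto
      then show "\<exists>z\<in>{2..n} \<times> {2..n}. (\<lambda>(m, k). m ^ k) z = d \<and> mangoldt d / real d \<le> ?g z"
        using pk by (intro bexI[of _ "(p, k)"]) auto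
    qed
  qed auto
  also have "\<dots> = (\<Sum>m=2..n. ln (real m) * (\<Sum>k=2..n. 1 / real m ^ k))"
    by (simp add: sum.cartesian_product sum_distrib_left case_prod_beta)
  also have "\<dots> \<le> (\<Sum>m=2..n. f m)"
  proof (rule sum_mono)
    fix m assume m: "m \<in> {2..n}"
    have "ln (real m) = 2 * ln (sqrt (real m))" using m by (simp add: ln_sqrt)
    also have "\<dots> \<le> 2 * sqrt (real m)" using m ln_le_minus_one[of "sqrt (real m)"] by simp
    finally have l: "ln (real m) \<le> 2 * sqrt (real m)" .
    have "ln (real m) * (\<Sum>k=2..n. 1 / real m ^ k) \<le> (2 * sqrt (real m)) * (2 / real m ^ 2)"
      using m l sum_inverse_powers_le[of m n] by (intro mult_mono) (auto intro: sum_nonneg)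
    also have "\<dots> = 4 * (real m powr (1/2) * real m powr (-2))"
      using m by (simp add: powr_half_sqrt powr_minus powr_numeral field_simps)
    also have "\<dots> = f m" using m by (simp add: f_def powr_add[symmetric])
    finally show "ln (real m) * (\<Sum>k=2..n. 1 / real m ^ k) \<le> f m" .
  qed
  also have "\<dots> \<le> suminf f" by (intro sum_le_suminf sf) (auto simp: f_def)
  finally show "(\<Sum>d | d \<in> {1..n} \<and> \<not> prime d. mangoldt d / real d) \<le> suminf f" .
qed

lemma sum_ln_prime_over_ge:
  obtains c :: real where "c \<ge> 0"
    "\<And>n. n > 0 \<Longrightarrow> (\<Sum>p | prime p \<and> p \<le> n. ln (real p) / real p) \<ge> ln (real n) - c"
proof -
  from sum_mangoldt_nonprime_bounded obtain c :: real where c: "c \<ge> 0"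
    "\<And>n. (\<Sum>d | d \<in> {1..n} \<and> \<not> prime d. mangoldt d / real d) \<le> c" by blast
  show thesis
  proof (rule that[of "c + 1"])
    fix n :: nat assume n: "n > 0"
    have "(\<Sum>d=1..n. mangoldt d / real d) = (\<Sum>d | d \<in> {1..n} \<and> prime d. mangoldt d / real d)
        + (\<Sum>d | d \<in> {1..n} \<and> \<not> prime d. mangoldt d / real d)"
      by (subst sum.union_disjoint[symmetric]) (auto intro!: sum.cong)
    moreover have "(\<Sum>d | d \<in> {1..n} \<and> prime d. mangoldt d / real d) = (\<Sum>p | prime p \<and> p \<le> n. ln (real p) / real p)"
      by (intro sum.cong) (auto dest: prime_ge_1_nat)
    ultimately show "(\<Sum>p | prime p \<and> p \<le> n. ln (real p) / real p) \<ge> ln (real n) - (c + 1)"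
      using sum_mangoldt_over_ge[OF n] c(2)[of n] by linarith
  qed (use c in auto)
qed

lemma finite_primes_le [simp]: "finite {p::nat. prime p \<and> real p \<le> x}"
  by (rule finite_subset[OF _ finite_moduli[of x]]) (auto dest: prime_ge_1_nat)

abbreviation primes_between :: "real \<Rightarrow> real \<Rightarrow> nat set" where
  "primes_between z x \<equiv> {p. prime p \<and> z < real p \<and> real p \<le> x}"

lemma finite_primes_between [simp]: "finite {p::nat. prime p \<and> z < real p \<and> real p \<le> x}"
  by (rule finite_subset[OF _ finite_primes_le[of x]]) auto

text \<open>A difference of two Mertens sums. Rounding \<open>Y\<close> down to an integer costs at
  most \<open>ln 2\<close>, since \<open>Y \<le> 2 * n\<close>.\<close>

lemma mertens_interval:
  obtains c :: real where "c \<ge> 0"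
    "\<And>X Y. 1 \<le> X \<Longrightarrow> X \<le> Y \<Longrightarrow>
      (\<Sum>p\<in>primes_between X Y. ln (real p) / real p) \<ge> ln Y - ln X - c"
proof -
  obtain c :: real where c: "c \<ge> 0"
    "\<And>n. n > 0 \<Longrightarrow> (\<Sum>p | prime p \<and> p \<le> n. ln (real p) / real p) \<ge> ln (real n) - c"
    using sum_ln_prime_over_ge by blast
  show thesis
  proof (rule that[of "c + ln 2 + 4"])
    fix X Y :: real assume XY: "1 \<le> X" "X \<le> Y"
    define m n where "m = nat \<lfloor>X\<rfloor>" and "n = nat \<lfloor>Y\<rfloor>"
    have m: "m > 0" "real m \<le> X" using XY by (auto simp: m_def)
    have "n > 0" "Y < real n + 1" using XY unfolding n_def by linarith+
    then have n: "n > 0" "Y \<le> 2 * real n" by auto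
    have le: "p \<le> m \<longleftrightarrow> real p \<le> X" "p \<le> n \<longleftrightarrow> real p \<le> Y" for p
      using XY by (auto simp: m_def n_def le_nat_iff le_floor_iff)
    have "{p. prime p \<and> p \<le> n} = {p. prime p \<and> p \<le> m} \<union> primes_between X Y"
      using XY by (auto simp: le)
    moreover have "(\<Sum>p\<in>{p. prime p \<and> p \<le> m} \<union> primes_between X Y. ln (real p) / real p)
        = (\<Sum>p | prime p \<and> p \<le> m. ln (real p) / real p)
        + (\<Sum>p\<in>primes_between X Y. ln (real p) / real p)"
      by (intro sum.union_disjoint) (auto simp: le)
    ultimately have "(\<Sum>p\<in>primes_between X Y. ln (real p) / real p)
        \<ge> ln (real n) - c - (ln (real m) + 4)"
      using c(2)[OF n(1)] sum_ln_prime_over_le[OF m(1)] by simp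
    moreover have "ln Y \<le> ln (2 * real n)" using n XY by (intro ln_mono) auto
    then have "ln Y \<le> ln 2 + ln (real n)" using n by (simp add: ln_mult)
    moreover have "ln (real m) \<le> ln X" using m by (intro ln_mono) auto
    ultimately show "(\<Sum>p\<in>primes_between X Y. ln (real p) / real p) \<ge> ln Y - ln X - (c + ln 2 + 4)"
      by linarith
  qed (use c in auto)
qed

text \<open>\<open>ln p \<le> ln Y\<close> is a crude step, but when \<open>X\<close> and
  \<open>Y\<close> are different fixed powers of a large \<open>N\<close>, the bound is still a
  positive constant.\<close>

lemma sum_inverse_primes_between:
  obtains c :: real where "c \<ge> 0"
    "\<And>X Y. 1 \<le> X \<Longrightarrow> X \<le> Y \<Longrightarrow> 1 < Y \<Longrightarrow>
      (\<Sum>p\<in>primes_between X Y. 1 / real p) \<ge> (ln Y - ln X - c) / ln Y"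
proof -
  obtain c :: real where c: "c \<ge> 0"
    "\<And>X Y. 1 \<le> X \<Longrightarrow> X \<le> Y \<Longrightarrow>
      (\<Sum>p\<in>primes_between X Y. ln (real p) / real p) \<ge> ln Y - ln X - c"
    using mertens_interval by blast
  show thesis
  proof (rule that[of c])
    fix X Y :: real assume XY: "1 \<le> X" "X \<le> Y" "1 < Y"
    have "ln Y - ln X - c \<le> (\<Sum>p\<in>primes_between X Y. ln (real p) / real p)"
      using c(2)[OF XY(1,2)] .
    also have "\<dots> \<le> (\<Sum>p\<in>primes_between X Y. ln Y * (1 / real p))"
      using XY by (intro sum_mono) (auto intro!: divide_right_mono)
    also have "\<dots> = ln Y * (\<Sum>p\<in>primes_between X Y. 1 / real p)"
      by (simp add: sum_distrib_left)
    finally show "(\<Sum>p\<in>primes_between X Y. 1 / real p) \<ge> (ln Y - ln X - c) / ln Y"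
      using XY by (simp add: field_simps)
  qed fact
qed

lemma card_primes_between_ge:
  obtains A :: real where "A > 1"
    "\<And>x. x \<ge> A \<Longrightarrow> real (card (primes_between (x / A) x)) \<ge> x / (A * ln x)"
proof -
  obtain c :: real where c: "c \<ge> 0"
    "\<And>X Y. 1 \<le> X \<Longrightarrow> X \<le> Y \<Longrightarrow>
      (\<Sum>p\<in>primes_between X Y. ln (real p) / real p) \<ge> ln Y - ln X - c"
    using mertens_interval by blast
  \<comment> \<open>With this \<open>A\<close> the interval from \<open>x / A\<close> to
    \<open>x\<close> has logarithmic length \<open>c + 1\<close>, so the Mertens bound exceeds its
    error by exactly \<open>1\<close>.\<close>
  define A where "A = exp (c + 1)"
  have A: "A > 1" using c by (simp add: A_def)
  show thesis
  proof (rule that[OF A])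
    fix x assume x: "x \<ge> A"
    let ?P = "primes_between (x / A) x"
    have lx: "ln x > 0" using x A by simp
    have "x > 0" using x A by linarith
    then have "ln (x / A) = ln x - ln A" using A by (simp add: ln_divide_pos)
    then have "1 = ln x - ln (x / A) - c" by (simp add: A_def)
    also have "\<dots> \<le> (\<Sum>p\<in>?P. ln (real p) / real p)"
      using x A by (intro c) (auto simp: field_simps)
    also have "\<dots> \<le> (\<Sum>p\<in>?P. ln x / (x / A))"
      using x A by (intro sum_mono frac_le) (auto dest: prime_gt_0_nat)
    also have "\<dots> = real (card ?P) * (ln x * A / x)" by simp
    finally show "real (card ?P) \<ge> x / (A * ln x)" using x A lx by (simp add: field_simps)
  qed
qed

text \<open>Up to \<open>sqrt x\<close> all integers are counted; above it each prime contributes at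
  least \<open>ln x / 2\<close> to Chebyshev's sum.\<close>

lemma card_primes_le:
  assumes "x > 1"
  shows "real (card {p. prime p \<and> real p \<le> x}) \<le> 10 * x / ln x"
proof -
  let ?S = "{p. prime p \<and> real p \<le> sqrt x}" and ?L = "primes_between (sqrt x) x"
  have lx: "ln x > 0" using assms by simp
  have ls: "ln (sqrt x) = ln x / 2" using assms by (simp add: ln_sqrt)
  have "ln x \<le> 2 * sqrt x" using ls ln_le_minus_one[of "sqrt x"] assms by simp
  then have "sqrt x * ln x \<le> sqrt x * (2 * sqrt x)" using assms by (intro mult_left_mono) auto
  also have "\<dots> = 2 * (sqrt x * sqrt x)" by simp
  also have "\<dots> = 2 * x" using assms by simp
  finally have "sqrt x * ln x \<le> 2 * x" .
  then have s: "sqrt x \<le> 2 * x / ln x" using lx by (simp add: field_simps)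
  have "?S \<subseteq> {1..nat \<lfloor>sqrt x\<rfloor>}"
    using assms by (auto simp: le_nat_iff le_floor_iff Suc_le_eq dest: prime_gt_0_nat)
  then have "card ?S \<le> card {1..nat \<lfloor>sqrt x\<rfloor>}" by (intro card_mono) auto
  then have "real (card ?S) \<le> real (nat \<lfloor>sqrt x\<rfloor>)" by simp
  also have "\<dots> \<le> sqrt x" using assms by (intro of_nat_floor) auto
  finally have cS: "real (card ?S) \<le> sqrt x" .
  have "real (card ?L) * (ln x / 2) = (\<Sum>p\<in>?L. ln (sqrt x))" by (simp add: ls)
  also have "\<dots> \<le> (\<Sum>p\<in>?L. mangoldt p)"
    using assms by (intro sum_mono) (auto intro!: ln_mono)
  also have "\<dots> \<le> (\<Sum>d=1..nat \<lfloor>x\<rfloor>. mangoldt d)"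
    by (intro sum_mono2) (auto simp: mangoldt_nonneg le_nat_iff le_floor_iff dest: prime_ge_1_nat)
  also have "\<dots> \<le> 4 * real (nat \<lfloor>x\<rfloor>)" by (rule sum_mangoldt_le)
  also have "\<dots> \<le> 4 * x" using assms by simp
  finally have cL: "real (card ?L) \<le> 8 * x / ln x" using lx by (simp add: field_simps)
  have "{p. prime p \<and> real p \<le> x} \<subseteq> ?S \<union> ?L" by auto
  then have "card {p. prime p \<and> real p \<le> x} \<le> card (?S \<union> ?L)" by (intro card_mono) auto
  also have "\<dots> \<le> card ?S + card ?L" by (rule card_Un_le)
  finally have "real (card {p. prime p \<and> real p \<le> x}) \<le> real (card ?S) + real (card ?L)" by linarith
  also have "\<dots> \<le> 2 * x / ln x + 8 * x / ln x" using cS s cL by linarith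
  finally show ?thesis by (simp add: add_divide_distrib[symmetric])
qed

text \<open>With \<open>D n = ln n + 4 - (\<Sum>p\<le>n. ln p / p) \<ge> 0\<close>, the quantity
  \<open>(\<Sum>p\<le>n. 1 / p) + D n / ln n - ln (ln n)\<close> is decreasing; this replaces partial summation.\<close>

lemma sum_inverse_primes_le:
  obtains c :: real where "\<And>n. n \<ge> 2 \<Longrightarrow> (\<Sum>p | prime p \<and> p \<le> n. 1 / real p) \<le> ln (ln (real n)) + c"
proof -
  define B where "B n = (\<Sum>p | prime p \<and> p \<le> n. ln (real p) / real p)" for n :: nat
  define P where "P n = (\<Sum>p | prime p \<and> p \<le> n. 1 / real p)" for n :: nat
  define F where "F n = P n + (ln (real n) + 4 - B n) / ln (real n) - ln (ln (real n))" for n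
  have ins: "{p. prime p \<and> p \<le> Suc n} = (if prime (Suc n) then insert (Suc n) {p. prime p \<and> p \<le> n} else {p. prime p \<and> p \<le> n})" for n
    by (auto simp: le_Suc_eq)
  have step: "F (Suc n) \<le> F n" if n: "n \<ge> 2" for n
  proof -
    define a where "a = (if prime (Suc n) then ln (real (Suc n)) / real (Suc n) else 0)"
    let ?l = "ln (real n)" and ?l' = "ln (real (Suc n))"
    have l: "?l > 0" "?l' > 0" "?l \<le> ?l'" using n by auto
    have B: "B (Suc n) = B n + a" by (simp add: B_def ins a_def)
    have P: "P (Suc n) = P n + a / ?l'" using l by (simp add: P_def ins a_def)
    have D: "?l + 4 - B n \<ge> 0" using sum_ln_prime_over_le[of n] n by (simp add: B_def)
    have "ln (?l / ?l') \<le> ?l / ?l' - 1" using l by (intro ln_le_minus_one) auto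
    then have r: "1 - ?l / ?l' \<le> ln ?l' - ln ?l" using l by (simp add: ln_div)
    have "a / ?l' + (?l' + 4 - (B n + a)) / ?l' = (?l + 4 - B n) / ?l' + (1 - ?l / ?l')"
      using l by (simp add: field_simps)
    also have "\<dots> \<le> (?l + 4 - B n) / ?l + (ln ?l' - ln ?l)"
      using D l r by (intro add_mono divide_left_mono) auto
    finally show ?thesis unfolding F_def B P by linarith
  qed
  have F: "F n \<le> F 2" if "n \<ge> 2" for n
    using that by (induction n rule: dec_induct) (auto intro: step order_trans)
  show thesis
  proof (rule that[of "F 2"])
    fix n :: nat assume n: "n \<ge> 2"
    have "(ln (real n) + 4 - B n) / ln (real n) \<ge> 0"
      using sum_ln_prime_over_le[of n] n by (intro divide_nonneg_nonneg) (auto simp: B_def)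
    then show "(\<Sum>p | prime p \<and> p \<le> n. 1 / real p) \<le> ln (ln (real n)) + F 2"
      using F[OF n] unfolding F_def[of n] P_def by linarith
  qed
qed

lemma prod_one_minus_inverse_primes_ge:
  obtains c :: real where "c > 0"
    "\<And>n. n \<ge> 2 \<Longrightarrow> (\<Prod>p | prime p \<and> p \<le> n. 1 - 1 / real p) \<ge> c / ln (real n)"
proof -
  obtain c :: real where c: "\<And>n. n \<ge> 2 \<Longrightarrow> (\<Sum>p | prime p \<and> p \<le> n. 1 / real p) \<le> ln (ln (real n)) + c"
    using sum_inverse_primes_le by blast
  show thesis
  \<comment> \<open>The \<open>4\<close> is twice the bound \<open>2\<close> for the sum of inverse
    squares, from \<open>ln (1 - x) \<ge> - x - 2 * x^2\<close> for
    \<open>0 \<le> x \<le> 1 / 2\<close>.\<close>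
  proof (rule that[of "exp (- c - 4)"])
    fix n :: nat assume n: "n \<ge> 2"
    let ?P = "{p. prime p \<and> p \<le> n}"
    have sub: "?P \<subseteq> {1..n}" by (auto dest: prime_ge_1_nat)
    then have fin: "finite ?P" using finite_subset by blast
    have half: "1 / real p \<le> 1 / 2" if "p \<in> ?P" for p
      using that prime_ge_2_nat[of p] by (intro divide_left_mono) auto
    have "(\<Sum>p\<in>?P. 1 / (real p)\<^sup>2) \<le> (\<Sum>p=1..n. 1 / (real p)\<^sup>2)"
      by (intro sum_mono2 sub) auto
    also have "\<dots> \<le> 2" by (rule sum_inverse_squares_le)
    finally have sq: "(\<Sum>p\<in>?P. 1 / (real p)\<^sup>2) \<le> 2" .
    have sq': "(\<Sum>p\<in>?P. 2 * (1 / real p)\<^sup>2) = 2 * (\<Sum>p\<in>?P. 1 / (real p)\<^sup>2)"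
      by (simp add: sum_distrib_left power_one_over)
    have "exp (- c - 4) / ln (real n) = exp (- (ln (ln (real n)) + c) - 4)"
      using n by (simp add: exp_diff exp_minus field_simps)
        (simp add: exp_add)
    also have "\<dots> \<le> exp (\<Sum>p\<in>?P. - (1 / real p) - 2 * (1 / real p)\<^sup>2)"
      using c[OF n] sq by (simp only: sum_subtractf sum_negf sq' exp_le_cancel_iff)
    also have "\<dots> = (\<Prod>p\<in>?P. exp (- (1 / real p) - 2 * (1 / real p)\<^sup>2))"
      by (rule exp_sum[OF fin])
    also have "\<dots> \<le> (\<Prod>p\<in>?P. 1 - 1 / real p)"
    proof (intro prod_mono conjI)
      fix p assume p: "p \<in> ?P"
      have "- (1 / real p) - 2 * (1 / real p)\<^sup>2 \<le> ln (1 - 1 / real p)"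
        using ln_one_minus_pos_lower_bound[of "1 / real p"] half[OF p] by simp
      then have "exp (- (1 / real p) - 2 * (1 / real p)\<^sup>2) \<le> exp (ln (1 - 1 / real p))" by simp
      also have "\<dots> = 1 - 1 / real p" using half[OF p] by simp
      finally show "exp (- (1 / real p) - 2 * (1 / real p)\<^sup>2) \<le> 1 - 1 / real p" .
    qed simp
    finally show "(\<Prod>p\<in>?P. 1 - 1 / real p) \<ge> exp (- c - 4) / ln (real n)" .
  qed simp
qed

section \<open>Sifted harmonic sums\<close>

lemma sum_inverse_sifted_ge:
  fixes P :: "nat set"
  assumes "finite P" and "\<And>p. p \<in> P \<Longrightarrow> p > 0"
  shows "(\<Sum>n | n \<in> {1..S} \<and> (\<forall>p\<in>P. \<not> p dvd n). 1 / real n)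
    \<ge> (\<Prod>p\<in>P. 1 - 1 / real p) * (\<Sum>n=1..S. 1 / real n)"
  using assms
proof (induction P)
  case (insert p P)
  let ?R = "\<lambda>P. {n. n \<in> {1..S} \<and> (\<forall>p\<in>P. \<not> p dvd n)}"
  have p: "p > 0" using insert.prems by simp
  have "?R P = ?R (insert p P) \<union> {n \<in> ?R P. p dvd n}" by auto
  then have "(\<Sum>n\<in>?R P. 1 / real n) = (\<Sum>n\<in>?R (insert p P) \<union> {n \<in> ?R P. p dvd n}. 1 / real n)"
    by (rule arg_cong[where f = "sum (\<lambda>n. 1 / real n)"])
  also have "\<dots> = (\<Sum>n\<in>?R (insert p P). 1 / real n) + (\<Sum>n | n \<in> ?R P \<and> p dvd n. 1 / real n)"
    by (intro sum.union_disjoint) auto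
  \<comment> \<open>If \<open>p\<close> divides a sifted \<open>n = p * m\<close>, then
    \<open>m\<close> is sifted as well, so removing the multiples of \<open>p\<close> costs at most
    the proportion \<open>1 / p\<close>, with no error term.\<close>
  also have "(\<Sum>n | n \<in> ?R P \<and> p dvd n. 1 / real n) \<le> (\<Sum>n\<in>?R P. 1 / real p * (1 / real n))"
  proof (rule sum_le_included[where i = "\<lambda>m. p * m"])
    show "\<forall>n\<in>{n. n \<in> ?R P \<and> p dvd n}. \<exists>m\<in>?R P. p * m = n \<and> 1 / real n \<le> 1 / real p * (1 / real m)"
    proof
      fix n assume n: "n \<in> {n. n \<in> ?R P \<and> p dvd n}"
      then obtain m where m: "n = p * m" by (auto elim: dvdE)
      have "m \<in> ?R P" using n m p by (auto intro: order_trans[of m "p * m"] Suc_leI Nat.gr0I)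
      then show "\<exists>m\<in>?R P. p * m = n \<and> 1 / real n \<le> 1 / real p * (1 / real m)"
        using m by (intro bexI[of _ m]) auto
    qed
  qed auto
  finally have "(1 - 1 / real p) * (\<Sum>n\<in>?R P. 1 / real n) \<le> (\<Sum>n\<in>?R (insert p P). 1 / real n)"
    unfolding sum_distrib_left[symmetric] left_diff_distrib by simp
  moreover have "(1 - 1 / real p) * ((\<Prod>p\<in>P. 1 - 1 / real p) * (\<Sum>n=1..S. 1 / real n))
      \<le> (1 - 1 / real p) * (\<Sum>n\<in>?R P. 1 / real n)"
    using insert p by (intro mult_left_mono) (auto simp: Suc_le_eq)
  ultimately show ?case using insert.hyps by (simp add: mult_ac)
next
  case empty
  have "{n. n \<in> {1..S} \<and> (\<forall>p\<in>{}. \<not> p dvd n)} = {1..S}" by auto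
  then show ?case by (simp only: prod.empty mult_1_left order.refl)
qed

text \<open>Write \<open>n = s * k^2\<close> with \<open>s\<close> squarefree. As \<open>A\<close>
  is closed under divisors, \<open>s\<close> stays in \<open>A\<close>; the \<open>k\<close>
  contribute the factor \<open>2\<close>.\<close>

lemma sum_inverse_le_squarefree:
  fixes A :: "nat set"
  assumes A: "A \<subseteq> {1..S}" and closed: "\<And>n d. n \<in> A \<Longrightarrow> d dvd n \<Longrightarrow> d \<in> A"
  shows "(\<Sum>n\<in>A. 1 / real n) \<le> 2 * (\<Sum>n | n \<in> A \<and> squarefree n. 1 / real n)"
proof -
  have fin: "finite A" using A finite_subset by blast
  have "(\<Sum>n\<in>A. 1 / real n) \<le> (\<Sum>(s, k)\<in>{n. n \<in> A \<and> squarefree n} \<times> {1..S}. 1 / real s * (1 / (real k)\<^sup>2))"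
  proof (rule sum_le_included[where i = "\<lambda>(s, k). s * k\<^sup>2"])
    show "\<forall>n\<in>A. \<exists>z\<in>{n. n \<in> A \<and> squarefree n} \<times> {1..S}.
        (case z of (s, k) \<Rightarrow> s * k\<^sup>2) = n \<and> 1 / real n \<le> (case z of (s, k) \<Rightarrow> 1 / real s * (1 / (real k)\<^sup>2))"
    proof
      fix n assume n: "n \<in> A"
      let ?s = "squarefree_part n" and ?k = "square_part n"
      have eq: "?s * ?k\<^sup>2 = n" using squarefree_decompose[of n] by simp
      have "?s dvd n" "?k dvd n" using eq by (metis dvd_triv_left, metis dvd_triv_right dvd_mult_left power2_eq_square dvd_trans)
      then have "?s \<in> A" "?k \<in> A" using closed n by auto
      then have "(?s, ?k) \<in> {n. n \<in> A \<and> squarefree n} \<times> {1..S}" using A by auto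
      moreover have "1 / real n = 1 / real ?s * (1 / (real ?k)\<^sup>2)"
        by (subst (1) eq[symmetric]) (simp del: of_nat_power add: of_nat_power)
      ultimately show "\<exists>z\<in>{n. n \<in> A \<and> squarefree n} \<times> {1..S}.
        (case z of (s, k) \<Rightarrow> s * k\<^sup>2) = n \<and> 1 / real n \<le> (case z of (s, k) \<Rightarrow> 1 / real s * (1 / (real k)\<^sup>2))"
        using eq by (intro bexI[of _ "(?s, ?k)"]) auto
    qed
  qed (use fin in auto)
  also have "\<dots> = (\<Sum>n | n \<in> A \<and> squarefree n. 1 / real n) * (\<Sum>k=1..S. 1 / (real k)\<^sup>2)"
    by (simp add: sum_product sum.cartesian_product)
  also have "\<dots> \<le> (\<Sum>n | n \<in> A \<and> squarefree n. 1 / real n) * 2"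
    by (intro mult_left_mono sum_inverse_squares_le sum_nonneg) auto
  finally show ?thesis by simp
qed

lemma ln_le_sum_inverse: "ln (real n + 1) \<le> (\<Sum>k=1..n. 1 / real k)"
proof (induction n)
  case (Suc n)
  have "ln (real (Suc n) + 1) - ln (real n + 1) = ln (1 + 1 / (real n + 1))"
  proof -
    have e: "1 + 1 / (real n + 1) = (real (Suc n) + 1) / (real n + 1)" by (simp add: field_simps)
    show ?thesis unfolding e by (subst ln_div) auto
  qed
  also have "\<dots> \<le> 1 / (real n + 1)" by (intro ln_add_one_self_le_self) auto
  finally show ?case using Suc by (simp add: algebra_simps)
qed simp

lemma sum_inverse_le_ln: "n > 0 \<Longrightarrow> (\<Sum>k=1..n. 1 / real k) \<le> ln (real n) + 1"
proof (induction n)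
  case (Suc n)
  show ?case
  proof (cases "n = 0")
    case False
    have "ln (real n / (real n + 1)) \<le> real n / (real n + 1) - 1"
      using False by (intro ln_le_minus_one) auto
    also have "\<dots> = - 1 / (real n + 1)" by (simp add: field_simps)
    finally have "1 / (real n + 1) \<le> ln (real n + 1) - ln (real n)"
      using False by (simp add: ln_div)
    then show ?thesis using Suc False by (simp add: algebra_simps)
  qed simp
qed simp

definition rough_squarefree :: "real \<Rightarrow> real \<Rightarrow> nat set" where
  "rough_squarefree M S = {s. 1 \<le> s \<and> real s \<le> S \<and> squarefree s \<and> (\<forall>p. prime p \<and> p dvd s \<longrightarrow> M < real p)}"

lemma finite_rough_squarefree [simp]: "finite (rough_squarefree M S)"
  by (rule finite_subset[OF _ finite_moduli[of S]]) (auto simp: rough_squarefree_def)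

text \<open>The Euler product over the primes up to \<open>M\<close> gives \<open>1 / ln M\<close>,
  the harmonic sum \<open>ln S\<close>. For \<open>M = N / y\<close> and \<open>S\<close> a power of
  \<open>N\<close> the quotient has the order \<open>1 / t\<close>.\<close>

lemma sum_inverse_rough_squarefree_ge:
  obtains c :: real where "c > 0"
    "\<And>M S. M \<ge> 2 \<Longrightarrow> S \<ge> 1 \<Longrightarrow> (\<Sum>s\<in>rough_squarefree M S. 1 / real s) \<ge> c * ln S / ln M"
proof -
  obtain c :: real where c: "c > 0"
    "\<And>n. n \<ge> 2 \<Longrightarrow> (\<Prod>p | prime p \<and> p \<le> n. 1 - 1 / real p) \<ge> c / ln (real n)"
    using prod_one_minus_inverse_primes_ge by blast
  show thesis
  proof (rule that[of "c / 2"])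
    fix M S :: real assume MS: "M \<ge> 2" "S \<ge> 1"
    define m s where "m = nat \<lfloor>M\<rfloor>" and "s = nat \<lfloor>S\<rfloor>"
    have m: "m \<ge> 2" "real m \<le> M" using MS by (auto simp: m_def le_nat_iff le_floor_iff)
    have s: "S \<le> real s + 1" using MS unfolding s_def by linarith
    have le: "p \<le> m \<longleftrightarrow> real p \<le> M" "p \<le> s \<longleftrightarrow> real p \<le> S" for p
      using MS by (auto simp: m_def s_def le_nat_iff le_floor_iff)
    let ?P = "{p. prime p \<and> p \<le> m}"
    let ?A = "{n. n \<in> {1..s} \<and> (\<forall>p\<in>?P. \<not> p dvd n)}"
    have fin: "finite ?P" by (rule finite_subset[of _ "{..m}"]) auto
    have "c * ln S / ln M \<le> (c / ln (real m)) * ln S"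
    proof -
      have "c / ln M \<le> c / ln (real m)" using MS m c by (intro divide_left_mono) auto
      then have "c / ln M * ln S \<le> c / ln (real m) * ln S" using MS by (intro mult_right_mono) auto
      then show ?thesis by simp
    qed
    also have "\<dots> \<le> (\<Prod>p\<in>?P. 1 - 1 / real p) * (\<Sum>n=1..s. 1 / real n)"
    proof (intro mult_mono c)
      have "ln S \<le> ln (real s + 1)" using s MS by (intro ln_mono) auto
      then show "ln S \<le> (\<Sum>n=1..s. 1 / real n)" using ln_le_sum_inverse[of s] by linarith
    qed (use m MS in \<open>auto intro!: prod_nonneg dest: prime_ge_1_nat\<close>)
    also have "\<dots> \<le> (\<Sum>n\<in>?A. 1 / real n)"
      using fin by (intro sum_inverse_sifted_ge) (auto dest: prime_gt_0_nat)
    also have "\<dots> \<le> 2 * (\<Sum>n | n \<in> ?A \<and> squarefree n. 1 / real n)"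
    proof (rule sum_inverse_le_squarefree)
      fix n d assume n: "n \<in> ?A" "d dvd n"
      then have "d \<le> n" "d > 0" by (auto intro: dvd_imp_le Nat.gr0I)
      then show "d \<in> ?A" using n by (auto dest: dvd_trans)
    qed auto
    also have "{n. n \<in> ?A \<and> squarefree n} = rough_squarefree M S"
      by (auto simp: rough_squarefree_def le not_le)
    finally have le2: "c * ln S / ln M \<le> 2 * (\<Sum>s\<in>rough_squarefree M S. 1 / real s)" .
    have "(c / 2) * ln S / ln M = (c * ln S / ln M) / 2" by simp
    also have "\<dots> \<le> (\<Sum>s\<in>rough_squarefree M S. 1 / real s)"
      using divide_right_mono[OF le2, of 2] by simp
    finally show "(\<Sum>s\<in>rough_squarefree M S. 1 / real s) \<ge> (c / 2) * ln S / ln M" .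
  qed (use c in auto)
qed

section \<open>Ramanujan sums and linear congruences\<close>

definition ramanujan_sum :: "nat \<Rightarrow> nat \<Rightarrow> real" where
  "ramanujan_sum r n = (\<Sum>a\<in>totatives r. cos (2 * pi * real n * (real a / real r)))"

text \<open>By the symmetry \<open>a \<mapsto> r - a\<close>. Consequently the sines of
  \<open>2 * pi * n * (a / r + \<beta>)\<close> add up over the totatives to the Ramanujan sum times
  the sine of \<open>2 * pi * n * \<beta>\<close>.\<close>

lemma sum_sin_totatives: "(\<Sum>a\<in>totatives r. sin (2 * pi * real n * (real a / real r))) = 0"
proof (cases "r > 1")
  case True
  have inv: "r - a \<in> totatives r" "a < r" if "a \<in> totatives r" for a
  proof -
    show less: "a < r" using that True by (rule totatives_less)
    have "gcd (r - a) ((r - a) + a) = gcd (r - a) a" by (rule gcd_add2)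
    also have "\<dots> = gcd r a" using less by (intro gcd_diff1_nat) simp
    finally have "gcd (r - a) ((r - a) + a) = gcd r a" .
    moreover have "(r - a) + a = r" using less by simp
    ultimately have "gcd (r - a) r = gcd a r" by (simp only: gcd.commute[of r a])
    moreover have "gcd a r = 1" using that by (simp add: in_totatives_iff)
    ultimately have "coprime (r - a) r" by (simp only: coprime_iff_gcd_eq_1)
    then show "r - a \<in> totatives r" using less by (simp add: in_totatives_iff)
  qed
  let ?f = "\<lambda>a. sin (2 * pi * real n * (real a / real r))"
  have "?f (r - a) = - ?f a" if "a \<in> totatives r" for a
  proof -
    have "2 * pi * real n * (real (r - a) / real r) = 2 * pi * of_int (int n) - 2 * pi * real n * (real a / real r)"
      using inv(2)[OF that] True by (simp add: of_nat_diff field_simps)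
    then show ?thesis
      using sin_int_2pin[of "int n"] cos_int_2pin[of "int n"] by (simp only: sin_diff)
  qed
  moreover have "sum ?f (totatives r) = (\<Sum>a\<in>totatives r. ?f (r - a))"
    by (rule sum.reindex_bij_witness[of _ "\<lambda>a. r - a" "\<lambda>a. r - a"]) (use inv in \<open>auto simp: less_imp_le\<close>)
  ultimately show ?thesis by (simp add: sum_negf)
next
  case False
  then have "r = 0 \<or> r = 1" by auto
  then show ?thesis using sin_int_2pin[of "int n"] by auto
qed

lemma ramanujan_sum_complex:
  "(\<Sum>a\<in>totatives r. cis (2 * pi * real n * (real a / real r))) = of_real (ramanujan_sum r n)"
  unfolding complex_eq_iff Re_sum Im_sum using sum_sin_totatives[of n r]
  by (simp add: ramanujan_sum_def)

text \<open>The Chinese remainder theorem for the fractions \<open>x / r + y / s\<close> modulo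
  \<open>1\<close>. Surjectivity follows from injectivity by counting, as \<open>totient\<close> is
  multiplicative.\<close>

lemma bij_betw_totatives_mult:
  assumes rs: "r > 1" "s > 1" "coprime r s"
  shows "bij_betw (\<lambda>(x, y). (x * s + y * r) mod (r * s)) (totatives r \<times> totatives s) (totatives (r * s))"
proof -
  let ?f = "\<lambda>(x, y). (x * s + y * r) mod (r * s)"
  have inj: "inj_on ?f (totatives r \<times> totatives s)"
  proof (rule inj_onI, clarify)
    fix x y x' y' assume xy: "x \<in> totatives r" "y \<in> totatives s" "x' \<in> totatives r" "y' \<in> totatives s"
      and eq: "(x * s + y * r) mod (r * s) = (x' * s + y' * r) mod (r * s)"
    have "[x * s + y * r = x' * s + y' * r] (mod r)" "[x * s + y * r = x' * s + y' * r] (mod s)"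
      using eq by (metis Cong.cong_def cong_modulus_mult_nat, metis Cong.cong_def cong_modulus_mult_nat mult.commute)
    then have "[x * s = x' * s] (mod r)" "[y * r = y' * r] (mod s)"
      by (auto simp: Cong.cong_def)
    then have "[x = x'] (mod r)" "[y = y'] (mod s)"
      using rs(3) by (auto simp: cong_mult_rcancel_nat coprime_commute)
    moreover have "x < r" "x' < r" "y < s" "y' < s" using xy rs by (auto intro: totatives_less)
    ultimately show "x = x' \<and> y = y'" by (simp add: Cong.cong_def)
  qed
  have sub: "?f ` (totatives r \<times> totatives s) \<subseteq> totatives (r * s)"
  proof clarify
    fix x y assume xy: "x \<in> totatives r" "y \<in> totatives s"
    have "coprime (x * s) r" "coprime (y * r) s"
      using xy rs(3) by (auto simp: in_totatives_iff coprime_commute)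
    then have "coprime ((x * s + y * r) mod r) r" "coprime ((y * r + x * s) mod s) s"
      using rs by (simp_all add: coprime_mod_left_iff)
    then have "coprime (x * s + y * r) r" "coprime (y * r + x * s) s"
      using rs by (simp_all only: coprime_mod_left_iff)
    then have "coprime (x * s + y * r) (r * s)" by (simp add: add.commute)
    moreover have "r * s \<noteq> 0" using rs by simp
    ultimately have c: "coprime ((x * s + y * r) mod (r * s)) (r * s)"
      by (metis coprime_mod_left_iff)
    moreover have "(x * s + y * r) mod (r * s) \<noteq> 0"
    proof
      assume "(x * s + y * r) mod (r * s) = 0"
      then have "r * s = 1" using c by simp
      then show False using rs by simp
    qed
    moreover have "(x * s + y * r) mod (r * s) \<le> r * s" using rs by (simp add: less_imp_le)
    ultimately show "(x * s + y * r) mod (r * s) \<in> totatives (r * s)"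
      by (simp add: in_totatives_iff)
  qed
  have "card (?f ` (totatives r \<times> totatives s)) = card (totatives (r * s))"
    using inj totient_mult_coprime[OF rs(3)] by (simp add: card_image totient_def card_cartesian_product)
  then have "?f ` (totatives r \<times> totatives s) = totatives (r * s)"
    using sub by (intro card_subset_eq) auto
  then show ?thesis using inj by (simp add: bij_betw_def)
qed

lemma cis_2pi_mod:
  fixes k n m :: nat
  assumes "m > 0"
  shows "cis (2 * pi * real n * (real (k mod m) / real m)) = cis (2 * pi * real n * (real k / real m))"
proof -
  have "real k = real (k mod m) + real m * real (k div m)"
    by (metis mod_mult_div_eq of_nat_add of_nat_mult)
  then have "2 * pi * real n * (real k / real m)
      = 2 * pi * real n * (real (k mod m) / real m) + 2 * pi * of_int (int (n * (k div m)))"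
    using assms by (simp add: field_simps)
  then show ?thesis by (simp only: cis_mult[symmetric] cis_2pi_int mult_1_right)
qed

lemma ramanujan_sum_mult:
  assumes "r > 0" "s > 0" "coprime r s"
  shows "ramanujan_sum (r * s) n = ramanujan_sum r n * ramanujan_sum s n"
proof (cases "r = 1 \<or> s = 1")
  case True
  have "cos (2 * pi * real n) = 1" using cos_int_2pin[of "int n"] by simp
  then have "ramanujan_sum 1 n = 1" by (simp add: ramanujan_sum_def)
  then show ?thesis using True by auto
next
  case False
  then have rs: "r > 1" "s > 1" using assms by auto
  let ?e = "\<lambda>r a. cis (2 * pi * real n * (real a / real r))"
  have "of_real (ramanujan_sum (r * s) n) = (\<Sum>a\<in>totatives (r * s). ?e (r * s) a)"
    by (rule ramanujan_sum_complex[symmetric])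
  also have "\<dots> = (\<Sum>z\<in>totatives r \<times> totatives s. ?e (r * s) (case z of (x, y) \<Rightarrow> (x * s + y * r) mod (r * s)))"
    by (rule sum.reindex_bij_betw[OF bij_betw_totatives_mult[OF rs assms(3)], symmetric])
  also have "\<dots> = (\<Sum>z\<in>totatives r \<times> totatives s. ?e r (fst z) * ?e s (snd z))"
  proof (rule sum.cong[OF refl])
    fix z assume "z \<in> totatives r \<times> totatives s"
    obtain x y where z: "z = (x, y)" by fastforce
    have "2 * pi * real n * (real (x * s + y * r) / real (r * s))
        = 2 * pi * real n * (real x / real r) + 2 * pi * real n * (real y / real s)"
      using rs by (simp add: field_simps)
    then show "?e (r * s) (case z of (x, y) \<Rightarrow> (x * s + y * r) mod (r * s)) = ?e r (fst z) * ?e s (snd z)"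
      unfolding z using rs by (simp only: prod.case fst_conv snd_conv cis_2pi_mod nat_0_less_mult_iff assms cis_mult simp_thms)
  qed
  also have "\<dots> = (\<Sum>x\<in>totatives r. ?e r x) * (\<Sum>y\<in>totatives s. ?e s y)"
    by (simp add: sum_product sum.cartesian_product case_prod_beta)
  also have "\<dots> = of_real (ramanujan_sum r n * ramanujan_sum s n)"
    by (simp only: ramanujan_sum_complex of_real_mult)
  finally show ?thesis by (simp only: of_real_eq_iff)
qed

lemma ramanujan_sum_prime:
  assumes "prime p"
  shows "ramanujan_sum p n = (if p dvd n then real p - 1 else - 1)"
proof -
  have p: "p > 0" using assms prime_gt_0_nat by blast
  let ?e = "\<lambda>a. cis (2 * pi * (of_int (int n) * real a / real p))"
  have "{..<p} = insert 0 {0<..<p}" using p by auto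
  then have "(\<Sum>a<p. ?e a) = 1 + (\<Sum>a\<in>{0<..<p}. ?e a)" by simp
  moreover have "(\<Sum>a\<in>{0<..<p}. ?e a) = of_real (ramanujan_sum p n)"
    unfolding ramanujan_sum_complex[symmetric] totatives_prime[OF assms] by (simp add: mult_ac)
  ultimately have "complex_of_real (ramanujan_sum p n) = (if p dvd n then of_nat p else 0) - 1"
    using sum_cis_residues[OF p, of "int n"] by (simp add: algebra_simps)
  also have "\<dots> = of_real (if p dvd n then real p - 1 else - 1)" by simp
  finally show ?thesis by (simp only: of_real_eq_iff)
qed

text \<open>The common value is the Moebius function of \<open>r\<close>; what matters later is that
  it is a sign independent of \<open>n\<close>. Both facts follow by splitting off one prime at a
  time.\<close>

lemma ramanujan_sum_squarefree_coprime:
  assumes "squarefree r" "coprime n r"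
  shows "\<bar>ramanujan_sum r n\<bar> = 1 \<and> ramanujan_sum r n = ramanujan_sum r 1"
  using assms
proof (induction r rule: less_induct)
  case (less r)
  have r0: "r > 0" using less.prems(1) by (auto intro: Nat.gr0I)
  show ?case
  proof (cases "r = 1")
    case True
    have "cos (2 * pi * real n) = 1" using cos_int_2pin[of "int n"] by simp
    then show ?thesis using True by (simp add: ramanujan_sum_def)
  next
    case False
    obtain p where p: "prime p" "p dvd r" using False prime_factor_nat by blast
    then obtain t where t: "r = p * t" by (auto elim: dvdE)
    have t0: "t > 0" "t < r" using r0 p(1) prime_gt_1_nat[of p] by (auto simp: t)
    have np: "\<not> p dvd t"
    proof
      assume "p dvd t"
      then have "p\<^sup>2 dvd r" by (simp add: t power2_eq_square)
      then show False using less.prems(1) p(1) squarefreeD[of r p] by (auto simp: prime_nat_iff)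
    qed
    then have cop: "coprime p t" using p(1) by (simp add: prime_imp_coprime)
    have sq: "squarefree t" using less.prems(1) by (rule squarefree_mono[rotated]) (simp add: t)
    have cn: "coprime n t" "\<not> p dvd n"
      using less.prems(2) p by (auto simp: t)
    have "\<not> p dvd 1" using p(1) by auto
    moreover have "\<bar>ramanujan_sum t 1\<bar> = 1" "ramanujan_sum t n = ramanujan_sum t 1"
      using less.IH[OF t0(2) sq cn(1)] by auto
    ultimately show ?thesis
      using cn(2) ramanujan_sum_mult[OF prime_gt_0_nat[OF p(1)] t0(1) cop]
        ramanujan_sum_prime[OF p(1)] by (simp add: t)
  qed
qed

section \<open>Linear congruences on intervals and partial summation\<close>

lemma linear_congruence_unique:
  fixes a j r :: nat
  assumes "coprime a r" "r > 0"
  obtains c where "c < r" "\<And>q. r dvd a * q + j \<longleftrightarrow> q mod r = c"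
proof -
  obtain x where x: "[a * x = 1] (mod r)" using cong_solve_coprime_nat[OF assms(1)] by auto
  define c where "c = nat ((- int x * int j) mod int r)"
  have cint: "int c = (- int x * int j) mod int r" using assms(2) by (simp add: c_def)
  have xi: "[int a * int x = 1] (mod int r)"
    using x by (metis cong_int_iff of_nat_1 of_nat_mult)
  show thesis
  proof (rule that[of c])
    have "int c < int r" unfolding cint using assms(2) by simp
    then show "c < r" by simp
    fix q
    have "r dvd a * q + j \<longleftrightarrow> int r dvd int a * int q + int j"
      by (metis int_dvd_int_iff of_nat_add of_nat_mult)
    also have "\<dots> \<longleftrightarrow> [int a * int q + int j = 0] (mod int r)" by (simp add: cong_0_iff)
    also have "\<dots> \<longleftrightarrow> [int q = - int x * int j] (mod int r)"
    proof
      assume "[int a * int q + int j = 0] (mod int r)"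
      then have "[int x * (int a * int q + int j) - int x * int j = int x * 0 - int x * int j] (mod int r)"
        by (intro cong_diff cong_mult cong_refl)
      then have "[(int a * int x) * int q = - int x * int j] (mod int r)" by (simp add: algebra_simps)
      moreover have "[(int a * int x) * int q = 1 * int q] (mod int r)"
        by (intro cong_mult xi cong_refl)
      ultimately show "[int q = - int x * int j] (mod int r)"
        by (metis cong_trans cong_sym mult_1)
    next
      assume "[int q = - int x * int j] (mod int r)"
      then have "[int a * int q + int j = int a * (- int x * int j) + int j] (mod int r)"
        by (intro cong_add cong_mult cong_refl)
      moreover have "[(int a * int x) * (- int j) + int j = 1 * (- int j) + int j] (mod int r)"
        by (intro cong_add cong_mult xi cong_refl)
      ultimately show "[int a * int q + int j = 0] (mod int r)"
        by (metis (no_types, opaque_lifting) cong_trans mult.assoc mult_minus_left mult_minus_right mult_1 add.left_inverse)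
    qed
    also have "\<dots> \<longleftrightarrow> int q mod int r = int c" by (simp add: Cong.cong_def cint)
    also have "\<dots> \<longleftrightarrow> q mod r = c" by (metis of_nat_eq_iff of_nat_mod)
    finally show "r dvd a * q + j \<longleftrightarrow> q mod r = c" .
  qed
qed

text \<open>As \<open>c < r\<close>, the difference \<open>t + r - c\<close> does not truncate, and
  the quotient is \<open>0\<close> as long as \<open>t < c\<close>. The value \<open>q = 0\<close>
  is counted.\<close>

lemma card_residue_atMost:
  fixes r c :: nat
  assumes "c < r"
  shows "card {q. q \<le> t \<and> q mod r = c} = (t + r - c) div r"
proof (induction t)
  case 0
  have "{q. q \<le> 0 \<and> q mod r = c} = (if c = 0 then {0} else {})" by auto
  then show ?case using assms by simp
next
  case (Suc t)
  have fin: "finite {q. q \<le> t \<and> q mod r = c}" by simp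
  have "{q. q \<le> Suc t \<and> q mod r = c} = (if Suc t mod r = c then insert (Suc t) {q. q \<le> t \<and> q mod r = c} else {q. q \<le> t \<and> q mod r = c})"
    by (auto simp: le_Suc_eq)
  then have card: "card {q. q \<le> Suc t \<and> q mod r = c} = (if Suc t mod r = c then Suc ((t + r - c) div r) else (t + r - c) div r)"
    using Suc fin by simp
  have eq: "Suc t + r - c = Suc (t + r - c)" using assms by simp
  have "Suc (t + r - c) mod r = 0 \<longleftrightarrow> Suc t mod r = c"
  proof -
    have "Suc (t + r - c) mod r = 0 \<longleftrightarrow> int r dvd int (Suc (t + r - c))"
      by (metis int_dvd_int_iff mod_0_imp_dvd dvd_imp_mod_0)
    also have "int (Suc (t + r - c)) = (int (Suc t) - int c) + int r" using assms by simp
    also have "int r dvd \<dots> \<longleftrightarrow> int r dvd int (Suc t) - int c" by simp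
    also have "\<dots> \<longleftrightarrow> int (Suc t) mod int r = int c mod int r" by (simp only: mod_eq_dvd_iff)
    also have "\<dots> \<longleftrightarrow> Suc t mod r = c" using assms by (metis mod_less of_nat_eq_iff of_nat_mod)
    finally show ?thesis .
  qed
  then show ?case unfolding card eq div_Suc by simp
qed

lemma card_congruence_interval:
  fixes a j r m t :: nat
  assumes "coprime a r" "r > 0" "m \<le> t"
  shows "\<bar>real (card {q\<in>{m<..t}. r dvd a * q + j}) - (real t - real m) / real r\<bar> \<le> 1"
proof -
  obtain c where c: "c < r" "\<And>q. r dvd a * q + j \<longleftrightarrow> q mod r = c"
    using linear_congruence_unique[OF assms(1,2)] by blast
  have "{q. q \<le> t \<and> q mod r = c} = {q. q \<le> m \<and> q mod r = c} \<union> {q\<in>{m<..t}. r dvd a * q + j}"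
    using assms(3) by (auto simp: c)
  moreover have "card ({q. q \<le> m \<and> q mod r = c} \<union> {q\<in>{m<..t}. r dvd a * q + j})
      = card {q. q \<le> m \<and> q mod r = c} + card {q\<in>{m<..t}. r dvd a * q + j}"
    by (intro card_Un_disjoint) auto
  ultimately have "card {q. q \<le> t \<and> q mod r = c}
      = card {q. q \<le> m \<and> q mod r = c} + card {q\<in>{m<..t}. r dvd a * q + j}"
    by (simp only:)
  then have eq: "(t + r - c) div r = (m + r - c) div r + card {q\<in>{m<..t}. r dvd a * q + j}"
    by (simp only: card_residue_atMost[OF c(1)])
  have fl: "real (n div r) \<le> real n / real r" "real n / real r < real (n div r) + 1" for n
    using floor_divide_of_nat_eq[of n r, where 'a = real] by linarith+
  have "real (t + r - c) / real r - real (m + r - c) / real r = (real t - real m) / real r"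
    using c(1) by (simp add: of_nat_diff diff_divide_distrib[symmetric])
  then show ?thesis
    using fl[of "t + r - c"] fl[of "m + r - c"] eq[THEN arg_cong[where f = real]] by simp linarith
qed

text \<open>Abel summation. The induction controls the sum minus its boundary term
  \<open>?D t * \<phi> t\<close> by the total decrease of \<open>\<phi>\<close>; the last boundary
  term costs the remaining \<open>\<phi> n\<close>.\<close>

lemma abel_inequality:
  fixes d \<phi> :: "nat \<Rightarrow> real"
  assumes "m < n"
    and D: "\<And>t. m \<le> t \<Longrightarrow> t \<le> n \<Longrightarrow> \<bar>\<Sum>i\<in>{m<..t}. d i\<bar> \<le> 1"
    and mono: "\<And>i. m < i \<Longrightarrow> i < n \<Longrightarrow> \<phi> (Suc i) \<le> \<phi> i"
    and nn: "\<phi> n \<ge> 0"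
  shows "\<bar>\<Sum>i\<in>{m<..n}. d i * \<phi> i\<bar> \<le> \<phi> (Suc m)"
proof -
  let ?D = "\<lambda>t. \<Sum>i\<in>{m<..t}. d i"
  have ins: "{m<..Suc t} = insert (Suc t) {m<..t}" if "m \<le> t" for t using that by auto
  have "\<bar>(\<Sum>i\<in>{m<..t}. d i * \<phi> i) - ?D t * \<phi> t\<bar> \<le> \<phi> (Suc m) - \<phi> t" if "Suc m \<le> t" "t \<le> n" for t
    using that
  proof (induction t rule: dec_induct)
    case base
    then show ?case by (simp add: ins)
  next
    case (step t)
    have "(\<Sum>i\<in>{m<..Suc t}. d i * \<phi> i) - ?D (Suc t) * \<phi> (Suc t)
        = ((\<Sum>i\<in>{m<..t}. d i * \<phi> i) - ?D t * \<phi> t) + ?D t * (\<phi> t - \<phi> (Suc t))"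
      using step by (simp add: ins algebra_simps)
    moreover have "\<bar>?D t * (\<phi> t - \<phi> (Suc t))\<bar> \<le> 1 * (\<phi> t - \<phi> (Suc t))"
      unfolding abs_mult using step mono[of t] D[of t] by (intro mult_mono) auto
    moreover have "\<bar>(\<Sum>i\<in>{m<..t}. d i * \<phi> i) - ?D t * \<phi> t\<bar> \<le> \<phi> (Suc m) - \<phi> t"
      using step by simp
    moreover have "\<bar>z\<bar> \<le> w - v" if "z = A + B" "\<bar>B\<bar> \<le> 1 * (u - v)" "\<bar>A\<bar> \<le> w - u" for z A B u v w :: real
      using that abs_triangle_ineq[of A B] by simp
    ultimately show ?case by blast
  qed
  from this[of n] have "\<bar>(\<Sum>i\<in>{m<..n}. d i * \<phi> i) - ?D n * \<phi> n\<bar> \<le> \<phi> (Suc m) - \<phi> n"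
    using assms(1) by simp
  moreover have "\<bar>?D n * \<phi> n\<bar> \<le> 1 * \<phi> n"
    unfolding abs_mult using D[of n] nn assms(1) by (intro mult_mono) auto
  ultimately show ?thesis by linarith
qed

text \<open>On every initial segment the number of solutions differs from its expected value by at
  most \<open>1\<close>; Abel summation carries this over to decreasing weights. With powers of the
  offset as weights this expresses that the frequencies near \<open>a / r\<close> are
  equidistributed.\<close>

lemma congruence_average:
  fixes a j r m n :: nat and \<phi> :: "nat \<Rightarrow> real"
  assumes "coprime a r" "r > 0" "m < n"
    and mono: "\<And>i. m < i \<Longrightarrow> i < n \<Longrightarrow> \<phi> (Suc i) \<le> \<phi> i"
    and nn: "\<phi> n \<ge> 0"
  shows "\<bar>\<Sum>q\<in>{m<..n}. ((if r dvd a * q + j then 1 else 0) - 1 / real r) * \<phi> q\<bar> \<le> \<phi> (Suc m)"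
proof (rule abel_inequality[OF assms(3) _ mono nn])
  fix t assume t: "m \<le> t" "t \<le> n"
  have "(\<Sum>i\<in>{m<..t}. (if r dvd a * i + j then 1 else 0) - 1 / real r)
      = real (card {q\<in>{m<..t}. r dvd a * q + j}) - (real t - real m) / real r"
    using t by (simp add: sum_subtractf of_nat_diff sum.If_cases Int_def)
  then show "\<bar>\<Sum>i\<in>{m<..t}. (if r dvd a * i + j then 1 else 0) - 1 / real r\<bar> \<le> 1"
    using card_congruence_interval[OF assms(1,2) t(1), of j] by simp
qed

section \<open>The test functions\<close>

lemma fraction_separation:
  fixes r s a b :: nat and k :: int
  assumes "coprime a r" "coprime b s" "0 < a" "a < r" "0 < b" "b < s" "(r, a) \<noteq> (s, b)"
  shows "\<bar>real a / real r - real b / real s - of_int k\<bar> \<ge> 1 / (real r * real s)"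
proof -
  define m where "m = int a * int s - int b * int r - k * (int r * int s)"
  have "m \<noteq> 0"
  proof
    assume "m = 0"
    then have e1: "int a * int s = int r * (int b + k * int s)"
      and e2: "int b * int r = int s * (int a - k * int r)"
      by (simp_all add: m_def algebra_simps)
    from e1 have "int r dvd int a * int s" by simp
    then have "int r dvd int s" using assms(1) by (simp add: coprime_dvd_mult_right_iff coprime_commute)
    moreover from e2 have "int s dvd int b * int r" by simp
    then have "int s dvd int r" using assms(2) by (simp add: coprime_dvd_mult_right_iff coprime_commute)
    ultimately have rs: "r = s" by (simp add: dvd_antisym)
    have "int r * int a = int r * (int b + k * int r)" using e1 rs by (simp add: mult.commute)
    then have ab: "int a = int b + k * int r" using assms(4) by simp
    then have "\<bar>k * int r\<bar> < int r" using assms(3-6) rs by linarith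
    then have "k = 0" using assms(4) by (cases "k = 0") (auto simp: abs_mult)
    then show False using ab rs assms(7) by simp
  qed
  then have "1 \<le> \<bar>m\<bar>" by linarith
  then have "1 \<le> \<bar>real_of_int m\<bar>" by linarith
  then have "1 / (real r * real s) \<le> \<bar>real_of_int m\<bar> / (real r * real s)"
    by (intro divide_right_mono) auto
  also have "\<dots> = \<bar>real_of_int m / (real r * real s)\<bar>" by (simp add: abs_divide abs_mult)
  also have "real_of_int m / (real r * real s) = real a / real r - real b / real s - of_int k"
    using assms(3-6) by (simp add: m_def field_simps)
  finally show ?thesis .
qed

lemma totatives_bounds: "a \<in> totatives r \<Longrightarrow> r \<ge> 2 \<Longrightarrow> 0 < a \<and> a < r \<and> coprime a r"
  using totatives_less[of a r] by (auto simp: in_totatives_iff)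

text \<open>\<open>r * r \<le> N\<close> makes the fractions \<open>1 / N\<close>-spaced, as the
  dual large sieve needs; \<open>8 * N \<le> r * Q\<close> leaves room for at least one offset
  \<open>j\<close>; \<open>4 * r \<le> Q\<close> makes the interval of moduli long enough to absorb
  the rounding in counts modulo \<open>r\<close>.\<close>

locale farey_test =
  fixes N :: nat and Q :: real and RR :: "nat set"
  assumes finite_RR [simp]: "finite RR"
    and N_pos: "N > 0" and Q_ge: "4 \<le> Q"
    and r_ge: "\<And>r. r \<in> RR \<Longrightarrow> 2 \<le> r"
    and r_sq: "\<And>r. r \<in> RR \<Longrightarrow> r * r \<le> N"
    and r_le: "\<And>r. r \<in> RR \<Longrightarrow> 4 * real r \<le> Q"
    and r_large: "\<And>r. r \<in> RR \<Longrightarrow> 8 * real N \<le> real r * Q"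
    and r_squarefree: "\<And>r. r \<in> RR \<Longrightarrow> squarefree r"
begin

definition lo :: nat where "lo = nat \<lfloor>Q / 2\<rfloor>"
definition hi :: nat where "hi = nat \<lfloor>Q\<rfloor>"
definition D :: "nat set" where "D = {lo<..hi}"
definition J :: "nat \<Rightarrow> nat" where "J r = nat \<lfloor>real r * Q / (8 * real N)\<rfloor>"
text \<open>For \<open>r \<in> RR\<close> the numerator is a sign, chosen so that
  \<open>A r * ramanujan_sum r n\<close> is \<open>1 / totient r\<close> whenever \<open>n\<close>
  is coprime to \<open>r\<close>.\<close>

definition A :: "nat \<Rightarrow> real" where "A r = ramanujan_sum r 1 / real (totient r)"
definition H :: real where "H = (\<Sum>r\<in>RR. 1 / real (totient r))"
definition FF :: "(nat \<times> nat) set" where "FF = (SIGMA r:RR. totatives r)"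
text \<open>
  The index \<open>((r, a), j)\<close> stands for the frequency \<open>a / r + j / (r * q)\<close>, which is a multiple of \<open>1 / q\<close>
  exactly when \<open>r\<close> divides \<open>a * q + j\<close>; the bound \<open>j \<le> J r\<close> keeps the offset below \<open>1 / (4 * N)\<close>.
\<close>

definition IX :: "nat \<Rightarrow> ((nat \<times> nat) \<times> nat) set" where
  "IX q = (SIGMA p:FF. {j\<in>{1..J (fst p)}. fst p dvd snd p * q + j})"
text \<open>The numerator of the frequency over the denominator \<open>q\<close>; on
  \<open>IX q\<close> the division is exact.\<close>

definition num :: "nat \<Rightarrow> (nat \<times> nat) \<times> nat \<Rightarrow> nat" where
  "num q z = (snd (fst z) * q + snd z) div fst (fst z)"
definition w :: "nat \<Rightarrow> nat \<Rightarrow> real" where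
  "w q x = (\<Sum>z\<in>IX q. A (fst (fst z)) * sin (2 * pi * real x * (real (num q z) / real q)))"
text \<open>What remains of the offsets once the condition \<open>r dvd a * q + j\<close> is
  replaced by its density \<open>1 / r\<close>.\<close>

definition S :: "nat \<Rightarrow> nat \<Rightarrow> real" where
  "S r n = (\<Sum>j=1..J r. \<Sum>q\<in>D. sin (2 * pi * real n * (real j / (real r * real q)))) / real r"

lemma finite_FF [simp]: "finite FF" by (simp add: FF_def)
lemma finite_IX [simp]: "finite (IX q)" by (simp add: IX_def)
lemma finite_D [simp]: "finite D" by (simp add: D_def)

lemma lo_bounds: "Q / 2 - 1 < real lo" "real lo \<le> Q / 2"
  and hi_bounds: "Q - 1 < real hi" "real hi \<le> Q"
  using Q_ge unfolding lo_def hi_def by linarith+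

lemma lo_less_hi: "lo < hi"
  using lo_bounds hi_bounds Q_ge by linarith

lemma D_bounds:
  assumes "q \<in> D"
  shows "q \<ge> 1" "Q / 2 < real q" "real q \<le> Q"
proof -
  have "real lo + 1 \<le> real q" "real q \<le> real hi" using assms by (auto simp: D_def)
  then show "q \<ge> 1" "Q / 2 < real q" "real q \<le> Q" using lo_bounds hi_bounds Q_ge by linarith+
qed

lemma card_D: "Q / 2 - 1 \<le> real (card D)" "real (card D) \<le> Q / 2 + 1"
  using lo_bounds hi_bounds lo_less_hi by (auto simp: D_def of_nat_diff)

lemma J_bounds:
  assumes "r \<in> RR"
  shows "real (J r) \<le> real r * Q / (8 * real N)" "real r * Q / (16 * real N) \<le> real (J r)" "J r \<ge> 1"
proof -
  let ?x = "real r * Q / (8 * real N)"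
  have x: "?x \<ge> 1" using r_large[OF assms] N_pos by simp
  then show 1: "real (J r) \<le> ?x" "J r \<ge> 1" unfolding J_def by linarith+
  have h: "t / 2 \<le> m" if "t - 1 < m" "1 \<le> m" for t m :: real using that by linarith
  have "?x - 1 < real (J r)" using x unfolding J_def by linarith
  then have "?x / 2 \<le> real (J r)" using 1 by (intro h) auto
  then show "real r * Q / (16 * real N) \<le> real (J r)" by simp
qed

lemma offset_bounds:
  assumes "r \<in> RR" "j \<in> {1..J r}" "Q / 2 < real q"
  shows "0 < real j / (real r * real q)" "real j / (real r * real q) \<le> 1 / (4 * real N)"
proof -
  have r: "real r > 0" using r_ge[OF assms(1)] by simp
  have q: "real q > 0" using assms(3) Q_ge by linarith
  show "0 < real j / (real r * real q)" using r q assms(2) by simp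
  have "real j \<le> real r * Q / (8 * real N)" using J_bounds(1)[OF assms(1)] assms(2) by simp
  also have "\<dots> \<le> real r * (2 * real q) / (8 * real N)"
    using assms(3) by (intro divide_right_mono mult_left_mono) auto
  finally have "real j \<le> real r * real q / (4 * real N)" by (simp add: mult.commute)
  then show "real j / (real r * real q) \<le> 1 / (4 * real N)"
    using r q N_pos by (simp add: field_simps)
qed

lemma num_div:
  assumes "z \<in> IX q" "q \<ge> 1"
  shows "real (num q z) / real q = real (snd (fst z)) / real (fst (fst z)) + real (snd z) / (real (fst (fst z)) * real q)"
proof -
  obtain r a j where z: "z = ((r, a), j)" by (metis surj_pair)
  have r: "r \<in> RR" "r dvd a * q + j" using assms(1) by (auto simp: z IX_def FF_def)
  then have "real (num q z) = real (a * q + j) / real r"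
    by (simp add: num_def z real_of_nat_div)
  then show ?thesis using assms(2) r_ge[OF r(1)] by (simp add: z field_simps)
qed

lemma FF_separated:
  assumes "p \<in> FF" "p' \<in> FF" "p \<noteq> p'"
  shows "\<bar>real (snd p) / real (fst p) - real (snd p') / real (fst p') - of_int k\<bar> \<ge> 1 / real N"
proof -
  obtain r a s b where p: "p = (r, a)" "p' = (s, b)" by fastforce
  have rs: "r \<in> RR" "s \<in> RR" "a \<in> totatives r" "b \<in> totatives s"
    using assms by (auto simp: p FF_def)
  have "real (r * s) \<le> real N"
  proof -
    have "(r * s)\<^sup>2 \<le> N\<^sup>2"
      using mult_mono[OF r_sq[OF rs(1)] r_sq[OF rs(2)]] by (simp add: power2_eq_square mult_ac)
    then have "r * s \<le> N" by simp
    then show ?thesis by (simp only: of_nat_le_iff)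
  qed
  then have "1 / real N \<le> 1 / (real r * real s)"
    using N_pos r_ge[OF rs(1)] r_ge[OF rs(2)] by (intro divide_left_mono) auto
  also have "\<dots> \<le> \<bar>real a / real r - real b / real s - of_int k\<bar>"
    using totatives_bounds[OF rs(3) r_ge[OF rs(1)]] totatives_bounds[OF rs(4) r_ge[OF rs(2)]] assms(3)
    by (intro fraction_separation) (auto simp: p)
  finally show ?thesis by (simp add: p)
qed

lemma num_less:
  assumes "z \<in> IX q" "q \<in> D"
  shows "num q z < q"
proof -
  obtain r a j where z: "z = ((r, a), j)" by (metis surj_pair)
  have r: "r \<in> RR" "a \<in> totatives r" "j \<in> {1..J r}" using assms(1) by (auto simp: z IX_def FF_def)
  have q: "q \<ge> 1" "Q / 2 < real q" using D_bounds[OF assms(2)] by auto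
  have r2: "real r \<ge> 2" using r_ge[OF r(1)] by simp
  have "a + 1 \<le> r" using totatives_bounds[OF r(2) r_ge[OF r(1)]] by simp
  then have "real a + 1 \<le> real r" by linarith
  then have "real a / real r \<le> 1 - 1 / real r" using r2 by (simp add: field_simps)
  moreover have "real j / (real r * real q) \<le> 1 / (4 * real N)" by (rule offset_bounds(2)[OF r(1,3) q(2)])
  moreover have "1 / (4 * real N) < 1 / real r"
  proof -
    have "r * 1 \<le> r * r" using r2 by (intro mult_left_mono) auto
    then have "r < 4 * N" using r_sq[OF r(1)] N_pos by linarith
    then show ?thesis using r2 N_pos by (simp add: field_simps)
  qed
  ultimately have "real (num q z) / real q < 1"
    using num_div[OF assms(1) q(1)] by (simp add: z)
  then show ?thesis using q(1) by (simp add: field_simps)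
qed

text \<open>Equal frequencies would put two fractions within \<open>1 / (4 * N)\<close> of each
  other, below their spacing \<open>1 / N\<close>. So the frequencies belonging to one
  \<open>q\<close> are distinct, as Parseval's identity requires.\<close>

lemma num_inj:
  assumes "q \<in> D"
  shows "inj_on (num q) (IX q)"
proof (rule inj_onI)
  fix z z' assume zz: "z \<in> IX q" "z' \<in> IX q" "num q z = num q z'"
  obtain r a j where z: "z = ((r, a), j)" by (metis surj_pair)
  obtain s b i where z': "z' = ((s, b), i)" by (metis surj_pair)
  have q: "q \<ge> 1" "Q / 2 < real q" using D_bounds[OF assms] by auto
  have r: "r \<in> RR" "(r, a) \<in> FF" "j \<in> {1..J r}" using zz(1) by (auto simp: z IX_def FF_def)
  have s: "s \<in> RR" "(s, b) \<in> FF" "i \<in> {1..J s}" using zz(2) by (auto simp: z' IX_def FF_def)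
  have eq: "real a / real r + real j / (real r * real q) = real b / real s + real i / (real s * real q)"
    using num_div[OF zz(1) q(1)] num_div[OF zz(2) q(1)] zz(3) by (simp add: z z')
  have h: "\<bar>x - y - of_int 0\<bar> < e" if "x + t = y + v" "0 < t" "t \<le> d" "0 < v" "v \<le> d" "d < e" for x y t v d e :: real
    using that by simp
  have "1 / (4 * real N) < 1 / real N" using N_pos by (simp add: field_simps)
  then have "\<bar>real a / real r - real b / real s - of_int 0\<bar> < 1 / real N"
    using h[OF eq] offset_bounds[OF r(1,3) q(2)] offset_bounds[OF s(1,3) q(2)] by blast
  then have "(r, a) = (s, b)" using FF_separated[OF r(2) s(2), of 0] by auto
  moreover from this have "j = i" using eq r_ge[OF r(1)] q(1) by simp
  ultimately show "z = z'" by (simp add: z z')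
qed

lemma w_odd:
  assumes "q \<in> D" "x < q"
  shows "w q ((q - x) mod q) = - w q x"
proof (cases "x = 0")
  case True
  then show ?thesis by (simp add: w_def)
next
  case False
  have "sin (2 * pi * real (q - x) * (real b / real q)) = - sin (2 * pi * real x * (real b / real q))" for b
  proof -
    have "2 * pi * real (q - x) * (real b / real q) = 2 * pi * of_int (int b) - 2 * pi * real x * (real b / real q)"
      using assms(2) by (simp add: of_nat_diff field_simps)
    then show ?thesis using sin_int_2pin[of "int b"] cos_int_2pin[of "int b"] by (simp only: sin_diff)
  qed
  then show ?thesis using False assms(2) by (simp add: w_def sum_negf)
qed

lemma w_mod:
  assumes "q \<in> D"
  shows "w q (n mod q) = w q n"
proof -
  have "sin (2 * pi * real (n mod q) * (real b / real q)) = sin (2 * pi * real n * (real b / real q))" for b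
  proof -
    have "q > 0" using D_bounds[OF assms] by simp
    from cis_2pi_mod[OF this, of b n]
    have "cis (2 * pi * real (n mod q) * (real b / real q)) = cis (2 * pi * real n * (real b / real q))"
      by (simp add: mult_ac)
    then show ?thesis by (simp add: complex_eq_iff)
  qed
  then show ?thesis by (simp add: w_def)
qed

lemma A_squared: "r \<in> RR \<Longrightarrow> (A r)\<^sup>2 = 1 / (real (totient r))\<^sup>2"
  using ramanujan_sum_squarefree_coprime[OF r_squarefree, of r 1]
  by (simp add: A_def power_divide flip: power2_abs[of "ramanujan_sum r (Suc 0)"])

lemma sum_FF: "(\<Sum>p\<in>FF. f p) = (\<Sum>r\<in>RR. \<Sum>a\<in>totatives r. f (r, a))"
  by (simp add: FF_def sum.Sigma)

lemma sum_IX: "(\<Sum>z\<in>IX q. f z) = (\<Sum>p\<in>FF. \<Sum>j | j \<in> {1..J (fst p)} \<and> fst p dvd snd p * q + j. f (p, j))"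
  by (simp add: IX_def sum.Sigma)

lemma sum_A_squared_FF: "(\<Sum>p\<in>FF. (A (fst p))\<^sup>2) = H"
proof -
  have "(\<Sum>p\<in>FF. (A (fst p))\<^sup>2) = (\<Sum>r\<in>RR. real (totient r) * (A r)\<^sup>2)"
    by (simp add: sum_FF totient_def)
  also have "\<dots> = H"
    unfolding H_def
  proof (rule sum.cong[OF refl])
    fix r assume r: "r \<in> RR"
    then have "totient r > 0" using r_ge[OF r] by simp
    then show "real (totient r) * (A r)\<^sup>2 = 1 / real (totient r)"
      unfolding A_squared[OF r] by (simp add: power2_eq_square)
  qed
  finally show ?thesis .
qed

text \<open>\<open>w q\<close> is the imaginary part of an exponential sum with distinct
  frequencies; indexed by the numerators it is accessible to Parseval's identity.\<close>

lemma w_norm_one: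
  assumes "q \<in> D"
  shows "(\<Sum>x<q. (w q x)\<^sup>2) \<le> real q * (\<Sum>z\<in>IX q. (A (fst (fst z)))\<^sup>2)"
proof -
  have q: "q > 0" using D_bounds[OF assms] by simp
  let ?inv = "the_inv_into (IX q) (num q)"
  define c where "c b = complex_of_real (A (fst (fst (?inv b))))" for b
  define T where "T x = (\<Sum>b\<in>num q ` IX q. c b * cis (2 * pi * real b * real x / real q))" for x
  have cn: "c (num q z) = of_real (A (fst (fst z)))" if "z \<in> IX q" for z
    using the_inv_into_f_f[OF num_inj[OF assms] that] by (simp add: c_def)
  have "(w q x)\<^sup>2 \<le> (cmod (T x))\<^sup>2" for x
  proof -
    have "T x
        = (\<Sum>z\<in>IX q. c (num q z) * cis (2 * pi * real (num q z) * real x / real q))"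
      unfolding T_def by (subst sum.reindex[OF num_inj[OF assms]]) simp
    also have "Im \<dots> = w q x"
      unfolding Im_sum w_def by (intro sum.cong refl) (simp add: cn mult_ac)
    finally have "\<bar>w q x\<bar> \<le> cmod (T x)"
      using abs_Im_le_cmod by metis
    then have "\<bar>w q x\<bar>\<^sup>2 \<le> (cmod (T x))\<^sup>2"
      by (intro power_mono) auto
    then show ?thesis by (simp only: power2_abs)
  qed
  then have "(\<Sum>x<q. (w q x)\<^sup>2)
      \<le> (\<Sum>x<q. (cmod (T x))\<^sup>2)"
    by (rule sum_mono)
  also have "\<dots> = real q * (\<Sum>b\<in>num q ` IX q. (cmod (c b))\<^sup>2)"
    unfolding T_def using num_less[OF _ assms] by (intro parseval_residues[OF q]) (auto simp: image_subset_iff)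
  also have "(\<Sum>b\<in>num q ` IX q. (cmod (c b))\<^sup>2) = (\<Sum>z\<in>IX q. (A (fst (fst z)))\<^sup>2)"
    by (subst sum.reindex[OF num_inj[OF assms]]) (simp add: cn)
  finally show ?thesis .
qed

lemma card_D_congruence_le:
  assumes "(r, a) \<in> FF"
  shows "real (card {q\<in>D. r dvd a * q + j}) \<le> Q / real r"
proof -
  have r: "r \<in> RR" "a \<in> totatives r" using assms by (auto simp: FF_def)
  have r2: "real r \<ge> 2" using r_ge[OF r(1)] by simp
  have "\<bar>real (card {q\<in>{lo<..hi}. r dvd a * q + j}) - (real hi - real lo) / real r\<bar> \<le> 1"
    using totatives_bounds[OF r(2) r_ge[OF r(1)]] lo_less_hi by (intro card_congruence_interval) auto
  then have "real (card {q\<in>D. r dvd a * q + j}) \<le> (real hi - real lo) / real r + 1"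
    unfolding D_def by linarith
  also have "\<dots> \<le> (Q / 2 + 1) / real r + real r / real r"
    using lo_bounds hi_bounds r2 by (intro add_mono divide_right_mono) auto
  also have "\<dots> \<le> Q / real r"
    unfolding add_divide_distrib[symmetric] using r_le[OF r(1)] r2 by (intro divide_right_mono) auto
  finally show ?thesis .
qed

text \<open>Each fraction with a given offset \<open>j\<close> occurs for at most
  \<open>Q / r\<close> moduli, and there are at most \<open>r * Q / (8 * N)\<close> offsets, so
  \<open>r\<close> cancels. The squared weights add up to \<open>H\<close>, since there are
  \<open>totient r\<close> fractions for each \<open>r\<close>.\<close>

lemma w_norm: "(\<Sum>q\<in>D. \<Sum>x<q. (w q x)\<^sup>2) \<le> Q ^ 3 / (8 * real N) * H"
proof -
  have "(\<Sum>q\<in>D. \<Sum>x<q. (w q x)\<^sup>2) \<le> (\<Sum>q\<in>D. Q * (\<Sum>z\<in>IX q. (A (fst (fst z)))\<^sup>2))"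
    using D_bounds by (intro sum_mono order_trans[OF w_norm_one] mult_right_mono sum_nonneg) auto
  also have "\<dots> = Q * (\<Sum>q\<in>D. \<Sum>p\<in>FF. \<Sum>j | j \<in> {1..J (fst p)} \<and> fst p dvd snd p * q + j. (A (fst p))\<^sup>2)"
    by (simp add: sum_distrib_left sum_IX)
  also have "(\<Sum>q\<in>D. \<Sum>p\<in>FF. \<Sum>j | j \<in> {1..J (fst p)} \<and> fst p dvd snd p * q + j. (A (fst p))\<^sup>2)
      = (\<Sum>p\<in>FF. \<Sum>q\<in>D. \<Sum>j | j \<in> {1..J (fst p)} \<and> fst p dvd snd p * q + j. (A (fst p))\<^sup>2)"
    by (rule sum.swap)
  also have "\<dots> = (\<Sum>p\<in>FF. \<Sum>j=1..J (fst p). \<Sum>q | q \<in> D \<and> fst p dvd snd p * q + j. (A (fst p))\<^sup>2)"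
    by (intro sum.cong refl sum.swap_restrict) auto
  also have "\<dots> \<le> (\<Sum>p\<in>FF. \<Sum>j=1..J (fst p). Q / real (fst p) * (A (fst p))\<^sup>2)"
  proof (intro sum_mono)
    fix p j assume p: "p \<in> FF"
    have "(\<Sum>q | q \<in> D \<and> fst p dvd snd p * q + j. (A (fst p))\<^sup>2)
        = real (card {q\<in>D. fst p dvd snd p * q + j}) * (A (fst p))\<^sup>2" by simp
    also have "\<dots> \<le> Q / real (fst p) * (A (fst p))\<^sup>2"
      using p card_D_congruence_le[of "fst p" "snd p" j] by (intro mult_right_mono) auto
    finally show "(\<Sum>q | q \<in> D \<and> fst p dvd snd p * q + j. (A (fst p))\<^sup>2) \<le> Q / real (fst p) * (A (fst p))\<^sup>2" .
  qed
  also have "\<dots> = (\<Sum>p\<in>FF. (real (J (fst p)) * Q / real (fst p)) * (A (fst p))\<^sup>2)" by (simp add: mult_ac)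
  also have "\<dots> \<le> (\<Sum>p\<in>FF. Q\<^sup>2 / (8 * real N) * (A (fst p))\<^sup>2)"
  proof (intro sum_mono mult_right_mono)
    fix p assume "p \<in> FF"
    then have r: "fst p \<in> RR" by (auto simp: FF_def)
    have "real (J (fst p)) * Q / real (fst p) \<le> real (fst p) * Q / (8 * real N) * Q / real (fst p)"
      using Q_ge by (intro divide_right_mono mult_right_mono J_bounds(1)[OF r]) auto
    also have "\<dots> = Q\<^sup>2 / (8 * real N)"
      using r_ge[OF r] by (simp add: power2_eq_square)
    finally show "real (J (fst p)) * Q / real (fst p) \<le> Q\<^sup>2 / (8 * real N)" .
  qed auto
  also have "\<dots> = Q\<^sup>2 / (8 * real N) * H"
    unfolding sum_distrib_left[symmetric] sum_A_squared_FF ..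
  finally have "(\<Sum>q\<in>D. \<Sum>x<q. (w q x)\<^sup>2) \<le> Q * (Q\<^sup>2 / (8 * real N) * H)"
    using Q_ge by (simp add: mult_left_mono)
  then show ?thesis by (simp add: power2_eq_square power3_eq_cube)
qed

text \<open>The angles stay between \<open>0\<close> and \<open>pi / 2\<close>, so Jordan's
  inequality makes \<open>S r n\<close> at least a multiple of \<open>n\<close>. The
  \<open>512\<close> comes from \<open>card D \<ge> Q / 4\<close> and from the sum of the
  \<open>j\<close>, which is at least \<open>(r * Q / (16 * N))^2 / 2\<close>.\<close>

lemma S_bounds:
  assumes "r \<in> RR" "n \<le> N"
  shows "real n * Q\<^sup>2 / (512 * (real N)\<^sup>2) \<le> S r n" "0 \<le> S r n" "S r n \<le> Q\<^sup>2 / (8 * real N)"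
proof -
  have r2: "real r \<ge> 2" using r_ge[OF assms(1)] by simp
  let ?s = "\<lambda>j q. sin (2 * pi * real n * (real j / (real r * real q)))"
  have lower: "?s j q \<ge> 4 * real n * real j / (real r * Q)" if "j \<in> {1..J r}" "q \<in> D" for j q
  proof -
    have q: "Q / 2 < real q" "real q \<le> Q" "real q > 0" using D_bounds[OF that(2)] by auto
    let ?x = "2 * real n * (real j / (real r * real q))"
    have "real n * (real j / (real r * real q)) \<le> real N * (1 / (4 * real N))"
      using offset_bounds[OF assms(1) that(1) q(1)] assms(2) by (intro mult_mono) auto
    also have "\<dots> = 1 / 4" using N_pos by simp
    finally have "?x \<le> 1 / 2" by (simp only: mult.assoc)
    then have "2 * ?x \<le> sin (pi * ?x)"
      by (intro sin_pi_ge) auto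
    moreover have "4 * real n * real j / (real r * Q) \<le> 4 * real n * real j / (real r * real q)"
      using q r2 by (intro divide_left_mono mult_left_mono) auto
    ultimately show ?thesis by (simp add: mult_ac)
  qed
  then have lower0: "?s j q \<ge> 0" if "j \<in> {1..J r}" "q \<in> D" for j q
    using that Q_ge by (smt (verit) divide_nonneg_nonneg mult_nonneg_nonneg of_nat_0_le_iff)
  show "0 \<le> S r n" unfolding S_def using lower0 by (intro divide_nonneg_nonneg sum_nonneg) auto
  have "(\<Sum>j=1..J r. \<Sum>q\<in>D. ?s j q) \<le> (\<Sum>j=1..J r. \<Sum>q\<in>D. 1)" by (intro sum_mono) auto
  also have "\<dots> = real (J r) * real (card D)" by simp
  also have "\<dots> \<le> (real r * Q / (8 * real N)) * Q"
    using J_bounds(1)[OF assms(1)] card_D(2) Q_ge by (intro mult_mono) auto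
  finally show "S r n \<le> Q\<^sup>2 / (8 * real N)"
    unfolding S_def using r2 by (simp add: field_simps power2_eq_square)
  let ?Y = "real r * Q / (16 * real N)"
  have J0: "?Y \<le> real (J r)" by (rule J_bounds(2)[OF assms(1)])
  have Y0: "?Y \<ge> 0" using Q_ge by simp
  have sumj: "(\<Sum>j=1..J r. real j) \<ge> ?Y\<^sup>2 / 2"
  proof -
    have "(\<Sum>j=1..J r. real j) = real (J r) * (real (J r) + 1) / 2"
      using double_gauss_sum_from_Suc_0[of "J r", where 'a = real] by simp
    also have "\<dots> \<ge> (real (J r))\<^sup>2 / 2" by (simp add: power2_eq_square algebra_simps)
    also have "(real (J r))\<^sup>2 / 2 \<ge> ?Y\<^sup>2 / 2" using J0 Y0 by (intro divide_right_mono power_mono) auto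
    finally show ?thesis .
  qed
  have "(Q / 4) * (4 * real n / (real r * Q)) * (?Y\<^sup>2 / 2)
      \<le> real (card D) * (4 * real n / (real r * Q)) * (\<Sum>j=1..J r. real j)"
    using card_D(1) Q_ge r2 sumj by (intro mult_mono) auto
  also have "\<dots> = (\<Sum>j=1..J r. \<Sum>q\<in>D. 4 * real n * real j / (real r * Q))"
    by (simp add: sum_distrib_left sum_divide_distrib mult_ac)
  also have "\<dots> \<le> (\<Sum>j=1..J r. \<Sum>q\<in>D. ?s j q)"
    by (intro sum_mono lower)
  finally have "(Q / 4) * (4 * real n / (real r * Q)) * (?Y\<^sup>2 / 2) / real r \<le> S r n"
    unfolding S_def by (intro divide_right_mono) auto
  moreover have "(Q / 4) * (4 * real n / (real r * Q)) * (?Y\<^sup>2 / 2) / real r = real n * Q\<^sup>2 / (512 * (real N)\<^sup>2)"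
    using r2 Q_ge by (simp add: power2_eq_square field_simps)
  ultimately show "real n * Q\<^sup>2 / (512 * (real N)\<^sup>2) \<le> S r n" by simp
qed

section \<open>Main term and error term of the test function\<close>

definition dev :: "nat \<times> nat \<Rightarrow> nat \<Rightarrow> nat \<Rightarrow> real" where
  "dev p j q = (if fst p dvd snd p * q + j then 1 else 0) - 1 / real (fst p)"

abbreviation wave :: "nat \<Rightarrow> nat \<times> nat \<Rightarrow> nat \<Rightarrow> nat \<Rightarrow> real" where
  "wave n p j q \<equiv> sin (2 * pi * real n * (real (snd p) / real (fst p) + real j / (real (fst p) * real q)))"

definition err :: "nat \<Rightarrow> real" where
  "err n = (\<Sum>p\<in>FF. \<Sum>j=1..J (fst p). \<Sum>q\<in>D. A (fst p) * dev p j q *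
      wave n p j q)"

text \<open>In the addition theorem the part with the sines of \<open>2 * pi * n * a / r\<close>
  cancels over the totatives; the cosines give the Ramanujan sum times \<open>S r n\<close>.\<close>

lemma main_term:
  "(\<Sum>p\<in>FF. \<Sum>j=1..J (fst p). \<Sum>q\<in>D. A (fst p) * (1 / real (fst p)) *
      wave n p j q)
   = (\<Sum>r\<in>RR. A r * ramanujan_sum r n * S r n)"
proof -
  have "(\<Sum>a\<in>totatives r. \<Sum>j=1..J r. \<Sum>q\<in>D. A r * (1 / real r) *
      sin (2 * pi * real n * (real a / real r + real j / (real r * real q))))
    = A r * ramanujan_sum r n * S r n" for r
  proof -
    define C where "C = (\<Sum>j=1..J r. \<Sum>q\<in>D. cos (2 * pi * real n * (real j / (real r * real q)))) / real r"
    have "(\<Sum>j=1..J r. \<Sum>q\<in>D. A r * (1 / real r) *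
        sin (2 * pi * real n * (real a / real r + real j / (real r * real q))))
      = A r * (sin (2 * pi * real n * (real a / real r)) * C + cos (2 * pi * real n * (real a / real r)) * S r n)" for a
      unfolding C_def S_def distrib_left[of "2 * pi * real n"] sin_add
      by (simp add: sum.distrib sum_distrib_left sum_divide_distrib distrib_left mult_ac)
    then have "(\<Sum>a\<in>totatives r. \<Sum>j=1..J r. \<Sum>q\<in>D. A r * (1 / real r) *
        sin (2 * pi * real n * (real a / real r + real j / (real r * real q))))
      = A r * ((\<Sum>a\<in>totatives r. sin (2 * pi * real n * (real a / real r))) * C
        + (\<Sum>a\<in>totatives r. cos (2 * pi * real n * (real a / real r))) * S r n)"
      by (simp add: sum.distrib sum_distrib_left sum_distrib_right distrib_left)
    then show ?thesis by (simp only: sum_sin_totatives ramanujan_sum_def) simp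
  qed
  then show ?thesis by (simp add: sum_FF)
qed

lemma sum_w:
  "(\<Sum>q\<in>D. w q (n mod q)) = (\<Sum>r\<in>RR. A r * ramanujan_sum r n * S r n) + err n"
proof -
  let ?i = "\<lambda>p j q. (if fst p dvd snd p * q + j then 1 else 0 :: real)"
  have "(\<Sum>q\<in>D. w q (n mod q)) = (\<Sum>q\<in>D. \<Sum>p\<in>FF. \<Sum>j=1..J (fst p). A (fst p) * ?i p j q * wave n p j q)"
  proof (rule sum.cong[OF refl])
    fix q assume q: "q \<in> D"
    have "w q (n mod q) = (\<Sum>z\<in>IX q. A (fst (fst z)) * wave n (fst z) (snd z) q)"
      unfolding w_mod[OF q] unfolding w_def using D_bounds(1)[OF q] by (intro sum.cong refl) (simp add: num_div)
    also have "\<dots> = (\<Sum>p\<in>FF. \<Sum>j | j \<in> {1..J (fst p)} \<and> fst p dvd snd p * q + j. A (fst p) * wave n p j q)"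
      by (simp add: sum_IX)
    also have "\<dots> = (\<Sum>p\<in>FF. \<Sum>j=1..J (fst p). A (fst p) * ?i p j q * wave n p j q)"
      by (intro sum.cong refl sum.mono_neutral_cong_left) auto
    finally show "w q (n mod q) = (\<Sum>p\<in>FF. \<Sum>j=1..J (fst p). A (fst p) * ?i p j q * wave n p j q)" .
  qed
  also have "\<dots> = (\<Sum>p\<in>FF. \<Sum>q\<in>D. \<Sum>j=1..J (fst p). A (fst p) * ?i p j q * wave n p j q)"
    by (rule sum.swap)
  also have "\<dots> = (\<Sum>p\<in>FF. \<Sum>j=1..J (fst p). \<Sum>q\<in>D. A (fst p) * ?i p j q * wave n p j q)"
    by (intro sum.cong refl sum.swap)
  also have "\<dots> = (\<Sum>p\<in>FF. \<Sum>j=1..J (fst p). \<Sum>q\<in>D. A (fst p) * (1 / real (fst p)) * wave n p j q) + err n"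
    unfolding err_def sum.distrib[symmetric]
    by (intro sum.cong refl) (simp add: dev_def algebra_simps)
  finally show ?thesis unfolding main_term .
qed

text \<open>
  In the error term the exponential of the offset is expanded into its power series: the
  coefficients \<open>E k p\<close> do not depend on \<open>n\<close>, so the dual large sieve applies to every power separately.
\<close>

definition E :: "nat \<Rightarrow> nat \<times> nat \<Rightarrow> real" where
  "E k p = (\<Sum>j=1..J (fst p). \<Sum>q\<in>D. dev p j q * (real j / (real (fst p) * real q)) ^ k)"

text \<open>For fixed \<open>j\<close> the powers of the offset decrease in \<open>q\<close>, so
  averaging over the congruence costs only the value at the left end \<open>q = Suc lo\<close>,
  where the offset is still at most \<open>1 / (4 * N)\<close>.\<close>

lemma E_le:
  assumes p: "p \<in> FF" and Jm: "\<And>r. r \<in> RR \<Longrightarrow> real (J r) \<le> Jm"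
  shows "\<bar>E k p\<bar> \<le> Jm * (1 / (4 * real N)) ^ k"
proof -
  obtain r a where ra: "p = (r, a)" by fastforce
  have r: "r \<in> RR" "a \<in> totatives r" using p by (auto simp: ra FF_def)
  have r2: "r \<ge> 2" by (rule r_ge[OF r(1)])
  have "\<bar>\<Sum>q\<in>D. dev (r, a) j q * (real j / (real r * real q)) ^ k\<bar> \<le> (1 / (4 * real N)) ^ k" if j: "j \<in> {1..J r}" for j
  proof -
    have "\<bar>\<Sum>q\<in>D. dev (r, a) j q * (real j / (real r * real q)) ^ k\<bar> \<le> (real j / (real r * real (Suc lo))) ^ k"
      unfolding D_def dev_def fst_conv snd_conv
    proof (rule congruence_average)
      show "coprime a r" "r > 0" using totatives_bounds[OF r(2) r2] r2 by auto
      show "lo < hi" by (rule lo_less_hi)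
      fix i assume "lo < i" "i < hi"
      then show "(real j / (real r * real (Suc i))) ^ k \<le> (real j / (real r * real i)) ^ k"
        using r2 by (intro power_mono divide_left_mono mult_left_mono) auto
    qed simp
    also have "\<dots> \<le> (1 / (4 * real N)) ^ k"
      using offset_bounds[OF r(1) j, of "Suc lo"] lo_bounds by (intro power_mono) auto
    finally show ?thesis .
  qed
  then have "\<bar>E k (r, a)\<bar> \<le> (\<Sum>j=1..J r. (1 / (4 * real N)) ^ k)"
    unfolding E_def ra fst_conv by (intro order_trans[OF sum_abs[of _ "{1..J r}"]] sum_mono)
  also have "\<dots> \<le> Jm * (1 / (4 * real N)) ^ k"
    using Jm[OF r(1)] by (simp add: mult_right_mono)
  finally show ?thesis unfolding ra .
qed

text \<open>In the \<open>k\<close>-th power, \<open>E k p\<close> brings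
  \<open>(1 / (4 * N)) ^ k\<close> and the waves bring at most \<open>(2 * pi * N) ^ k\<close>;
  together \<open>(pi / 2) ^ k\<close>, which the factorials sum up to \<open>exp (pi / 2)\<close>.
  The square root comes from Cauchy-Schwarz against \<open>g\<close> followed by the dual large
  sieve.\<close>

lemma err_le:
  assumes Jm: "\<And>r. r \<in> RR \<Longrightarrow> real (J r) \<le> Jm"
  shows "\<bar>\<Sum>n=1..N. g n * err n\<bar> \<le> exp (pi / 2) * (Jm * sqrt (5 * real N * H * (\<Sum>n=1..N. (g n)\<^sup>2)))"
proof (cases "RR = {}")
  case True
  then have "FF = {}" "H = 0" unfolding FF_def H_def by simp_all
  then show ?thesis by (simp add: err_def)
next
  case False
  then have Jm0: "Jm \<ge> 0" using Jm by (meson ex_in_conv of_nat_0_le_iff order_trans)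
  let ?e = "\<lambda>n p. cis (2 * pi * real n * (real (snd p) / real (fst p)))"
  let ?b = "\<lambda>p j q. real j / (real (fst p) * real q)"
  define G where "G = (\<Sum>n=1..N. (g n)\<^sup>2)"
  define B where "B = Jm * sqrt (5 * real N * H * G)"
  have H0: "H \<ge> 0" by (auto simp: H_def intro: sum_nonneg)
  have G0: "G \<ge> 0" by (auto simp: G_def intro: sum_nonneg)
  define X where "X = (\<Sum>n=1..N. \<Sum>p\<in>FF. \<Sum>j=1..J (fst p). \<Sum>q\<in>D.
      (of_real (g n * A (fst p) * dev p j q) * ?e n p) * exp (\<i> * of_real (2 * pi * real n * ?b p j q)))"
  define Z where "Z k = (\<Sum>n=1..N. \<Sum>p\<in>FF. \<Sum>j=1..J (fst p). \<Sum>q\<in>D.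
      (of_real (g n * A (fst p) * dev p j q) * ?e n p) * ((\<i> * of_real (2 * pi * real n * ?b p j q)) ^ k /\<^sub>R fact k))" for k
  have ImX: "Im X = (\<Sum>n=1..N. g n * err n)"
  proof -
    have "Im ((of_real (g n * A (fst p) * dev p j q) * ?e n p) * exp (\<i> * of_real (2 * pi * real n * ?b p j q)))
        = g n * (A (fst p) * dev p j q * sin (2 * pi * real n * (real (snd p) / real (fst p) + ?b p j q)))" for n p j q
      unfolding cis_conv_exp[symmetric] mult.assoc[of "of_real _"] cis_mult distrib_left[symmetric]
      by simp
    then show ?thesis unfolding X_def err_def Im_sum by (simp only: sum_distrib_left)
  qed
  have ZX: "Z sums X"
    unfolding Z_def X_def by (intro sums_sum sums_mult exp_converges)
  have aux: "x \<le> c * (t * b)" if "0 \<le> c" "0 \<le> b" "x = c * y" "y \<le> s * b" "s \<le> t" for x y c s t b :: real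
  proof -
    have "y \<le> t * b" using that(2,4,5) by (meson mult_right_mono order_trans)
    then show ?thesis using that(1,3) by (simp add: mult_left_mono)
  qed
  have Z: "cmod (Z k) \<le> B * ((pi / 2) ^ k /\<^sub>R fact k)" for k
  proof -
    define T where "T n = (\<Sum>p\<in>FF. of_real (A (fst p) * E k p) * ?e n p)" for n
    have "Z k = (\<Sum>n=1..N. ((\<i> * of_real (2 * pi)) ^ k /\<^sub>R fact k) * (of_real (g n * real n ^ k) * T n))"
      unfolding Z_def T_def E_def sum_distrib_left sum_distrib_right of_real_sum
      by (intro sum.cong refl) (simp add: power_mult_distrib scaleR_conv_of_real power_divide field_simps)
    then have "Z k = ((\<i> * of_real (2 * pi)) ^ k /\<^sub>R fact k) * (\<Sum>n=1..N. of_real (g n * real n ^ k) * T n)"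
      by (simp only: sum_distrib_left)
    then have n1: "cmod (Z k) = (2 * pi) ^ k / fact k * cmod (\<Sum>n=1..N. of_real (g n * real n ^ k) * T n)"
      by (simp add: norm_mult norm_power power_mult_distrib divide_inverse mult_ac)
    have n2: "cmod (\<Sum>n=1..N. of_real (g n * real n ^ k) * T n) \<le> (\<Sum>n=1..N. \<bar>g n\<bar> * cmod (T n)) * real N ^ k"
    proof -
      have "cmod (\<Sum>n=1..N. of_real (g n * real n ^ k) * T n) \<le> (\<Sum>n=1..N. \<bar>g n\<bar> * real n ^ k * cmod (T n))"
        by (intro sum_norm_le) (simp add: norm_mult abs_mult norm_power)
      also have "\<dots> \<le> (\<Sum>n=1..N. \<bar>g n\<bar> * real N ^ k * cmod (T n))"
        by (intro sum_mono mult_left_mono mult_right_mono power_mono) auto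
      also have "\<dots> = (\<Sum>n=1..N. \<bar>g n\<bar> * cmod (T n)) * real N ^ k"
        by (simp add: sum_distrib_left mult_ac)
      finally show ?thesis .
    qed
    have n3: "(\<Sum>n=1..N. \<bar>g n\<bar> * cmod (T n)) \<le> B * (1 / (4 * real N)) ^ k"
    proof -
      let ?\<epsilon> = "Jm * (1 / (4 * real N)) ^ k"
      have "(\<Sum>n=1..N. (cmod (T n))\<^sup>2) \<le> 5 * real N * (\<Sum>p\<in>FF. (cmod (of_real (A (fst p) * E k p)))\<^sup>2)"
        unfolding T_def using FF_separated N_pos by (intro large_sieve_dual) auto
      also have "\<dots> \<le> 5 * real N * (\<Sum>p\<in>FF. (A (fst p))\<^sup>2 * ?\<epsilon>\<^sup>2)"
      proof (intro mult_left_mono sum_mono)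
        fix p assume p: "p \<in> FF"
        have "\<bar>E k p\<bar>\<^sup>2 \<le> ?\<epsilon>\<^sup>2" using E_le[OF p Jm, of k] by (intro power_mono) auto
        then show "(cmod (of_real (A (fst p) * E k p)))\<^sup>2 \<le> (A (fst p))\<^sup>2 * ?\<epsilon>\<^sup>2"
          unfolding norm_of_real power2_abs power_mult_distrib[of "A (fst p)"] by (intro mult_left_mono) auto
      qed simp
      also have "\<dots> = 5 * real N * H * ?\<epsilon>\<^sup>2"
        by (simp add: sum_distrib_right[symmetric] sum_A_squared_FF)
      finally have T2: "(\<Sum>n=1..N. (cmod (T n))\<^sup>2) \<le> 5 * real N * H * ?\<epsilon>\<^sup>2" .
      have "(\<Sum>n=1..N. \<bar>g n\<bar> * cmod (T n))\<^sup>2 \<le> (\<Sum>n=1..N. \<bar>g n\<bar>\<^sup>2) * (\<Sum>n=1..N. (cmod (T n))\<^sup>2)"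
        by (rule Cauchy_Schwarz_ineq_sum)
      also have "\<dots> \<le> G * (5 * real N * H * ?\<epsilon>\<^sup>2)"
        unfolding G_def power2_abs using T2 by (intro mult_left_mono sum_nonneg) auto
      also have "\<dots> = (sqrt (5 * real N * H * G) * ?\<epsilon>)\<^sup>2"
        using H0 G0 by (simp add: power_mult_distrib)
      also have "\<dots> = (B * (1 / (4 * real N)) ^ k)\<^sup>2"
        unfolding B_def by (simp add: mult_ac)
      finally show ?thesis
        by (rule power2_le_imp_le) (use Jm0 H0 G0 in \<open>auto simp: B_def\<close>)
    qed
    have "cmod (Z k) \<le> (2 * pi) ^ k / fact k * (B * (1 / (4 * real N)) ^ k * real N ^ k)"
      by (rule aux[OF _ _ n1 n2 n3]) simp_all
    also have "\<dots> = B * ((2 * pi * (1 / (4 * real N)) * real N) ^ k / fact k)"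
      by (simp only: power_mult_distrib) (simp add: mult_ac)
    also have "2 * pi * (1 / (4 * real N)) * real N = pi / 2" using N_pos by simp
    also have "(pi / 2) ^ k / fact k = (pi / 2) ^ k /\<^sub>R fact k"
      unfolding real_scaleR_def divide_inverse by (rule mult.commute)
    finally show ?thesis .
  qed
  have "cmod X \<le> B * exp (pi / 2)"
    by (rule norm_sums_le[OF ZX sums_mult[OF exp_converges] Z])
  then show ?thesis using abs_Im_le_cmod[of X] by (simp add: ImX B_def G_def mult.commute)
qed

end

section \<open>Lower bounds for the variance\<close>

lemma card_residue_interval:
  assumes "a < q"
  shows "\<bar>real (card {n\<in>{1..N}. n mod q = a}) - real N / real q\<bar> \<le> 1"
proof -
  have "q dvd 1 * n + (q - a) \<longleftrightarrow> n mod q = a" for n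
  proof -
    have "q dvd 1 * n + (q - a) \<longleftrightarrow> int q dvd int (1 * n + (q - a))"
      by (simp only: int_dvd_int_iff)
    also have "int (1 * n + (q - a)) = (int n - int a) + int q"
      using assms by (simp add: of_nat_diff)
    also have "int q dvd (int n - int a) + int q \<longleftrightarrow> int q dvd int n - int a" by simp
    also have "\<dots> \<longleftrightarrow> int n mod int q = int a mod int q" by (simp only: mod_eq_dvd_iff)
    also have "\<dots> \<longleftrightarrow> n mod q = a" using assms by (metis mod_less of_nat_eq_iff of_nat_mod)
    finally show ?thesis .
  qed
  moreover have "{0<..N} = {1..N}" by auto
  ultimately show ?thesis
    using card_congruence_interval[of 1 q 0 N "q - a"] assms by simp
qed

lemma card_moduli_le:
  assumes "Q \<ge> 0"
  shows "real (card {q::nat. 1 \<le> q \<and> real q \<le> Q}) \<le> Q"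
proof -
  have "{q::nat. 1 \<le> q \<and> real q \<le> Q} = {1..nat \<lfloor>Q\<rfloor>}"
    using assms by (auto simp: le_nat_iff le_floor_iff)
  then show ?thesis using assms by simp
qed

text \<open>This controls the part \<open>1\<close> of \<open>f = 1 - g\<close>: the number of
  \<open>n\<close> in a residue class differs from \<open>N / q\<close> by at most \<open>1\<close>,
  so the squared deviations add up to at most \<open>Q^2\<close>.\<close>

lemma odd_correlation_one:
  fixes w :: "nat \<Rightarrow> nat \<Rightarrow> real" and D :: "nat set" and Q :: real
  assumes D: "\<And>q. q \<in> D \<Longrightarrow> 1 \<le> q \<and> real q \<le> Q" and Q: "Q \<ge> 0"
    and odd: "\<And>q a. q \<in> D \<Longrightarrow> a < q \<Longrightarrow> w q ((q - a) mod q) = - w q a"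
  shows "(\<Sum>q\<in>D. \<Sum>n=1..N. w q (n mod q))\<^sup>2 \<le> Q\<^sup>2 * (\<Sum>q\<in>D. \<Sum>a<q. (w q a)\<^sup>2)"
proof -
  have sub: "D \<subseteq> {q. 1 \<le> q \<and> real q \<le> Q}" using D by auto
  then have fin: "finite D" using finite_moduli finite_subset by blast
  define d where "d q a = (\<Sum>n | 1 \<le> n \<and> n \<le> N \<and> [n = a] (mod q). 1) - real N / real q" for q a
  have "(\<Sum>n=1..N. w q (n mod q)) = (\<Sum>a<q. d q a * w q a)" if q: "q \<in> D" for q
    using sum_odd_test_function[of q "w q" "\<lambda>_. 1" N "\<lambda>_. real N / real q"] D[OF q] odd[OF q]
    by (simp add: d_def)
  then have "(\<Sum>q\<in>D. \<Sum>n=1..N. w q (n mod q)) = (\<Sum>q\<in>D. \<Sum>a<q. d q a * w q a)" by simp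
  also have "\<dots>\<^sup>2 \<le> (\<Sum>q\<in>D. \<Sum>a<q. (d q a)\<^sup>2) * (\<Sum>q\<in>D. \<Sum>a<q. (w q a)\<^sup>2)"
    by (rule Cauchy_Schwarz_residues[OF fin])
  also have "\<dots> \<le> Q\<^sup>2 * (\<Sum>q\<in>D. \<Sum>a<q. (w q a)\<^sup>2)"
  proof (intro mult_right_mono sum_nonneg)
    have "(\<Sum>q\<in>D. \<Sum>a<q. (d q a)\<^sup>2) \<le> (\<Sum>q\<in>D. \<Sum>a<q. 1)"
    proof (intro sum_mono)
      fix q a :: nat assume "a \<in> {..<q}"
      then have "{n. 1 \<le> n \<and> n \<le> N \<and> [n = a] (mod q)} = {n\<in>{1..N}. n mod q = a}" "a < q"
        by (auto simp: Cong.cong_def)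
      then have "\<bar>d q a\<bar> \<le> 1" unfolding d_def using card_residue_interval[of a q N] by simp
      then show "(d q a)\<^sup>2 \<le> 1" by (simp add: abs_square_le_1)
    qed
    also have "\<dots> \<le> (\<Sum>q\<in>D. Q)" using D by (intro sum_mono) auto
    also have "\<dots> \<le> (\<Sum>q | 1 \<le> q \<and> real q \<le> Q. Q)" by (intro sum_mono2 finite_moduli sub Q)
    also have "\<dots> \<le> Q * Q"
      using card_moduli_le[OF Q] Q by (simp add: mult_right_mono)
    finally show "(\<Sum>q\<in>D. \<Sum>a<q. (d q a)\<^sup>2) \<le> Q\<^sup>2" by (simp add: power2_eq_square)
  qed auto
  finally show ?thesis .
qed

section \<open>Square waves and the range of large \<open>Q\<close>\<close>

definition square_wave :: "nat \<Rightarrow> nat \<Rightarrow> real" where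
  "square_wave q a = (if a = 0 \<or> 2 * a = q then 0 else if 2 * a < q then 1 else - 1)"

lemma square_wave_odd:
  assumes "a < q"
  shows "square_wave q ((q - a) mod q) = - square_wave q a"
  using assms by (cases "a = 0") (auto simp: square_wave_def)

text \<open>The partial sums form a triangular wave: they rise through the first half of the period,
  fall through the second and are back at \<open>0\<close> for
  \<open>N mod q = q - 1\<close>.\<close>

lemma sum_square_wave:
  assumes "q > 0"
  shows "(\<Sum>n=1..N. square_wave q (n mod q)) = real (min (N mod q) (q - 1 - N mod q))"
proof (induction N)
  case (Suc N)
  define s where "s = N mod q"
  have s: "s < q" using assms by (simp add: s_def)
  have "(\<Sum>n=1..Suc N. square_wave q (n mod q)) = real (min s (q - 1 - s)) + square_wave q (Suc N mod q)"
    using Suc by (simp add: s_def)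
  also have "Suc N mod q = (if Suc s = q then 0 else Suc s)"
    by (simp add: mod_Suc s_def)
  also have "real (min s (q - 1 - s)) + square_wave q (if Suc s = q then 0 else Suc s)
      = real (min (if Suc s = q then 0 else Suc s) (q - 1 - (if Suc s = q then 0 else Suc s)))"
    using s by (auto simp: square_wave_def min_def of_nat_diff)
  finally show ?case by (simp add: mod_Suc s_def)
qed simp

lemma card_nat_between_ge:
  fixes u v :: real
  assumes "0 \<le> u"
  shows "real (card {q::nat. u \<le> real q \<and> real q \<le> v}) \<ge> v - u - 1"
proof (cases "u \<le> v")
  case True
  have "{q::nat. u \<le> real q \<and> real q \<le> v} = {nat \<lceil>u\<rceil>..nat \<lfloor>v\<rfloor>}"
    using assms True by (auto simp: le_nat_iff le_floor_iff nat_le_iff ceiling_le_iff)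
  moreover have "real (card {nat \<lceil>u\<rceil>..nat \<lfloor>v\<rfloor>}) \<ge> v - u - 1"
    using assms True by simp linarith
  ultimately show ?thesis by simp
qed simp

text \<open>For the quotient \<open>k = N div q\<close> a remainder between \<open>q / 4\<close> and
  \<open>3 * q / 4\<close> means that \<open>q\<close> lies in \<open>I k\<close>. The
  \<open>k\<close> between \<open>x = N / Q\<close> and \<open>4 * x\<close> give at least
  \<open>2 * x\<close> disjoint intervals of length at least \<open>Q / (46 * x)\<close>. One point
  may be lost per interval, in all at most \<open>4 * x \<le> Q / 50\<close>; this is where
  \<open>200 * N \<le> Q^2\<close> enters.\<close>

lemma card_moduli_middle_remainder:
  fixes N :: nat and Q :: real
  assumes Q: "Q \<le> real N" "Q > 0" and large: "200 * real N \<le> Q\<^sup>2"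
  shows "real (card {q. Q / 8 \<le> real q \<and> real q \<le> Q \<and> q \<le> 4 * (N mod q) \<and> 4 * (N mod q) \<le> 3 * q}) \<ge> Q / 50"
    (is "real (card ?D) \<ge> _")
proof -
  define x where "x = real N / Q"
  have x1: "x \<ge> 1" using Q by (simp add: x_def)
  have N: "real N = x * Q" using Q by (simp add: x_def)
  define K where "K = {k::nat. x \<le> real k \<and> real k \<le> 4 * x}"
  define I where "I k = {q::nat. 4 * real N / (4 * real k + 3) \<le> real q \<and> real q \<le> 4 * real N / (4 * real k + 1)}" for k
  have finK: "finite K" by (rule finite_subset[of _ "{..nat \<lfloor>4 * x\<rfloor>}"]) (use x1 in \<open>auto simp: K_def le_nat_iff le_floor_iff\<close>)
  have finI: "finite (I k)" for k
    by (rule finite_subset[of _ "{..nat \<lfloor>4 * real N / (4 * real k + 1)\<rfloor>}"]) (auto simp: I_def le_nat_iff le_floor_iff)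
  have I: "N div q = k \<and> q \<le> 4 * (N mod q) \<and> 4 * (N mod q) \<le> 3 * q" if q: "q \<in> I k" and k: "k \<in> K" for q k
  proof -
    have "4 * real N \<le> (4 * real k + 3) * real q" "(4 * real k + 1) * real q \<le> 4 * real N"
      using q by (auto simp: I_def field_simps)
    then have "real (4 * N) \<le> real ((4 * k + 3) * q)" "real ((4 * k + 1) * q) \<le> real (4 * N)"
      by (simp_all add: algebra_simps)
    then have h: "4 * N \<le> (4 * k + 3) * q" "(4 * k + 1) * q \<le> 4 * N"
      by (simp_all only: of_nat_le_iff)
    have "N > 0" using Q by simp
    then have q0: "q > 0" using h(1) by (auto intro!: Nat.gr0I)
    have "k * q \<le> N" "N < Suc k * q" using h q0 by (auto simp: algebra_simps)
    then have d: "N div q = k" by (intro div_nat_eqI) (simp_all add: mult.commute)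
    then have "N = k * q + N mod q" by (metis div_mult_mod_eq)
    then show ?thesis using h d by (auto simp: algebra_simps)
  qed
  have sub: "(\<Union>k\<in>K. I k) \<subseteq> ?D"
  proof
    fix q assume "q \<in> (\<Union>k\<in>K. I k)"
    then obtain k where k: "k \<in> K" "q \<in> I k" by auto
    have kx: "x \<le> real k" "real k \<le> 4 * x" using k(1) by (auto simp: K_def)
    have "real q \<le> 4 * real N / (4 * real k + 1)" using k(2) by (simp add: I_def)
    also have "\<dots> \<le> 4 * real N / (4 * x)" using kx x1 by (intro divide_left_mono) auto
    also have "\<dots> = Q" using x1 by (simp add: N)
    finally have 1: "real q \<le> Q" .
    have "Q / 8 = 4 * real N / (32 * x)" using x1 by (simp add: N)
    also have "\<dots> \<le> 4 * real N / (4 * real k + 3)" using kx x1 by (intro divide_left_mono) auto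
    also have "\<dots> \<le> real q" using k(2) by (simp add: I_def)
    finally show "q \<in> ?D" using 1 I[OF k(2,1)] by simp
  qed
  have finD: "finite ?D"
    by (rule finite_subset[of _ "{..nat \<lfloor>Q\<rfloor>}"]) (use Q in \<open>auto simp: le_nat_iff le_floor_iff\<close>)
  have "real (card K) \<ge> 4 * x - x - 1" unfolding K_def using x1 by (intro card_nat_between_ge) auto
  then have K1: "real (card K) \<ge> 2 * x" using x1 by linarith
  have "K \<subseteq> {1..nat \<lfloor>4 * x\<rfloor>}"
    using x1 by (auto simp: K_def le_nat_iff le_floor_iff Suc_le_eq intro!: Nat.gr0I)
  then have "card K \<le> card {1..nat \<lfloor>4 * x\<rfloor>}" by (intro card_mono) auto
  then have "real (card K) \<le> real (nat \<lfloor>4 * x\<rfloor>)" by simp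
  also have "\<dots> \<le> 4 * x" using x1 by (intro of_nat_floor) auto
  finally have K2: "real (card K) \<le> 4 * x" .
  have cI: "real (card (I k)) \<ge> Q / (46 * x) - 1" if k: "k \<in> K" for k
  proof -
    have kx: "real k \<le> 4 * x" using k by (auto simp: K_def)
    have "(4 * real k + 1) * (4 * real k + 3) \<le> (19 * x) * (19 * x)"
      using kx x1 by (intro mult_mono) auto
    then have "(4 * real k + 1) * (4 * real k + 3) \<le> 361 * (x * x)" by simp
    moreover have xx: "x * x > 0" using x1 by simp
    ultimately have "8 * real N / (368 * (x * x)) \<le> 8 * real N / ((4 * real k + 1) * (4 * real k + 3))"
      by (intro divide_left_mono) auto
    also have "\<dots> = 4 * real N / (4 * real k + 1) - 4 * real N / (4 * real k + 3)"
      by (simp add: field_simps)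
    finally have "4 * real N / (4 * real k + 1) - 4 * real N / (4 * real k + 3) \<ge> Q / (46 * x)"
      using x1 by (simp add: N)
    moreover have "real (card (I k)) \<ge> 4 * real N / (4 * real k + 1) - 4 * real N / (4 * real k + 3) - 1"
      unfolding I_def by (intro card_nat_between_ge) auto
    ultimately show ?thesis by linarith
  qed
  have disj: "\<forall>k\<in>K. \<forall>l\<in>K. k \<noteq> l \<longrightarrow> I k \<inter> I l = {}"
    using I by blast
  have "4 * x \<le> Q / 50"
  proof -
    have "200 * x * Q \<le> Q * Q" using large by (simp add: N power2_eq_square)
    then show ?thesis using Q by simp
  qed
  moreover have "Q / 23 - 4 * x \<le> real (card K) * (Q / (46 * x)) - real (card K)"
  proof -
    have "Q / 23 = 2 * x * (Q / (46 * x))" using x1 by simp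
    also have "\<dots> \<le> real (card K) * (Q / (46 * x))" using K1 x1 Q by (intro mult_right_mono) auto
    finally show ?thesis using K2 by linarith
  qed
  moreover have "real (card K) * (Q / (46 * x)) - real (card K) = (\<Sum>k\<in>K. Q / (46 * x) - 1)"
    by (simp add: right_diff_distrib)
  moreover have "\<dots> \<le> (\<Sum>k\<in>K. real (card (I k)))" by (intro sum_mono cI)
  moreover have "\<dots> = real (card (\<Union>k\<in>K. I k))"
    using finK finI disj by (simp add: card_UN_disjoint)
  moreover have "\<dots> \<le> real (card ?D)" using sub finD by (simp add: card_mono)
  ultimately show ?thesis using Q by linarith
qed

text \<open>A middle remainder gives a correlation of at least \<open>Q / 32 - 1\<close> with the
  constant \<open>1\<close>, of which \<open>g\<close> destroys at most \<open>Q / 128\<close>; as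
  \<open>128 \<le> Q\<close>, at least \<open>Q / 64\<close> remains. The final constant is
  \<open>50 * 64^2\<close>.\<close>

lemma variance_lower_square:
  fixes g :: "nat \<Rightarrow> real"
  assumes Q: "Q \<le> real N" "128 \<le> Q" and large: "200 * real N \<le> Q\<^sup>2"
    and g: "\<And>n. 0 \<le> g n" and small: "(\<Sum>n=1..N. g n) \<le> Q / 128"
  shows "ap_variance N Q (\<lambda>n. of_real (1 - g n)) \<ge> Q\<^sup>2 / 204800"
proof -
  let ?D = "{q. Q / 8 \<le> real q \<and> real q \<le> Q \<and> q \<le> 4 * (N mod q) \<and> 4 * (N mod q) \<le> 3 * q}"
  let ?V = "ap_variance N Q (\<lambda>n. of_real (1 - g n))"
  have cD: "real (card ?D) \<ge> Q / 50"
    using Q large by (intro card_moduli_middle_remainder) auto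
  have D: "1 \<le> q" if "q \<in> ?D" for q using that Q by (auto intro!: Nat.gr0I simp: Suc_le_eq)
  have "(\<Sum>n=1..N. (1 - g n) * square_wave q (n mod q)) \<ge> Q / 64" if q: "q \<in> ?D" for q
  proof -
    have q0: "q > 0" using D[OF q] by simp
    have "real q \<le> 4 * (real (min (N mod q) (q - 1 - N mod q)) + 1)"
    proof -
      have "q \<le> 4 * (min (N mod q) (q - 1 - N mod q) + 1)" using q q0 by (auto simp: min_def)
      then have "real q \<le> real (4 * (min (N mod q) (q - 1 - N mod q) + 1))" by (simp only: of_nat_le_iff)
      then show ?thesis by simp
    qed
    then have 1: "(\<Sum>n=1..N. square_wave q (n mod q)) \<ge> Q / 32 - 1"
      using q by (subst sum_square_wave[OF q0]) auto
    have "(\<Sum>n=1..N. g n * square_wave q (n mod q)) \<le> (\<Sum>n=1..N. g n * 1)"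
      by (intro sum_mono mult_left_mono g) (auto simp: square_wave_def)
    then have 2: "(\<Sum>n=1..N. g n * square_wave q (n mod q)) \<le> Q / 128" using small by simp
    have "(\<Sum>n=1..N. (1 - g n) * square_wave q (n mod q))
        = (\<Sum>n=1..N. square_wave q (n mod q)) - (\<Sum>n=1..N. g n * square_wave q (n mod q))"
      by (simp add: left_diff_distrib sum_subtractf)
    then show ?thesis using 1 2 Q by linarith
  qed
  then have "(\<Sum>q\<in>?D. \<Sum>n=1..N. (1 - g n) * square_wave q (n mod q)) \<ge> (\<Sum>q\<in>?D. Q / 64)"
    by (rule sum_mono)
  then have "(real (card ?D) * (Q / 64))\<^sup>2 \<le> (\<Sum>q\<in>?D. \<Sum>n=1..N. (1 - g n) * square_wave q (n mod q))\<^sup>2"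
    using Q by (intro power_mono) auto
  also have "\<dots> \<le> ?V * (\<Sum>q\<in>?D. \<Sum>a<q. (square_wave q a)\<^sup>2)"
    using D by (intro variance_duality square_wave_odd) auto
  also have "\<dots> \<le> ?V * (real (card ?D) * Q)"
  proof (intro mult_left_mono ap_variance_nonneg)
    have "(\<Sum>q\<in>?D. \<Sum>a<q. (square_wave q a)\<^sup>2) \<le> (\<Sum>q\<in>?D. \<Sum>a<q. 1)"
      by (intro sum_mono) (auto simp: square_wave_def)
    also have "\<dots> \<le> (\<Sum>q\<in>?D. Q)" by (intro sum_mono) auto
    finally show "(\<Sum>q\<in>?D. \<Sum>a<q. (square_wave q a)\<^sup>2) \<le> real (card ?D) * Q" by simp
  qed
  finally have "(real (card ?D) * Q) * (real (card ?D) * Q / 4096) \<le> (real (card ?D) * Q) * ?V"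
    by (simp add: power2_eq_square mult_ac)
  moreover have "real (card ?D) * Q > 0" using cD Q by (intro mult_pos_pos) auto
  ultimately have "real (card ?D) * Q / 4096 \<le> ?V" by (simp only: mult_le_cancel_left_pos)
  moreover have "Q / 50 * Q / 4096 \<le> real (card ?D) * Q / 4096"
    using cD Q by (intro divide_right_mono mult_right_mono) auto
  ultimately show ?thesis by (simp add: power2_eq_square)
qed

section \<open>Duality with the Farey test function\<close>

context farey_test
begin

text \<open>The correlation of \<open>w\<close> with \<open>g\<close> is at least
  \<open>H * B / 2\<close> after subtraction of the error, and that with the constant
  \<open>1\<close> at most \<open>H * B / 4\<close> by \<open>Q_small\<close>. The square of what
  remains is divided by the bound \<open>W\<close> for the norm of \<open>w\<close>.\<close>

lemma variance_lower:
  fixes g :: "nat \<Rightarrow> real"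
  assumes B: "B > 0" and H: "H > 0"
    and corr: "\<And>r. r \<in> RR \<Longrightarrow> (\<Sum>n=1..N. g n * (ramanujan_sum r 1 * ramanujan_sum r n * S r n)) \<ge> B"
    and Jm: "\<And>r. r \<in> RR \<Longrightarrow> real (J r) \<le> Jm"
    and err_small: "exp (pi / 2) * (Jm * sqrt (5 * real N * H * (\<Sum>n=1..N. (g n)\<^sup>2))) \<le> H * B / 2"
    and Q_small: "2 * Q ^ 5 \<le> real N * H * B\<^sup>2"
  shows "ap_variance N Q (\<lambda>n. of_real (1 - g n)) \<ge> H * B\<^sup>2 * real N / (2 * Q ^ 3)"
proof -
  define W where "W = Q ^ 3 / (8 * real N) * H"
  have W0: "W > 0" using Q_ge N_pos H by (simp add: W_def)
  let ?V = "ap_variance N Q (\<lambda>n. of_real (1 - g n))"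
  define X1 where "X1 = (\<Sum>q\<in>D. \<Sum>n=1..N. w q (n mod q))"
  define Xg where "Xg = (\<Sum>q\<in>D. \<Sum>n=1..N. g n * w q (n mod q))"
  have X: "(\<Sum>q\<in>D. \<Sum>n=1..N. (1 - g n) * w q (n mod q)) = X1 - Xg"
    by (simp add: X1_def Xg_def left_diff_distrib sum_subtractf)
  have "Xg = (\<Sum>n=1..N. g n * (\<Sum>q\<in>D. w q (n mod q)))"
    unfolding Xg_def by (subst sum.swap) (simp add: sum_distrib_left)
  also have "\<dots> = (\<Sum>n=1..N. \<Sum>r\<in>RR. g n * (A r * ramanujan_sum r n * S r n)) + (\<Sum>n=1..N. g n * err n)"
    unfolding sum_w by (simp add: distrib_left sum.distrib sum_distrib_left)
  also have "(\<Sum>n=1..N. \<Sum>r\<in>RR. g n * (A r * ramanujan_sum r n * S r n))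
      = (\<Sum>r\<in>RR. 1 / real (totient r) * (\<Sum>n=1..N. g n * (ramanujan_sum r 1 * ramanujan_sum r n * S r n)))"
    by (subst sum.swap) (simp add: A_def sum_distrib_left mult_ac)
  finally have Xg_eq: "Xg = (\<Sum>r\<in>RR. 1 / real (totient r) *
      (\<Sum>n=1..N. g n * (ramanujan_sum r 1 * ramanujan_sum r n * S r n))) + (\<Sum>n=1..N. g n * err n)" .
  have "H * B = (\<Sum>r\<in>RR. 1 / real (totient r) * B)"
    by (simp add: H_def sum_distrib_right)
  also have "\<dots> \<le> (\<Sum>r\<in>RR. 1 / real (totient r) *
      (\<Sum>n=1..N. g n * (ramanujan_sum r 1 * ramanujan_sum r n * S r n)))"
    by (intro sum_mono mult_left_mono corr) auto
  moreover have "\<bar>\<Sum>n=1..N. g n * err n\<bar> \<le> H * B / 2"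
    by (rule order_trans[OF err_le[of Jm g, OF Jm] err_small])
  ultimately have Xg: "Xg \<ge> H * B / 2" unfolding Xg_eq by linarith
  have "X1\<^sup>2 \<le> Q\<^sup>2 * (\<Sum>q\<in>D. \<Sum>a<q. (w q a)\<^sup>2)"
    unfolding X1_def using D_bounds Q_ge by (intro odd_correlation_one w_odd) auto
  also have "\<dots> \<le> Q\<^sup>2 * W"
    unfolding W_def by (intro mult_left_mono w_norm) auto
  also have "\<dots> \<le> (H * B / 4)\<^sup>2"
  proof -
    have "2 * Q ^ 5 * H \<le> real N * H * B\<^sup>2 * H" using Q_small H by (intro mult_right_mono) auto
    then have "2 * Q ^ 5 * H / (16 * real N) \<le> real N * H * B\<^sup>2 * H / (16 * real N)"
      by (intro divide_right_mono) auto
    then have "Q ^ 5 * H / (8 * real N) \<le> H\<^sup>2 * B\<^sup>2 / 16"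
      using N_pos by (simp add: power2_eq_square mult_ac)
    moreover have "Q\<^sup>2 * W = Q ^ 5 * H / (8 * real N)"
      by (simp add: W_def power_numeral_reduce)
    ultimately show ?thesis by (simp add: power_divide power_mult_distrib)
  qed
  finally have "\<bar>X1\<bar>\<^sup>2 \<le> (H * B / 4)\<^sup>2" by (simp only: power2_abs)
  then have "\<bar>X1\<bar> \<le> H * B / 4" by (rule power2_le_imp_le) (use B H in auto)
  then have "H * B / 4 \<le> \<bar>X1 - Xg\<bar>" using Xg by linarith
  then have "(H * B / 4)\<^sup>2 \<le> \<bar>X1 - Xg\<bar>\<^sup>2" using B H by (intro power_mono) auto
  also have "\<dots> = (\<Sum>q\<in>D. \<Sum>n=1..N. (1 - g n) * w q (n mod q))\<^sup>2" by (simp only: X power2_abs)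
  also have "\<dots> \<le> ?V * (\<Sum>q\<in>D. \<Sum>a<q. (w q a)\<^sup>2)"
    using D_bounds by (intro variance_duality w_odd) auto
  also have "\<dots> \<le> ?V * W"
    unfolding W_def by (intro mult_left_mono w_norm ap_variance_nonneg)
  finally have "(H * B / 4)\<^sup>2 / W \<le> ?V" using W0 by (simp add: field_simps)
  moreover have "(H * B / 4)\<^sup>2 / W = H * B\<^sup>2 * real N / (2 * Q ^ 3)"
    using H Q_ge N_pos by (simp add: W_def power_divide power_mult_distrib power2_eq_square)
  ultimately show ?thesis by simp
qed

end

section \<open>Integers with a large prime factor\<close>

definition nonsmooth :: "nat \<Rightarrow> real \<Rightarrow> nat set" where
  "nonsmooth N y = {n\<in>{1..N}. n \<notin> smooth_numbers y}"

lemma finite_nonsmooth [simp]: "finite (nonsmooth N y)"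
  by (simp add: nonsmooth_def)

lemma nonsmooth_iff:
  "n \<in> nonsmooth N y \<longleftrightarrow> n \<in> {1..N} \<and> (\<exists>p. prime p \<and> p dvd n \<and> y < real p)"
  by (auto simp: nonsmooth_def smooth_numbers_def not_le)

lemma nonsmooth_decompose:
  assumes "n \<in> nonsmooth N y" "y > 0"
  obtains p m where "prime p" "y < real p" "n = p * m" "m \<ge> 1" "real m < real N / y"
proof -
  obtain p where p: "prime p" "p dvd n" "y < real p" and n: "1 \<le> n" "n \<le> N"
    using assms(1) by (auto simp: nonsmooth_iff)
  obtain m where m: "n = p * m" using p(2) by (auto elim: dvdE)
  have m1: "m \<ge> 1" using n m by (cases m) auto
  have "y * real m < real p * real m" using p(3) m1 by simp
  also have "\<dots> \<le> real N" using n m by (metis of_nat_le_iff of_nat_mult)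
  finally have "real m < real N / y" using assms(2) by (simp add: field_simps)
  with p m m1 show thesis by (intro that)
qed

text \<open>A prime \<open>p > y\<close> is coprime to \<open>d \<le> y\<close>, so
  \<open>n = p * d * k\<close> with \<open>k \<le> N / (y * d)\<close>. For each \<open>k\<close>
  the primes up to \<open>N / (d * k)\<close> are counted; this limit is at least \<open>y\<close>,
  so its logarithm is at least \<open>ln N / 2\<close>.\<close>

lemma card_nonsmooth_multiples_le:
  fixes N d :: nat and y :: real
  assumes y: "1 < y" "real N \<le> y\<^sup>2" and N: "N > 1" and d: "0 < d" "real d \<le> y"
  shows "real (card {n\<in>nonsmooth N y. d dvd n})
    \<le> 20 * real N / (real d * ln (real N)) * (\<Sum>m=1..nat \<lfloor>real N / (y * real d)\<rfloor>. 1 / real m)"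
proof -
  define K where "K = {1..nat \<lfloor>real N / (y * real d)\<rfloor>}"
  define P where "P m = {p. prime p \<and> real p \<le> real N / (real d * real m)}" for m
  have Nd: "real N / (y * real d) \<ge> 0" using y by simp
  have lnN: "ln (real N) > 0" using N by simp
  have "{n\<in>nonsmooth N y. d dvd n} \<subseteq> (\<Union>m\<in>K. (\<lambda>p. p * d * m) ` P m)"
  proof
    fix n assume n: "n \<in> {n\<in>nonsmooth N y. d dvd n}"
    then obtain p m where pm: "prime p" "y < real p" "n = p * m" "m \<ge> 1"
      using y by (auto elim!: nonsmooth_decompose)
    have nN: "n \<le> N" using n by (simp add: nonsmooth_def)
    have "\<not> p dvd d" using pm(2) d by (auto dest!: dvd_imp_le)
    then have "coprime d p" using pm(1) prime_imp_coprime coprime_commute by blast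
    then have "d dvd m" using n pm(3) by (simp add: coprime_dvd_mult_right_iff)
    then obtain k where k: "m = d * k" by (auto elim: dvdE)
    have k1: "k \<ge> 1" using pm(4) k by (cases k) auto
    have "real (p * d * k) \<le> real N" using nN pm(3) k by (simp only: of_nat_le_iff mult.assoc)
    then have le: "real p * (real d * real k) \<le> real N" by (simp add: mult.assoc)
    then have 1: "p \<in> P k" using pm(1) d k1 by (simp add: P_def field_simps)
    have "y * (real d * real k) \<le> real p * (real d * real k)"
      using pm(2) by (intro mult_right_mono) auto
    then have "real k \<le> real N / (y * real d)" using order_trans[OF _ le] y d by (simp add: pos_le_divide_eq mult_ac)
    then have "k \<in> K" using k1 Nd by (simp add: K_def le_nat_iff le_floor_iff)
    then show "n \<in> (\<Union>m\<in>K. (\<lambda>p. p * d * m) ` P m)"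
      using 1 pm(3) k by (intro UN_I[of k] image_eqI[of _ _ p]) (auto simp: mult_ac)
  qed
  moreover have finP: "finite (P m)" for m by (simp add: P_def)
  ultimately have "card {n\<in>nonsmooth N y. d dvd n} \<le> card (\<Union>m\<in>K. (\<lambda>p. p * d * m) ` P m)"
    by (intro card_mono) (auto simp: K_def)
  also have "\<dots> \<le> (\<Sum>m\<in>K. card ((\<lambda>p. p * d * m) ` P m))"
    by (intro card_UN_le) (simp add: K_def)
  also have "\<dots> \<le> (\<Sum>m\<in>K. card (P m))" by (intro sum_mono card_image_le finP)
  finally have "real (card {n\<in>nonsmooth N y. d dvd n}) \<le> (\<Sum>m\<in>K. real (card (P m)))"
    by (metis of_nat_le_iff of_nat_sum)
  also have "\<dots> \<le> (\<Sum>m\<in>K. 20 * real N / (real d * ln (real N)) * (1 / real m))"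
  proof (rule sum_mono)
    fix m assume m: "m \<in> K"
    then have m1: "m \<ge> 1" "real m \<le> real N / (y * real d)"
      using Nd by (auto simp: K_def le_nat_iff le_floor_iff)
    let ?x = "real N / (real d * real m)"
    have x: "y \<le> ?x" using m1 y d by (simp add: field_simps)
    have "ln (real N) \<le> ln (y\<^sup>2)" using y N by (intro ln_mono) auto
    also have "\<dots> = 2 * ln y" using y by (simp add: ln_realpow)
    also have "\<dots> \<le> 2 * ln ?x" using x y by simp
    finally have lx: "ln (real N) / 2 \<le> ln ?x" by simp
    have "real (card (P m)) \<le> 10 * ?x / ln ?x"
      unfolding P_def using x y by (intro card_primes_le) auto
    also have "\<dots> \<le> 10 * ?x / (ln (real N) / 2)"
      using lx lnN by (intro divide_left_mono) auto
    also have "\<dots> = 20 * real N / (real d * ln (real N)) * (1 / real m)" by (simp add: mult_ac)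
    finally show "real (card (P m)) \<le> 20 * real N / (real d * ln (real N)) * (1 / real m)" .
  qed
  finally show ?thesis by (simp add: K_def sum_distrib_left)
qed

lemma sum_inverse_floor_le:
  fixes x :: real
  assumes "x \<ge> 1"
  shows "(\<Sum>m=1..nat \<lfloor>x\<rfloor>. 1 / real m) \<le> ln x + 1"
proof -
  have "(\<Sum>m=1..nat \<lfloor>x\<rfloor>. 1 / real m) \<le> ln (real (nat \<lfloor>x\<rfloor>)) + 1"
    using assms by (intro sum_inverse_le_ln) auto
  also have "ln (real (nat \<lfloor>x\<rfloor>)) \<le> ln x" using assms by (intro ln_mono) auto
  finally show ?thesis by simp
qed

text \<open>Two different primes above \<open>y\<close> dividing the same number would make it
  exceed \<open>y^2 \<ge> N\<close>.\<close>

lemma nonsmooth_factorization_unique: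
  fixes p q m k :: nat
  assumes y: "0 < y" "real N \<le> y\<^sup>2" and p: "prime p" "y < real p" and q: "prime q" "y < real q"
    and eq: "p * m = q * k" and le: "p * m \<le> N" and m: "m > 0"
  shows "p = q"
proof (rule ccontr)
  assume ne: "p \<noteq> q"
  then have cop: "coprime p q" using p q by (simp add: primes_coprime)
  then have "p * q dvd p * m" by (metis divides_mult dvd_triv_left eq)
  then have "p * q \<le> p * m" using p m by (intro dvd_imp_le) (auto simp: prime_gt_0_nat)
  then have "real (p * q) \<le> real N" using le by linarith
  moreover have "y * y < real p * real q" using p q y by (intro mult_strict_mono) auto
  ultimately show False using y by (simp add: power2_eq_square)
qed

text \<open>Count the \<open>p * m\<close> with \<open>m \<le> N / (y * A)\<close> and
  \<open>p\<close> between \<open>N / (m * A)\<close> and \<open>N / m\<close>: the bound on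
  \<open>m\<close> forces \<open>p > y\<close>. The restriction to \<open>n \<ge> N / A\<close> is
  made because the lower bound for \<open>S r n\<close> is proportional to \<open>n\<close>.\<close>

lemma card_nonsmooth_upper_part_ge:
  fixes N :: nat and y A :: real
  assumes y: "1 < y" "real N \<le> y\<^sup>2" "y < real N" and N: "N > 1" and A: "A > 1" "A \<le> real N / y"
    and primes: "\<And>x. x \<ge> A \<Longrightarrow> real (card (primes_between (x / A) x)) \<ge> x / (A * ln x)"
  shows "real (card {n\<in>nonsmooth N y. real N / A \<le> real n}) \<ge> real N / (A * ln (real N)) * ln (real N / (y * A))"
proof -
  define z where "z = real N / (y * A)"
  have z1: "z \<ge> 1" using A y by (simp add: z_def field_simps)
  define K where "K = {1..nat \<lfloor>z\<rfloor>}"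
  define P where "P m = primes_between (real N / real m / A) (real N / real m)" for m
  define Z where "Z = (SIGMA m:K. P m)"
  have lnN: "ln (real N) > 0" using N by simp
  have finP: "finite (P m)" for m by (simp add: P_def)
  have Km: "m \<ge> 1" "real m \<le> z" if "m \<in> K" for m
    using that z1 by (auto simp: K_def le_nat_iff le_floor_iff)
  have Py: "y < real p" if "m \<in> K" "p \<in> P m" for m p
  proof -
    have "real m * (y * A) \<le> real N" using Km[OF that(1)] y A by (simp add: z_def field_simps)
    then have "y \<le> real N / real m / A" using Km[OF that(1)] A by (simp add: field_simps)
    then show ?thesis using that(2) by (simp add: P_def)
  qed
  have le: "p * m \<le> N" if "m \<in> K" "p \<in> P m" for m p
  proof -
    have "real p * real m \<le> real N" using that Km[OF that(1)] by (simp add: P_def field_simps)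
    then show ?thesis by (metis of_nat_le_iff of_nat_mult)
  qed
  have inj: "inj_on (\<lambda>(m, p). p * m) Z"
  proof (rule inj_onI, clarify)
    fix m p k q assume Z: "(m, p) \<in> Z" "(k, q) \<in> Z" and eq: "p * m = q * k"
    then have mp: "m \<in> K" "p \<in> P m" "k \<in> K" "q \<in> P k" by (auto simp: Z_def)
    have "p = q"
      using nonsmooth_factorization_unique[of y N p q m k] y Py[OF mp(1,2)] Py[OF mp(3,4)] le[OF mp(1,2)] eq mp Km[OF mp(1)]
      by (auto simp: P_def)
    then show "m = k \<and> p = q" using eq mp(2) by (auto simp: P_def)
  qed
  have sub: "(\<lambda>(m, p). p * m) ` Z \<subseteq> {n\<in>nonsmooth N y. real N / A \<le> real n}"
  proof clarify
    fix m p assume "(m, p) \<in> Z"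
    then have mp: "m \<in> K" "p \<in> P m" by (auto simp: Z_def)
    have pp: "prime p" using mp(2) by (simp add: P_def)
    have "real N / A \<le> real p * real m"
      using mp(2) Km[OF mp(1)] A by (simp add: P_def field_simps)
    moreover have "1 \<le> p * m" using Km[OF mp(1)] prime_gt_0_nat[OF pp] by (simp add: Suc_le_eq)
    ultimately show "p * m \<in> nonsmooth N y \<and> real N / A \<le> real (p * m)"
      using le[OF mp] Py[OF mp] pp by (auto simp: nonsmooth_iff)
  qed
  have "real N / (A * ln (real N)) * ln z \<le> real N / (A * ln (real N)) * (\<Sum>m\<in>K. 1 / real m)"
  proof (intro mult_left_mono)
    have "ln z \<le> ln (real (nat \<lfloor>z\<rfloor>) + 1)" using z1 by (intro ln_mono) linarith+
    then show "ln z \<le> (\<Sum>m\<in>K. 1 / real m)"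
      using ln_le_sum_inverse[of "nat \<lfloor>z\<rfloor>"] unfolding K_def by linarith
  qed (use A lnN in auto)
  also have "\<dots> = (\<Sum>m\<in>K. real N / real m / (A * ln (real N)))"
    unfolding sum_distrib_left by (intro sum.cong refl) simp
  also have "\<dots> \<le> (\<Sum>m\<in>K. real (card (P m)))"
  proof (rule sum_mono)
    fix m assume m: "m \<in> K"
    let ?x = "real N / real m"
    have "real m * A \<le> z * A" using Km[OF m] A by (intro mult_right_mono) auto
    also have "\<dots> = real N / y" using A by (simp add: z_def)
    also have "\<dots> \<le> real N" using y by (simp add: field_simps)
    finally have x: "A \<le> ?x" using Km[OF m] by (simp add: field_simps)
    have "?x \<le> real N" using Km[OF m] by (simp add: field_simps mult_le_cancel_left1)
    then have "ln ?x \<le> ln (real N)" using x A by (intro ln_mono) auto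
    moreover have "ln ?x > 0" using x A by simp
    ultimately have "?x / (A * ln (real N)) \<le> ?x / (A * ln ?x)"
      using A lnN by (intro divide_left_mono mult_left_mono) auto
    also have "\<dots> \<le> real (card (P m))" unfolding P_def by (rule primes[OF x])
    finally show "?x / (A * ln (real N)) \<le> real (card (P m))" .
  qed
  also have "\<dots> = real (card Z)"
    unfolding Z_def using finP by (subst card_SigmaI) (auto simp: K_def)
  also have "\<dots> = real (card ((\<lambda>(m, p). p * m) ` Z))" by (simp add: card_image[OF inj])
  also have "\<dots> \<le> real (card {n\<in>nonsmooth N y. real N / A \<le> real n})"
    using sub by (intro of_nat_mono card_mono) auto
  finally show ?thesis by (simp add: z_def)
qed

section \<open>Test moduli and their correlation with the nonsmooth numbers\<close>

definition test_moduli :: "real \<Rightarrow> real \<Rightarrow> real \<Rightarrow> real \<Rightarrow> nat set" where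
  "test_moduli M S X Y = (\<lambda>(s, p). s * p) ` (rough_squarefree M S \<times> primes_between X Y)"

lemma finite_test_moduli [simp]: "finite (test_moduli M S X Y)"
  by (simp add: test_moduli_def)

lemma test_moduliE:
  assumes "r \<in> test_moduli M S X Y" "S \<le> X"
  obtains s p where "r = s * p" "s \<in> rough_squarefree M S" "prime p" "X < real p" "real p \<le> Y" "coprime s p" "1 \<le> s"
proof -
  obtain s p where sp: "r = s * p" "s \<in> rough_squarefree M S" "prime p" "X < real p" "real p \<le> Y"
    using assms(1) by (auto simp: test_moduli_def)
  have s: "1 \<le> s" "real s \<le> S" using sp(2) by (auto simp: rough_squarefree_def)
  have "\<not> p dvd s" using s sp(4) assms(2) by (auto dest!: dvd_imp_le)
  then have "coprime s p" using sp(3) prime_imp_coprime coprime_commute by blast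
  with sp s show thesis by (intro that)
qed

lemma test_moduli_bounds:
  assumes "r \<in> test_moduli M S X Y" "S \<le> X" "0 \<le> Y" "0 \<le> S" "0 \<le> X"
  shows "squarefree r" "X < real r" "real r \<le> S * Y" "2 \<le> r"
proof -
  obtain s p where sp: "r = s * p" "s \<in> rough_squarefree M S" "prime p" "X < real p" "real p \<le> Y" "coprime s p" "1 \<le> s"
    using test_moduliE[OF assms(1,2)] by blast
  have s: "squarefree s" "real s \<le> S" using sp(2) by (auto simp: rough_squarefree_def)
  show "squarefree r" unfolding sp(1) using s sp by (intro squarefree_mult_coprime) (auto intro: squarefree_prime)
  have "real p * 1 \<le> real p * real s" using sp(7) by (intro mult_left_mono) auto
  then show "X < real r" using sp by (simp add: mult.commute)
  show "real r \<le> S * Y" unfolding sp(1) of_nat_mult using s sp assms by (intro mult_mono) auto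
  have "p \<le> s * p" using sp(7) by simp
  then show "2 \<le> r" unfolding sp(1) using prime_ge_2_nat[OF sp(3)] by (rule order_trans[rotated])
qed

text \<open>\<open>S \<le> X\<close> keeps the large prime out of the rough part, so
  \<open>s\<close> and \<open>p\<close> can be recovered from their product and the sum
  factorizes.\<close>

lemma sum_inverse_totient_test_moduli_ge:
  assumes "S \<le> X"
  shows "(\<Sum>r\<in>test_moduli M S X Y. 1 / real (totient r))
    \<ge> (\<Sum>s\<in>rough_squarefree M S. 1 / real s) * (\<Sum>p\<in>primes_between X Y. 1 / real p)"
proof -
  let ?P = "primes_between X Y"
  have bd: "1 \<le> s" "real s \<le> S" if "s \<in> rough_squarefree M S" for s
    using that by (auto simp: rough_squarefree_def)
  have inj: "inj_on (\<lambda>(s, p). s * p) (rough_squarefree M S \<times> ?P)"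
  proof (rule inj_onI, clarify)
    fix s p s' p' assume h: "s \<in> rough_squarefree M S" "s' \<in> rough_squarefree M S" "prime p" "prime p'"
      "X < real p" "X < real p'" "s * p = s' * p'"
    have "\<not> p dvd s'" using bd[OF h(2)] h(5) assms by (auto dest!: dvd_imp_le)
    moreover have "p dvd s' * p'" using h(7) by (metis dvd_triv_right)
    ultimately have "p dvd p'" using h(3) prime_dvd_mult_iff by blast
    then have "p = p'" using h(3,4) primes_dvd_imp_eq by blast
    then show "s = s' \<and> p = p'" using h(7) prime_gt_0_nat[OF h(3)] by simp
  qed
  have "(\<Sum>s\<in>rough_squarefree M S. 1 / real s) * (\<Sum>p\<in>?P. 1 / real p)
      = (\<Sum>z\<in>rough_squarefree M S \<times> ?P. 1 / real (fst z * snd z))"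
    by (simp add: sum_product sum.cartesian_product case_prod_beta)
  also have "\<dots> = (\<Sum>r\<in>test_moduli M S X Y. 1 / real r)"
    unfolding test_moduli_def by (subst sum.reindex[OF inj]) (simp add: case_prod_beta)
  also have "\<dots> \<le> (\<Sum>r\<in>test_moduli M S X Y. 1 / real (totient r))"
  proof (rule sum_mono)
    fix r assume "r \<in> test_moduli M S X Y"
    then obtain s p where sp: "r = s * p" "prime p" "1 \<le> s" using assms by (elim test_moduliE)
    then have "r > 0" using prime_gt_0_nat by auto
    then show "1 / real r \<le> 1 / real (totient r)"
      using totient_le[of r] by (intro divide_left_mono) auto
  qed
  finally show ?thesis .
qed

text \<open>Every \<open>n\<close> with a prime factor exceeding \<open>y\<close> is coprime to the rough part of a test modulus,
  so its Ramanujan sum has the sign of \<open>ramanujan_sum r 1\<close> unless the large prime \<open>p\<close> divides \<open>n\<close>.\<close>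

lemma ramanujan_sum_nonsmooth:
  assumes y: "1 < y" "real N \<le> y\<^sup>2"
    and r: "r = s * p" "s \<in> rough_squarefree (real N / y) S" "prime p" "coprime s p" "S \<le> y"
    and n: "n \<in> nonsmooth N y"
  shows "ramanujan_sum r 1 * ramanujan_sum r n = (if p dvd n then - (real p - 1) else 1)"
proof -
  have s: "1 \<le> s" "real s \<le> S" "squarefree s" "\<And>q. prime q \<Longrightarrow> q dvd s \<Longrightarrow> real N / y < real q"
    using r(2) by (auto simp: rough_squarefree_def)
  obtain q m where qm: "prime q" "y < real q" "n = q * m" "m \<ge> 1" "real m < real N / y"
    using nonsmooth_decompose[OF n] y by auto
  have "coprime n s"
  proof (rule ccontr)
    assume "\<not> coprime n s"
    then have "gcd n s \<noteq> 1" by (simp only: coprime_iff_gcd_eq_1 not_False_eq_True)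
    then obtain l where "prime l" "l dvd gcd n s" using prime_factor_nat by blast
    then have l: "prime l" "l dvd n" "l dvd s" by auto
    have "l \<le> s" using l(3) s(1) by (intro dvd_imp_le) auto
    then have "real l \<le> y" using s(2) r(5) by linarith
    then have "l \<noteq> q" using qm(2) by auto
    then have "l dvd m" using l qm(1,3) by (auto simp: prime_dvd_mult_iff dest: primes_dvd_imp_eq)
    then have "l \<le> m" using qm(4) by (intro dvd_imp_le) auto
    then have "real l < real N / y" using qm(5) by linarith
    then show False using s(4)[OF l(1,3)] by simp
  qed
  then have cs: "\<bar>ramanujan_sum s 1\<bar> = 1" "ramanujan_sum s n = ramanujan_sum s 1"
    using ramanujan_sum_squarefree_coprime[OF s(3)] by (metis, metis)
  have sq: "ramanujan_sum s 1 * ramanujan_sum s 1 = 1"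
    using cs(1) by (metis abs_mult_self_eq mult_1)
  have p1: "\<not> p dvd 1" using r(3) by auto
  have mult: "ramanujan_sum r k = ramanujan_sum s k * ramanujan_sum p k" for k
    unfolding r(1) using s(1) prime_gt_0_nat[OF r(3)] r(4) by (intro ramanujan_sum_mult) auto
  have "ramanujan_sum r 1 * ramanujan_sum r n = (ramanujan_sum s 1 * ramanujan_sum s 1) * (ramanujan_sum p 1 * ramanujan_sum p n)"
    unfolding mult cs(2) by (simp only: mult_ac)
  then show ?thesis
    using sq p1 ramanujan_sum_prime[OF r(3)] by simp
qed

definition nonsmooth_indicator :: "real \<Rightarrow> nat \<Rightarrow> real" where
  "nonsmooth_indicator y n = (if n \<in> smooth_numbers y then 0 else 1)"

lemma sum_nonsmooth_indicator: "(\<Sum>n=1..N. nonsmooth_indicator y n * f n) = (\<Sum>n\<in>nonsmooth N y. f n)"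
  unfolding nonsmooth_def nonsmooth_indicator_def by (intro sum.mono_neutral_cong_right) auto

lemma indicator_smooth: "(indicator (smooth_numbers y) :: nat \<Rightarrow> complex) = (\<lambda>n. of_real (1 - nonsmooth_indicator y n))"
  by (auto simp: nonsmooth_indicator_def indicator_def)

context farey_test
begin

text \<open>A multiple of \<open>p\<close> contributes \<open>- (p - 1) * S r n\<close>, that is,
  \<open>S r n\<close> minus \<open>p * S r n\<close>. So all \<open>S r n\<close> count positively,
  bounded below on the upper part of the nonsmooth numbers, and the corrections are bounded by the
  largest possible \<open>S r n\<close>.\<close>

lemma correlation_ge:
  assumes y: "1 < y" "real N \<le> y\<^sup>2"
    and r: "r \<in> RR" "r = s * p" "s \<in> rough_squarefree (real N / y) Z" "prime p" "coprime s p" "Z \<le> y"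
    and a: "a > 1"
  shows "(\<Sum>n=1..N. nonsmooth_indicator y n * (ramanujan_sum r 1 * ramanujan_sum r n * S r n))
    \<ge> Q\<^sup>2 / (512 * a * real N) * real (card {n\<in>nonsmooth N y. real N / a \<le> real n})
      - Q\<^sup>2 / (8 * real N) * (real p * real (card {n\<in>nonsmooth N y. p dvd n}))"
proof -
  have nN: "n \<le> N" if "n \<in> nonsmooth N y" for n using that by (simp add: nonsmooth_def)
  have "Q\<^sup>2 / (512 * a * real N) * real (card {n\<in>nonsmooth N y. real N / a \<le> real n})
      = (\<Sum>n | n \<in> nonsmooth N y \<and> real N / a \<le> real n. Q\<^sup>2 / (512 * a * real N))" by simp
  also have "\<dots> \<le> (\<Sum>n | n \<in> nonsmooth N y \<and> real N / a \<le> real n. S r n)"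
  proof (rule sum_mono)
    fix n assume n: "n \<in> {n. n \<in> nonsmooth N y \<and> real N / a \<le> real n}"
    have "Q\<^sup>2 / (512 * a * real N) = (real N / a) * Q\<^sup>2 / (512 * (real N)\<^sup>2)"
      using N_pos a by (simp add: power2_eq_square)
    also have "\<dots> \<le> real n * Q\<^sup>2 / (512 * (real N)\<^sup>2)"
      using n by (intro divide_right_mono mult_right_mono) auto
    also have "\<dots> \<le> S r n" using S_bounds(1)[OF r(1)] nN n by simp
    finally show "Q\<^sup>2 / (512 * a * real N) \<le> S r n" .
  qed
  also have "\<dots> \<le> (\<Sum>n\<in>nonsmooth N y. S r n)"
    using S_bounds(2)[OF r(1)] nN by (intro sum_mono2) auto
  finally have 1: "Q\<^sup>2 / (512 * a * real N) * real (card {n\<in>nonsmooth N y. real N / a \<le> real n})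
      \<le> (\<Sum>n\<in>nonsmooth N y. S r n)" .
  have "(\<Sum>n | n \<in> nonsmooth N y \<and> p dvd n. S r n) \<le> (\<Sum>n | n \<in> nonsmooth N y \<and> p dvd n. Q\<^sup>2 / (8 * real N))"
    using S_bounds(3)[OF r(1)] nN by (intro sum_mono) auto
  also have "\<dots> = Q\<^sup>2 / (8 * real N) * real (card {n\<in>nonsmooth N y. p dvd n})" by simp
  finally have 2: "real p * (\<Sum>n | n \<in> nonsmooth N y \<and> p dvd n. S r n)
      \<le> real p * (Q\<^sup>2 / (8 * real N) * real (card {n\<in>nonsmooth N y. p dvd n}))"
    by (rule mult_left_mono) simp
  have "(\<Sum>n\<in>nonsmooth N y. S r n) - real p * (\<Sum>n | n \<in> nonsmooth N y \<and> p dvd n. S r n)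
      = (\<Sum>n\<in>nonsmooth N y. S r n - (if p dvd n then real p * S r n else 0))"
    by (simp add: sum_subtractf sum_distrib_left sum.inter_filter[symmetric])
  also have "\<dots> \<le> (\<Sum>n\<in>nonsmooth N y. ramanujan_sum r 1 * ramanujan_sum r n * S r n)"
  proof (rule sum_mono)
    fix n assume n: "n \<in> nonsmooth N y"
    have "0 \<le> S r n" using S_bounds(2)[OF r(1)] nN[OF n] by simp
    then show "S r n - (if p dvd n then real p * S r n else 0) \<le> ramanujan_sum r 1 * ramanujan_sum r n * S r n"
      unfolding ramanujan_sum_nonsmooth[OF y r(2-6) n] by (simp add: algebra_simps)
  qed
  also have "\<dots> = (\<Sum>n=1..N. nonsmooth_indicator y n * (ramanujan_sum r 1 * ramanujan_sum r n * S r n))"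
    by (rule sum_nonsmooth_indicator[symmetric])
  finally show ?thesis using 1 2 by (simp add: mult_ac)
qed

end

section \<open>Choice of the parameters for small \<open>Q\<close>\<close>

lemma card_nonsmooth_le:
  assumes y: "1 < y" "real N \<le> y\<^sup>2" and N: "N > 1" and M: "1 \<le> ln (real N / y)"
  shows "real (card (nonsmooth N y)) \<le> 40 * real N * (ln (real N / y) / ln (real N))"
proof -
  have lnN: "ln (real N) > 0" using N by simp
  have M1: "real N / y \<ge> 1" using M y N by (metis ln_ge_zero_iff divide_pos_pos of_nat_0_less_iff less_trans zero_less_one order_trans zero_le_one)
  have "real (card {n\<in>nonsmooth N y. 1 dvd n})
      \<le> 20 * real N / (real 1 * ln (real N)) * (\<Sum>m=1..nat \<lfloor>real N / (y * real 1)\<rfloor>. 1 / real m)"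
    using y by (intro card_nonsmooth_multiples_le N) auto
  \<comment> \<open>By \<open>1 \<le> ln (N / y)\<close> the harmonic sum
    \<open>ln (N / y) + 1\<close> is at most \<open>2 * ln (N / y)\<close>.\<close>
  also have "\<dots> \<le> 20 * real N / (real 1 * ln (real N)) * (2 * ln (real N / y))"
    using sum_inverse_floor_le[OF M1] M lnN by (intro mult_left_mono) auto
  finally show ?thesis by simp
qed

text \<open>The upper bound on \<open>Q\<close> makes the correlation with the constant
  \<open>1\<close> negligible. The lower bound is used twice: it makes room for the moduli
  \<open>r\<close>, and it lets the error term lose a factor \<open>N powr \<delta>\<close> against
  the main term.\<close>

lemma variance_lower_small_moduli:
  fixes a c1 c2 D0 h \<eta> \<delta> t y Q :: real and N :: nat
  assumes a: "a > 1" and primes: "\<And>x. x \<ge> a \<Longrightarrow> real (card (primes_between (x / a) x)) \<ge> x / (a * ln x)"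
    and c1: "c1 > 0" "\<And>M Z. M \<ge> 2 \<Longrightarrow> Z \<ge> 1 \<Longrightarrow> (\<Sum>s\<in>rough_squarefree M Z. 1 / real s) \<ge> c1 * ln Z / ln M"
    and c2: "\<And>X Y. 1 \<le> X \<Longrightarrow> X \<le> Y \<Longrightarrow> 1 < Y \<Longrightarrow>
      (\<Sum>p\<in>primes_between X Y. 1 / real p) \<ge> (ln Y - ln X - c2) / ln Y"
    and D0: "D0 = 2048 * a\<^sup>2" and h: "h = c1 * \<delta>\<^sup>2 / 64" and \<eta>: "\<eta> = h / (2 * D0\<^sup>2)"
    and \<delta>: "0 < \<delta>" "\<delta> \<le> 1 / 4" "10 * \<delta> \<le> 1 / D0"
    and N: "20 * D0 \<le> ln (real N)" "16 * c2 \<le> \<delta> * ln (real N)" "8 \<le> real N powr (\<delta> / 2)"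
      "exp (pi / 2) * sqrt 200 * D0 \<le> 4 * sqrt h * real N powr \<delta>"
    and y: "1 < y" "real N \<le> y\<^sup>2" "a\<^sup>2 \<le> real N / y" "1 \<le> ln (real N / y)" "2 \<le> real N / y"
    and t: "t = ln (real N / y) / ln (real N)"
    and Q: "real N powr (1 / 2 + \<delta>) \<le> Q" "Q \<le> real N" "Q \<le> \<eta> * real N * t"
  shows "ap_variance N Q (indicator (smooth_numbers y)) \<ge> \<eta> * t * Q * real N"
proof -
  define L where "L = ln (real N)"
  define M where "M = real N / y"
  have D0_pos: "D0 > 0" using a by (simp add: D0)
  have "L > 0" using N(1) D0_pos by (simp add: L_def)
  then have N1: "N > 1" unfolding L_def by (metis ln_gt_zero_imp_gt_one ln_0 gr0I less_irrefl of_nat_0 of_nat_0_less_iff of_nat_1 of_nat_less_iff)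
  then have Npos: "real N > 1" by simp
  have lnpow: "ln (real N powr a) = a * L" for a using Npos by (simp add: L_def ln_powr)
  have M: "M \<ge> 2" "ln M \<ge> 1" "a\<^sup>2 \<le> M" using y by (simp_all add: M_def)
  have yM: "M \<le> y" using y by (simp add: M_def field_simps power2_eq_square)
  have yN: "y < real N" using M y by (simp add: M_def field_simps)
  have tL: "ln M = t * L" using \<open>L > 0\<close> by (simp add: t M_def L_def)
  have t0: "t > 0" using M \<open>L > 0\<close> by (simp add: t M_def L_def)
  have sqrtN: "real N powr (1/2) = sqrt (real N)" using Npos by (simp add: powr_half_sqrt)
  have sqrty: "sqrt (real N) \<le> y" using y by (intro real_le_lsqrt) auto
  have h0: "h > 0" using c1 \<delta> by (simp add: h)
  \<comment> \<open>The exponents give \<open>Z * Y \<le> sqrt N\<close>, hence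
    \<open>r \<le> sqrt N\<close>, and \<open>X * Q \<ge> N powr (1 + \<delta> / 2)\<close>, which
    is at least \<open>8 * N\<close>. The gap \<open>\<delta> / 8\<close> between the exponents of
    \<open>X\<close> and \<open>Y\<close> keeps the sum of \<open>1 / p\<close> of order
    \<open>\<delta>\<close>.\<close>
  define Z X Y where "Z = real N powr (\<delta> / 8)" and "X = real N powr (1 / 2 - \<delta> / 2)"
    and "Y = real N powr (1 / 2 - 3 * \<delta> / 8)"
  have S1: "Z \<ge> 1" and X1: "X \<ge> 1" and Y1: "Y > 1"
    using Npos \<delta> by (auto simp: Z_def X_def Y_def intro!: ge_one_powr_ge_zero gr_one_powr)
  have XY: "X \<le> Y" unfolding X_def Y_def using Npos \<delta> by (intro powr_mono) auto
  have SX: "Z \<le> X" unfolding Z_def X_def using Npos \<delta> by (intro powr_mono) auto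
  have SY: "Z * Y \<le> sqrt (real N)"
  proof -
    have "Z * Y = real N powr (1 / 2 - \<delta> / 4)" by (simp add: Z_def Y_def powr_add[symmetric])
    also have "\<dots> \<le> real N powr (1 / 2)" using Npos \<delta> by (intro powr_mono) auto
    finally show ?thesis by (simp add: sqrtN)
  qed
  define RR where "RR = test_moduli M Z X Y"
  have RRb: "squarefree r" "X < real r" "real r \<le> sqrt (real N)" "2 \<le> r" if "r \<in> RR" for r
    using test_moduli_bounds[OF that[unfolded RR_def] SX] SY S1 X1 Y1 by auto
  have N\<delta>: "real N powr \<delta> \<ge> 8"
  proof -
    have "real N powr (\<delta> / 2) \<le> real N powr \<delta>" using \<delta> Npos by (intro powr_mono) auto
    then show ?thesis using N(3) by linarith
  qed
  have Qs: "sqrt (real N) * real N powr \<delta> \<le> Q"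
    using Q(1) by (simp add: powr_add sqrtN)
  have Q8: "8 * sqrt (real N) \<le> Q"
  proof -
    have "sqrt (real N) * 8 \<le> sqrt (real N) * real N powr \<delta>" using N\<delta> by (intro mult_left_mono) auto
    then show ?thesis using Qs by linarith
  qed
  have sN1: "sqrt (real N) > 1" using Npos by simp
  interpret farey_test N Q RR
  proof
    show "finite RR" by (simp add: RR_def)
    show "N > 0" using N1 by simp
    show "4 \<le> Q" using Q8 sN1 by linarith
    fix r assume r: "r \<in> RR"
    show "2 \<le> r" "squarefree r" using RRb[OF r] by auto
    have "real r * real r \<le> sqrt (real N) * sqrt (real N)" using RRb[OF r] by (intro mult_mono) auto
    then have "real (r * r) \<le> real N" by simp
    then show "r * r \<le> N" by (simp only: of_nat_le_iff)
    show "4 * real r \<le> Q" using RRb(3)[OF r] Q8 sN1 by linarith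
    have "8 * real N \<le> real N powr (\<delta> / 2) * real N" using N(3) by (intro mult_right_mono) auto
    also have "\<dots> = X * real N powr (1 / 2 + \<delta>)"
      using Npos by (simp add: X_def powr_add[symmetric] powr_mult_base mult.commute)
    also have "\<dots> \<le> real r * Q" using RRb(2)[OF r] Q X1 by (intro mult_mono) auto
    finally show "8 * real N \<le> real r * Q" .
  qed
  \<comment> \<open>The rough parts contribute at least \<open>c1 * \<delta> / (8 * t)\<close>, the
    primes at least \<open>\<delta> / 8\<close>; the product is \<open>h / t\<close>.\<close>
  have Ht: "H * t \<ge> h"
  proof -
    have "ln Z = \<delta> / 8 * L" "ln X = (1 / 2 - \<delta> / 2) * L" "ln Y = (1 / 2 - 3 * \<delta> / 8) * L"
      by (simp_all only: Z_def X_def Y_def lnpow)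
    note lns = this
    have lnY: "0 < ln Y" using Y1 by simp
    have "\<delta> / 8 \<le> (\<delta> * L / 16) / (L / 2)" using \<open>L > 0\<close> by simp
    also have "\<dots> \<le> (\<delta> * L / 16) / ln Y"
      using \<open>L > 0\<close> \<delta> lnY by (intro divide_left_mono) (auto simp: lns mult_right_mono)
    also have "\<dots> \<le> (ln Y - ln X - c2) / ln Y"
      using N(2) lnY by (intro divide_right_mono) (auto simp: lns L_def algebra_simps)
    also have "\<dots> \<le> (\<Sum>p\<in>primes_between X Y. 1 / real p)"
      by (rule c2[OF X1 XY Y1])
    finally have p: "\<delta> / 8 \<le> (\<Sum>p\<in>primes_between X Y. 1 / real p)" .
    have s: "c1 * ln Z / ln M \<le> (\<Sum>s\<in>rough_squarefree M Z. 1 / real s)" by (rule c1(2)[OF M(1) S1])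
    have "(c1 * ln Z / ln M) * (\<delta> / 8) \<le> (\<Sum>s\<in>rough_squarefree M Z. 1 / real s) * (\<Sum>p\<in>primes_between X Y. 1 / real p)"
      using p s \<delta> by (intro mult_mono sum_nonneg) auto
    also have "\<dots> \<le> H"
      using sum_inverse_totient_test_moduli_ge[OF SX, of M Y, folded RR_def] unfolding H_def .
    finally have "(c1 * ln Z / ln M) * (\<delta> / 8) * t \<le> H * t" using t0 by (intro mult_right_mono) auto
    moreover have "(c1 * ln Z / ln M) * (\<delta> / 8) * t = h"
      using t0 \<open>L > 0\<close> unfolding lns tL h by (simp add: power2_eq_square)
    ultimately show ?thesis by simp
  qed
  have Hpos: "H > 0" using Ht h0 t0 by (smt (verit) mult_nonpos_nonneg)
  \<comment> \<open>\<open>D0 = 2048 * a^2\<close> balances the correlation: the gain is at least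
    \<open>Q^2 * t / (1024 * a^2) = 2 * B\<close>, the loss from the multiples of \<open>p\<close>
    at most \<open>B\<close>.\<close>
  define B where "B = Q\<^sup>2 * t / D0"
  have Qpos: "Q > 0" using Q_ge by simp
  have Bpos: "B > 0" using Qpos t0 D0_pos by (simp add: B_def)
  let ?g = "nonsmooth_indicator y"
  have corr: "(\<Sum>n=1..N. ?g n * (ramanujan_sum r 1 * ramanujan_sum r n * S r n)) \<ge> B" if r: "r \<in> RR" for r
  proof -
    obtain s p where sp: "r = s * p" "s \<in> rough_squarefree M Z" "prime p" "X < real p" "real p \<le> Y" "coprime s p" "1 \<le> s"
      using test_moduliE[OF r[unfolded RR_def] SX] by blast
    have sqY: "Y \<le> sqrt (real N)" using SY S1 Y1 by (smt (verit) mult_le_cancel_right1)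
    have SsqN: "Z \<le> y" using SX XY sqY sqrty by linarith
    have p0: "p > 0" using sp(3) prime_gt_0_nat by blast
    let ?U = "real (card {n\<in>nonsmooth N y. real N / a \<le> real n})"
    let ?W = "real p * real (card {n\<in>nonsmooth N y. p dvd n})"
    have "a * 1 \<le> a * a" using a by (intro mult_left_mono) auto
    then have AM: "a \<le> M" using M(3) by (simp add: power2_eq_square)
    have "real N / (a * L) * ln (real N / (y * a)) \<le> ?U"
      unfolding L_def using y yN N1 a AM by (intro card_nonsmooth_upper_part_ge primes) (auto simp: M_def)
    moreover have "ln M / 2 \<le> ln (real N / (y * a))"
    proof -
      have "ln (a\<^sup>2) \<le> ln M" using M a by (intro ln_mono) auto
      then have "2 * ln a \<le> ln M" using a by (simp add: ln_realpow)
      moreover have "real N / (y * a) = M / a" by (simp add: M_def)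
      moreover have "ln (M / a) = ln M - ln a" using M a by (intro ln_divide_pos) auto
      ultimately show ?thesis by simp
    qed
    then have "real N / (a * L) * (ln M / 2) \<le> real N / (a * L) * ln (real N / (y * a))"
      using a \<open>L > 0\<close> by (intro mult_left_mono) auto
    ultimately have U: "real N * t / (2 * a) \<le> ?U" using \<open>L > 0\<close> by (simp add: tL mult_ac)
    have W: "?W \<le> 8 * real N * t / D0"
    proof -
      have py: "real p \<le> y" using sp(5) sqY sqrty by linarith
      have "real (card {n\<in>nonsmooth N y. p dvd n})
          \<le> 20 * real N / (real p * L) * (\<Sum>m=1..nat \<lfloor>real N / (y * real p)\<rfloor>. 1 / real m)"
        unfolding L_def by (intro card_nonsmooth_multiples_le y N1 p0 py)
      then have "?W \<le> real p * (20 * real N / (real p * L) * (\<Sum>m=1..nat \<lfloor>real N / (y * real p)\<rfloor>. 1 / real m))"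
        by (intro mult_left_mono) auto
      also have "\<dots> = 20 * real N / L * (\<Sum>m=1..nat \<lfloor>M / real p\<rfloor>. 1 / real m)"
        using p0 by (simp add: M_def)
      finally have W1: "?W \<le> 20 * real N / L * (\<Sum>m=1..nat \<lfloor>M / real p\<rfloor>. 1 / real m)" .
      show ?thesis
      proof (cases "real p \<le> M")
        case False
        \<comment> \<open>A prime \<open>p\<close> with \<open>M < p \<le> y\<close> divides no
          nonsmooth number.\<close>
        then have "nat \<lfloor>M / real p\<rfloor> = 0" using p0 M by simp
        then have "?W \<le> 0" using W1 by simp
        then show ?thesis using t0 D0_pos by (smt (verit) divide_nonneg_nonneg mult_nonneg_nonneg of_nat_0_le_iff)
      next
        case True
        \<comment> \<open>Now \<open>X < p \<le> M \<le> sqrt N\<close>, so \<open>M / p\<close> is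
          at most \<open>N powr (\<delta> / 2)\<close>. This forces \<open>t \<ge> 1 / 4\<close>,
          and the remaining loss \<open>10 * \<delta> + 20 / L\<close> is at most
          \<open>2 / D0\<close>.\<close>
        have lnp: "(1 / 2 - \<delta> / 2) * L \<le> ln (real p)"
          unfolding lnpow[symmetric] X_def[symmetric] using sp(4) X1 by (intro ln_mono) auto
        have "M * M \<le> M * y" using yM M by (intro mult_left_mono) auto
        then have "M\<^sup>2 \<le> real N" using y by (simp add: M_def power2_eq_square)
        then have "ln (M\<^sup>2) \<le> L" unfolding L_def using M Npos by (intro ln_mono) auto
        then have lnM: "ln M \<le> L / 2" using M by (simp add: ln_realpow)
        have "ln (real p) \<le> ln M" using True p0 by (intro ln_mono) auto
        then have "(1 / 2 - \<delta> / 2) * L \<le> t * L" using lnp tL by linarith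
        then have "1 / 2 - \<delta> / 2 \<le> t" using \<open>L > 0\<close> by simp
        then have t4: "1 / 4 \<le> t" using \<delta> by linarith
        have "(\<Sum>m=1..nat \<lfloor>M / real p\<rfloor>. 1 / real m) \<le> ln (M / real p) + 1"
          using True p0 by (intro sum_inverse_floor_le) simp
        also have "ln (M / real p) = ln M - ln (real p)" using M p0 by (intro ln_divide_pos) auto
        also have "ln M - ln (real p) + 1 \<le> \<delta> / 2 * L + 1" using lnp lnM by (simp add: algebra_simps)
        finally have "?W \<le> 20 * real N / L * (\<delta> / 2 * L + 1)"
          using W1 \<open>L > 0\<close> by (smt (verit) mult_left_mono divide_nonneg_nonneg mult_nonneg_nonneg of_nat_0_le_iff)
        also have "\<dots> = real N * (10 * \<delta> + 20 / L)" using \<open>L > 0\<close> by (simp add: field_simps)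
        also have "\<dots> \<le> real N * (1 / D0 + 1 / D0)"
        proof (intro mult_left_mono add_mono \<delta>)
          show "20 / L \<le> 1 / D0" using N(1) \<open>L > 0\<close> D0_pos by (simp add: L_def field_simps)
        qed simp
        also have "\<dots> = 8 * real N * (1 / 4) / D0" by simp
        also have "\<dots> \<le> 8 * real N * t / D0" using t4 D0_pos by (intro divide_right_mono mult_left_mono) auto
        finally show ?thesis .
      qed
    qed
    have "B = Q\<^sup>2 / (512 * a * real N) * (real N * t / (2 * a)) - Q\<^sup>2 / (8 * real N) * (8 * real N * t / D0)"
      using a Npos unfolding B_def D0 by (simp add: field_simps power2_eq_square)
    also have "\<dots> \<le> Q\<^sup>2 / (512 * a * real N) * ?U - Q\<^sup>2 / (8 * real N) * ?W"
      using U W a by (intro diff_mono mult_left_mono) auto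
    also have "\<dots> \<le> (\<Sum>n=1..N. ?g n * (ramanujan_sum r 1 * ramanujan_sum r n * S r n))"
      using correlation_ge[OF y(1,2) r sp(1) sp(2)[unfolded M_def] sp(3,6) SsqN a] by simp
    finally show ?thesis .
  qed
  define Jm where "Jm = Q / (8 * sqrt (real N))"
  have Jm: "real (J r) \<le> Jm" if "r \<in> RR" for r
  proof -
    have "real (J r) \<le> real r * Q / (8 * real N)" by (rule J_bounds(1)[OF that])
    also have "\<dots> \<le> sqrt (real N) * Q / (8 * real N)"
      using RRb(3)[OF that] Qpos by (intro divide_right_mono mult_right_mono) auto
    also have "\<dots> = Jm" using Npos unfolding Jm_def
      by (simp add: field_simps)
    finally show ?thesis .
  qed
  have G: "(\<Sum>n=1..N. (?g n)\<^sup>2) \<le> 40 * real N * t"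
  proof -
    have "(\<Sum>n=1..N. (?g n)\<^sup>2) = (\<Sum>n=1..N. ?g n * 1)"
      by (intro sum.cong) (auto simp: nonsmooth_indicator_def)
    also have "\<dots> = real (card (nonsmooth N y))" by (subst sum_nonsmooth_indicator) simp
    also have "\<dots> \<le> 40 * real N * t" unfolding t using y N1 by (intro card_nonsmooth_le) auto
    finally show ?thesis .
  qed
  \<comment> \<open>With \<open>H * t = v^2\<close> the error is a constant times
    \<open>v * Q * sqrt N\<close> and the main term a constant times \<open>v^2 * Q^2\<close>. As
    \<open>v \<ge> sqrt h\<close>, the factor \<open>N powr \<delta>\<close> in
    \<open>Q \<ge> sqrt N * N powr \<delta>\<close> decides.\<close>
  define v where "v = sqrt (H * t)"
  have v2: "v * v = H * t" using Hpos t0 by (simp add: v_def)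
  have vh: "sqrt h \<le> v" using Ht by (simp add: v_def)
  have v0: "v > 0" using Hpos t0 by (simp add: v_def)
  have err_small: "exp (pi / 2) * (Jm * sqrt (5 * real N * H * (\<Sum>n=1..N. (?g n)\<^sup>2))) \<le> H * B / 2"
  proof -
    have "sqrt (5 * real N * H * (\<Sum>n=1..N. (?g n)\<^sup>2)) \<le> sqrt (5 * real N * H * (40 * real N * t))"
      using G Hpos by (intro real_sqrt_le_mono mult_left_mono) auto
    also have "5 * real N * H * (40 * real N * t) = 200 * ((real N)\<^sup>2 * (H * t))"
      by (simp add: power2_eq_square)
    also have "sqrt \<dots> = sqrt 200 * (real N * v)"
      by (simp only: real_sqrt_mult v_def) simp
    finally have "exp (pi / 2) * (Jm * sqrt (5 * real N * H * (\<Sum>n=1..N. (?g n)\<^sup>2)))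
        \<le> exp (pi / 2) * (Jm * (sqrt 200 * (real N * v)))"
      using Qpos by (intro mult_left_mono) (auto simp: Jm_def)
    also have "\<dots> = (exp (pi / 2) * sqrt 200 * D0) * (Q * sqrt (real N) * v / (8 * D0))"
    proof -
      define s where "s = sqrt (real N)"
      have s: "s * s = real N" "s \<noteq> 0" using sN1 by (auto simp: s_def)
      have "Jm * (s * s) = Q * s / 8" using s(2) by (simp add: Jm_def s_def[symmetric])
      then have "Jm * real N = Q * sqrt (real N) / 8" unfolding s(1) unfolding s_def .
      then have "Jm * (sqrt 200 * (real N * v)) = sqrt 200 * (Q * sqrt (real N) / 8) * v"
        by (simp add: mult_ac)
      then show ?thesis using D0_pos by simp
    qed
    also have "\<dots> \<le> (4 * sqrt h * real N powr \<delta>) * (Q * sqrt (real N) * v / (8 * D0))"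
      using N(4) Qpos v0 D0_pos by (intro mult_right_mono) auto
    also have "\<dots> = (sqrt h * (sqrt (real N) * real N powr \<delta>)) * (Q * v / (2 * D0))"
      by simp
    also have "\<dots> \<le> (v * Q) * (Q * v / (2 * D0))"
      using vh Qs v0 Qpos D0_pos by (intro mult_right_mono mult_mono) auto
    also have "\<dots> = (v * v) * Q\<^sup>2 / (2 * D0)" by (simp add: power2_eq_square)
    also have "\<dots> = H * B / 2" by (simp add: v2 B_def mult_ac)
    finally show ?thesis .
  qed
  have key: "h * t \<le> H * t * t" using Ht t0 by (intro mult_right_mono) auto
  have Q_small: "2 * Q ^ 5 \<le> real N * H * B\<^sup>2"
  proof -
    \<comment> \<open>\<open>\<eta> = h / (2 * D0^2)\<close> is chosen so that
      \<open>Q \<le> \<eta> * N * t\<close> is exactly this inequality.\<close>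
    have "2 * Q * D0\<^sup>2 \<le> real N * (h * t)" using Q(3) D0_pos unfolding \<eta> by (simp add: field_simps)
    also have "\<dots> \<le> real N * (H * t * t)" using key by (intro mult_left_mono) auto
    finally have "2 * Q * D0\<^sup>2 * (Q ^ 4 / D0\<^sup>2) \<le> real N * (H * t * t) * (Q ^ 4 / D0\<^sup>2)"
      by (intro mult_right_mono) auto
    moreover have "2 * Q * D0\<^sup>2 * (Q ^ 4 / D0\<^sup>2) = 2 * Q ^ 5" using D0_pos by (simp add: power_numeral_reduce)
    moreover have "real N * (H * t * t) * (Q ^ 4 / D0\<^sup>2) = real N * H * B\<^sup>2"
      by (simp add: B_def power_numeral_reduce power_divide power_mult_distrib)
    ultimately show ?thesis by simp
  qed
  have "\<eta> * t * Q * real N = (h * t) * (Q * real N / (2 * D0\<^sup>2))" by (simp add: \<eta>)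
  also have "\<dots> \<le> (H * t * t) * (Q * real N / (2 * D0\<^sup>2))"
    using Qpos by (intro mult_right_mono[OF key]) auto
  also have "\<dots> = H * B\<^sup>2 * real N / (2 * Q ^ 3)"
    using Qpos D0_pos by (simp add: B_def power_numeral_reduce power_divide power_mult_distrib mult_ac)
  also have "\<dots> \<le> ap_variance N Q (\<lambda>n. of_real (1 - ?g n))"
    using corr by (intro variance_lower[OF Bpos Hpos _ Jm err_small Q_small]) auto
  finally show ?thesis by (simp only: indicator_smooth)
qed

section \<open>The theorem\<close>

text \<open>The last condition places the threshold \<open>\<eta> * N * t\<close> itself in the
  admissible range of \<open>Q\<close>, as \<open>t \<ge> 1 / ln N\<close>; it holds for large
  \<open>N\<close> because \<open>1 / 2 + \<delta> \<le> 3 / 4\<close>.\<close>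

lemma eventually_large:
  fixes \<delta> \<eta> a b c :: real
  assumes "0 < \<delta>" "\<delta> \<le> 1 / 4" "0 < \<eta>" "0 < c"
  shows "eventually (\<lambda>N::nat. a \<le> ln (real N) \<and> b \<le> \<delta> * ln (real N) \<and> 8 \<le> real N powr (\<delta> / 2)
    \<and> b \<le> c * real N powr \<delta> \<and> 128 \<le> real N powr (1 / 2 + \<delta>)
    \<and> 200 * real N \<le> (real N powr (1 / 2 + \<delta>))\<^sup>2
    \<and> real N powr (1 / 2 + \<delta>) \<le> \<eta> * real N / ln (real N)) sequentially"
proof (intro eventually_conj)
  have lnN: "filterlim (\<lambda>N::nat. ln (real N)) at_top sequentially"
    by (rule filterlim_compose[OF ln_at_top filterlim_real_sequentially])
  have pw: "filterlim (\<lambda>N::nat. real N powr e) at_top sequentially" if "e > 0" for e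
  proof -
    have "filterlim (\<lambda>x::real. x powr e) at_top at_top" using that by real_asymp
    then show ?thesis by (rule filterlim_compose[OF _ filterlim_real_sequentially])
  qed
  note ge = filterlim_at_top[THEN iffD1, rule_format]
  show "eventually (\<lambda>N::nat. a \<le> ln (real N)) sequentially" by (rule ge[OF lnN])
  show "eventually (\<lambda>N::nat. b \<le> \<delta> * ln (real N)) sequentially"
    using ge[OF lnN, of "b / \<delta>"] by eventually_elim (use assms in \<open>simp add: field_simps\<close>)
  show "eventually (\<lambda>N::nat. 8 \<le> real N powr (\<delta> / 2)) sequentially" using assms by (intro ge pw) auto
  show "eventually (\<lambda>N::nat. b \<le> c * real N powr \<delta>) sequentially"
    using ge[OF pw[OF assms(1)], of "b / c"] by eventually_elim (use assms in \<open>simp add: field_simps\<close>)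
  show "eventually (\<lambda>N::nat. 128 \<le> real N powr (1 / 2 + \<delta>)) sequentially" using assms by (intro ge pw) auto
  have "eventually (\<lambda>N::nat. 200 \<le> real N powr (2 * \<delta>)) sequentially" using assms by (intro ge pw) auto
  then show "eventually (\<lambda>N::nat. 200 * real N \<le> (real N powr (1 / 2 + \<delta>))\<^sup>2) sequentially"
    using eventually_gt_at_top[of 0]
  proof eventually_elim
    case (elim N)
    have "(real N powr (1 / 2 + \<delta>))\<^sup>2 = real N powr (1 + 2 * \<delta>)"
      by (simp add: power2_eq_square powr_add[symmetric])
    also have "\<dots> = real N * real N powr (2 * \<delta>)" using elim by (simp add: powr_add)
    finally show ?case using elim by simp
  qed
  have "((\<lambda>x::real. ln x / x powr (1/4)) \<longlongrightarrow> 0) at_top" by real_asymp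
  then have "((\<lambda>N::nat. ln (real N) / real N powr (1/4)) \<longlongrightarrow> 0) sequentially"
    by (rule filterlim_compose[OF _ filterlim_real_sequentially])
  then have "eventually (\<lambda>N::nat. ln (real N) / real N powr (1/4) < \<eta>) sequentially"
    using assms(3) by (rule order_tendstoD(2))
  then show "eventually (\<lambda>N::nat. real N powr (1 / 2 + \<delta>) \<le> \<eta> * real N / ln (real N)) sequentially"
    using eventually_gt_at_top[of 1]
  proof eventually_elim
    case (elim N)
    have N: "real N > 1" using elim by simp
    have "real N powr (1 / 2 + \<delta>) * ln (real N) \<le> real N powr (3/4) * (\<eta> * real N powr (1/4))"
      using elim assms N by (intro mult_mono powr_mono) (auto simp: field_simps)
    also have "\<dots> = \<eta> * (real N powr (3/4) * real N powr (1/4))" by simp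
    also have "\<dots> = \<eta> * real N" using N by (simp only: powr_add[symmetric]) simp
    finally show ?case using N by (simp add: field_simps)
  qed
qed

theorem theorem1p7:
  "\<exists>\<delta>\<^sub>0>0. \<forall>\<delta>::real. 0 < \<delta> \<and> \<delta> < \<delta>\<^sub>0 \<longrightarrow>
    (\<exists>C>0::real. \<exists>\<kappa>>0::real. \<exists>N\<^sub>0::nat. \<forall>(N::nat) (Q::real) (y::real) (u::real).
      N \<ge> N\<^sub>0 \<and> real N powr (1 / 2 + \<delta>) \<le> Q \<and> Q \<le> real N \<and>
      y > 1 \<and> u = ln (real N) / ln y \<and>
      1 + ln C / ln (real N) \<le> u \<and> u \<le> 2 \<longrightarrow>
      ap_variance N Q (indicator (smooth_numbers y))
        \<ge> \<kappa> * (Q * real N * ln u + Q\<^sup>2))"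
proof -
  obtain a :: real where a: "a > 1"
    and primes: "\<And>x. x \<ge> a \<Longrightarrow> real (card (primes_between (x / a) x)) \<ge> x / (a * ln x)"
    using card_primes_between_ge by blast
  obtain c1 :: real where c1: "c1 > 0"
    "\<And>M S. M \<ge> 2 \<Longrightarrow> S \<ge> 1 \<Longrightarrow> (\<Sum>s\<in>rough_squarefree M S. 1 / real s) \<ge> c1 * ln S / ln M"
    using sum_inverse_rough_squarefree_ge by blast
  obtain c2 :: real where "c2 \<ge> 0" and c2: "\<And>X Y. 1 \<le> X \<Longrightarrow> X \<le> Y \<Longrightarrow> 1 < Y \<Longrightarrow>
      (\<Sum>p\<in>primes_between X Y. 1 / real p) \<ge> (ln Y - ln X - c2) / ln Y"
    by (rule sum_inverse_primes_between) (rule that)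
  define D0 where "D0 = 2048 * a\<^sup>2"
  have D0: "D0 > 0" using a by (simp add: D0_def)
  show ?thesis
  \<comment> \<open>\<open>10 * \<delta> \<le> 1 / D0\<close> bounds the loss from the multiples of
    the large prime in the case \<open>t \<ge> 1 / 4\<close>.\<close>
  proof (rule exI[of _ "min (1 / 4) (1 / (10 * D0))"], intro conjI allI impI)
    show "min (1 / 4) (1 / (10 * D0)) > 0" using D0 by simp
    fix \<delta> :: real assume "0 < \<delta> \<and> \<delta> < min (1 / 4) (1 / (10 * D0))"
    then have \<delta>: "0 < \<delta>" "\<delta> \<le> 1 / 4" "10 * \<delta> \<le> 1 / D0" using D0 by (auto simp: field_simps)
    define h where "h = c1 * \<delta>\<^sup>2 / 64"
    define \<eta> where "\<eta> = h / (2 * D0\<^sup>2)"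
    have h: "h > 0" using c1 \<delta> by (simp add: h_def)
    have \<eta>: "\<eta> > 0" using h D0 by (simp add: \<eta>_def)
    define b where "b = max (16 * c2) (exp (pi / 2) * sqrt 200 * D0)"
    obtain N0 where N0: "\<And>N. N \<ge> N0 \<Longrightarrow> 20 * D0 \<le> ln (real N) \<and> b \<le> \<delta> * ln (real N) \<and> 8 \<le> real N powr (\<delta> / 2)
      \<and> b \<le> (4 * sqrt h) * real N powr \<delta> \<and> 128 \<le> real N powr (1 / 2 + \<delta>)
      \<and> 200 * real N \<le> (real N powr (1 / 2 + \<delta>))\<^sup>2
      \<and> real N powr (1 / 2 + \<delta>) \<le> \<eta> * real N / ln (real N)"
      using eventually_large[OF \<delta>(1,2) \<eta>, of "4 * sqrt h" "20 * D0" b] h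
      unfolding eventually_sequentially by auto
    \<comment> \<open>A square, because \<open>ln C \<le> u * ln M\<close> and
      \<open>u \<le> 2\<close> yield only half of \<open>ln C\<close> for \<open>ln M\<close>. Then
      \<open>M \<ge> a^2 + 3\<close> covers \<open>a^2 \<le> M\<close>, \<open>2 \<le> M\<close>
      and, as \<open>exp 1 \<le> 3\<close>, also \<open>1 \<le> ln M\<close>.\<close>
    define C where "C = (a\<^sup>2 + 3)\<^sup>2"
    \<comment> \<open>\<open>5120 = 40 * 128\<close>: for \<open>Q \<ge> K * N * t\<close> the bound
      \<open>40 * N * t\<close> for the number of nonsmooth integers is at most
      \<open>Q / 128\<close>.\<close>
    define K :: real where "K = 5120"
    \<comment> \<open>One constant for each of the three ranges separated by
      \<open>\<eta> * N * t\<close> and \<open>K * N * t\<close>.\<close>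
    define \<kappa> where "\<kappa> = min (\<eta> / (2 + \<eta>)) (min (\<eta>\<^sup>2 / (2 * K + K\<^sup>2)) (1 / 409600))"
    have C: "C > 0" by (simp add: C_def) (smt (verit) zero_le_power2)
    have \<kappa>_le: "\<kappa> \<le> \<eta> / (2 + \<eta>)" "\<kappa> \<le> \<eta>\<^sup>2 / (2 * K + K\<^sup>2)" "\<kappa> \<le> 1 / 409600"
      unfolding \<kappa>_def by linarith+
    have \<kappa>: "\<kappa> > 0" using \<eta> by (simp add: \<kappa>_def K_def)
    show "\<exists>C>0::real. \<exists>\<kappa>>0::real. \<exists>N\<^sub>0::nat. \<forall>(N::nat) (Q::real) (y::real) (u::real).
      N \<ge> N\<^sub>0 \<and> real N powr (1 / 2 + \<delta>) \<le> Q \<and> Q \<le> real N \<and>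
      y > 1 \<and> u = ln (real N) / ln y \<and>
      1 + ln C / ln (real N) \<le> u \<and> u \<le> 2 \<longrightarrow>
      ap_variance N Q (indicator (smooth_numbers y))
        \<ge> \<kappa> * (Q * real N * ln u + Q\<^sup>2)"
    proof (rule exI[of _ C], rule conjI[OF C], rule exI[of _ \<kappa>], rule conjI[OF \<kappa>], rule exI[of _ N0],
        intro allI impI, elim conjE)
      fix N :: nat and Q y u :: real
      assume N: "N \<ge> N0" and Q: "real N powr (1 / 2 + \<delta>) \<le> Q" "Q \<le> real N" and y: "y > 1"
        and u: "u = ln (real N) / ln y" "1 + ln C / ln (real N) \<le> u" "u \<le> 2"
      let ?V = "\<lambda>Q. ap_variance N Q (indicator (smooth_numbers y))"
      note NN = N0[OF N]
      define L where "L = ln (real N)"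
      have L: "L > 0" using NN D0 unfolding L_def by (smt (verit) mult_pos_pos)
      have N1: "N > 1" using L unfolding L_def by (cases "N = 0 \<or> N = 1") auto
      have ly: "ln y > 0" using y by simp
      have uly: "u * ln y = L" using u(1) ly by (simp add: L_def)
      have "L \<le> 2 * ln y" using uly u(3) ly by (metis mult_right_mono less_imp_le)
      then have "ln (real N) \<le> ln (y\<^sup>2)" using y by (simp add: ln_realpow L_def)
      then have Ny: "real N \<le> y\<^sup>2" using y N1 by simp
      define M where "M = real N / y"
      have lnM: "ln M = L - ln y" unfolding M_def L_def using N1 y by (intro ln_divide_pos) auto
      have sC: "ln C = 2 * ln (a\<^sup>2 + 3)" unfolding C_def by (intro ln_realpow[of _ 2, simplified])
      have "ln C / L \<le> u - 1" using u(2) by (simp add: L_def)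
      then have "ln C \<le> (u - 1) * L" using L by (simp add: field_simps)
      also have "\<dots> = u * (L - ln y)" using uly by (simp add: algebra_simps)
      finally have lC: "ln C \<le> u * ln M" by (simp add: lnM)
      have e3: "exp 1 \<le> a\<^sup>2 + 3" using exp_le by (smt (verit) zero_le_power2)
      then have l1: "1 \<le> ln (a\<^sup>2 + 3)" by (metis exp_gt_zero ln_exp ln_mono)
      have u0: "u > 0" using uly L ly by (metis zero_less_mult_pos2)
      have "ln M > 0" using lC sC l1 u0 by (smt (verit) zero_less_mult_pos)
      then have "u * ln M \<le> 2 * ln M" using u(3) by (intro mult_right_mono) auto
      then have lnM_ge: "ln (a\<^sup>2 + 3) \<le> ln M" using lC sC by linarith
      have Mpos: "M > 0" using N1 y by (simp add: M_def)
      have M: "a\<^sup>2 + 3 \<le> M" using lnM_ge Mpos by (smt (verit) ln_le_cancel_iff zero_le_power2)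
      have M': "a\<^sup>2 \<le> real N / y" "2 \<le> real N / y" "1 \<le> ln (real N / y)"
        using M l1 lnM_ge unfolding M_def[symmetric] by (smt (verit) zero_le_power2)+
      define t where "t = ln (real N / y) / ln (real N)"
      have tL: "t * L = ln M" using L by (simp add: t_def M_def L_def)
      have t0: "t > 0" using tL L \<open>ln M > 0\<close> by (metis zero_less_mult_pos2)
      have tinv: "1 / L \<le> t" using M'(3) L by (simp add: t_def L_def divide_right_mono)
      have lnu: "ln u \<le> 2 * t"
      proof -
        \<comment> \<open>The exact relation is \<open>u - 1 = u * t\<close>; with
          \<open>ln u \<le> u - 1\<close> and \<open>u \<le> 2\<close> it replaces
          \<open>ln u\<close> by \<open>t\<close>.\<close>
        have "(u - 1) * L = u * (t * L)"
          by (simp only: tL lnM left_diff_distrib right_diff_distrib uly mult_1)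
        then have "u - 1 = u * t" using L by simp
        moreover have "u * t \<le> 2 * t" using u(3) t0 by (intro mult_right_mono) auto
        ultimately show ?thesis using ln_le_minus_one[OF u0] by linarith
      qed
      have Q128: "128 \<le> Q" using NN Q by linarith
      then have Qpos: "Q > 0" by linarith
      have T: "Q * real N * ln u \<le> 2 * (Q * real N * t)"
      proof -
        have "Q * real N * ln u \<le> Q * real N * (2 * t)" using lnu Qpos by (intro mult_left_mono) auto
        then show ?thesis by simp
      qed
      have small: "\<eta> * t * P * real N \<le> ?V P"
        if "real N powr (1 / 2 + \<delta>) \<le> P" "P \<le> real N" "P \<le> \<eta> * real N * t" for P
        using variance_lower_small_moduli[OF a primes c1 c2 D0_def h_def \<eta>_def \<delta> _ _ _ _ y Ny M'(1,3,2) t_def that] NN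
        by (auto simp: b_def)
      show "?V Q \<ge> \<kappa> * (Q * real N * ln u + Q\<^sup>2)"
      proof (cases "Q \<le> \<eta> * real N * t")
        case True
        have "Q\<^sup>2 \<le> \<eta> * (Q * real N * t)"
          using mult_left_mono[OF True, of Q] Qpos by (simp add: power2_eq_square mult_ac)
        then have "Q * real N * ln u + Q\<^sup>2 \<le> (2 + \<eta>) * (Q * real N * t)" using T by (simp add: algebra_simps)
        then have "\<kappa> * (Q * real N * ln u + Q\<^sup>2) \<le> \<kappa> * ((2 + \<eta>) * (Q * real N * t))"
          using \<kappa> by (intro mult_left_mono) auto
        also have "\<dots> \<le> (\<eta> / (2 + \<eta>)) * ((2 + \<eta>) * (Q * real N * t))"
          using \<eta> t0 Qpos by (intro mult_right_mono \<kappa>_le) auto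
        also have "\<dots> = \<eta> * t * Q * real N" using \<eta> by simp
        also have "\<dots> \<le> ?V Q" by (rule small[OF Q True])
        finally show ?thesis .
      next
        case False
        show ?thesis
        proof (cases "Q \<le> K * real N * t")
          case True
          \<comment> \<open>Here \<open>Q\<close> and \<open>N * t\<close> have the same order, so
            the bound at the smaller \<open>?P\<close> carries over by monotonicity.\<close>
          let ?P = "\<eta> * real N * t"
          have "real N powr (1 / 2 + \<delta>) \<le> \<eta> * real N * (1 / L)" using NN by (simp add: L_def)
          also have "\<dots> \<le> ?P" using tinv \<eta> by (intro mult_left_mono) auto
          finally have P: "real N powr (1 / 2 + \<delta>) \<le> ?P" .
          have "Q\<^sup>2 \<le> (K * real N * t)\<^sup>2" using True Qpos by (intro power_mono) auto
          moreover have "Q * real N * t \<le> K * real N * t * real N * t"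
            using True t0 by (intro mult_right_mono) auto
          ultimately have "Q * real N * ln u + Q\<^sup>2 \<le> (2 * K + K\<^sup>2) * (real N * t)\<^sup>2"
            using T by (simp add: algebra_simps power2_eq_square)
          then have "\<kappa> * (Q * real N * ln u + Q\<^sup>2) \<le> \<kappa> * ((2 * K + K\<^sup>2) * (real N * t)\<^sup>2)"
            using \<kappa> by (intro mult_left_mono) auto
          also have "\<dots> \<le> (\<eta>\<^sup>2 / (2 * K + K\<^sup>2)) * ((2 * K + K\<^sup>2) * (real N * t)\<^sup>2)"
            by (intro mult_right_mono \<kappa>_le) (auto simp: K_def)
          also have "\<dots> = \<eta> * t * ?P * real N" by (simp add: K_def power2_eq_square)
          also have "\<dots> \<le> ?V ?P" using P False Q(2) by (intro small) auto
          also have "\<dots> \<le> ?V Q" using False by (intro ap_variance_mono) auto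
          finally show ?thesis .
        next
          case False
          have "(\<Sum>n=1..N. nonsmooth_indicator y n) = (\<Sum>n=1..N. nonsmooth_indicator y n * 1)" by simp
          also have "\<dots> = real (card (nonsmooth N y))" by (subst sum_nonsmooth_indicator) simp
          also have "\<dots> \<le> 40 * real N * t" unfolding t_def by (rule card_nonsmooth_le[OF y Ny N1 M'(3)])
          also have "\<dots> \<le> Q / 128" using False by (simp add: K_def)
          finally have g: "(\<Sum>n=1..N. nonsmooth_indicator y n) \<le> Q / 128" .
          have "(real N powr (1 / 2 + \<delta>))\<^sup>2 \<le> Q\<^sup>2" using Q by (intro power_mono) auto
          then have "200 * real N \<le> Q\<^sup>2" using NN by linarith
          then have V: "Q\<^sup>2 / 204800 \<le> ?V Q"
            unfolding indicator_smooth using Q Q128 g by (intro variance_lower_square) (auto simp: nonsmooth_indicator_def)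
          have "K * (Q * real N * t) \<le> Q\<^sup>2"
            using False Qpos mult_left_mono[of "K * real N * t" Q Q] by (simp add: power2_eq_square mult_ac)
          moreover have "Q * real N * t \<ge> 0" using Qpos t0 by simp
          ultimately have "Q * real N * ln u + Q\<^sup>2 \<le> 2 * Q\<^sup>2" using T unfolding K_def by linarith
          then have "\<kappa> * (Q * real N * ln u + Q\<^sup>2) \<le> \<kappa> * (2 * Q\<^sup>2)"
            using \<kappa> by (intro mult_left_mono) auto
          also have "\<dots> \<le> 1 / 409600 * (2 * Q\<^sup>2)" by (intro mult_right_mono \<kappa>_le) auto
          also have "\<dots> \<le> ?V Q" using V by simp
          finally show ?thesis .
        qed
      qed
    qed
  qed
qed

end
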